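(* For any $0\le s\le\frac12$, $1<p<\infty$, $2<r\le\infty$ there exist vector fields $u,v,w\in B^s_{p,r}(\mathbb R^3)$ and smooth, rapidly decaying vector fields $u_n,v_n,w_n$ on $\mathbb R^3$, with $\nabla\cdot u_n=0$, such that $\lim_{n\to\infty}u_n=u$, $\lim_{n\to\infty}v_n=v$, $\lim_{n\to\infty}w_n=w$ hold in the norm of $B^s_{p,r}$ and such that $$\lim_{n\to\infty}\langle B(u_n,v_n),w_n\rangle=\infty .$$
   Context: All vector fields are $\mathbb R^3$-valued on $\mathbb R^3$. Littlewood-Paley notation: $\lambda_q=2^q$; fix a nonnegative radial $\chi\in C_0^\infty(B(0,1))$ with $\chi(\xi)=1$ for $|\xi|\le 1/2$, $\varphi(\xi)=\chi(\xi/2)-\chi(\xi)$; $\Delta_q u=\mathcal F^{-1}(\varphi(\lambda_q^{-1}\xi)\mathcal F u)$ for $q\ge 0$, $\Delta_{-1}u=\mathcal F^{-1}(\chi\mathcal F u)$. The inhomogeneous Besov space $B^s_{p,r}$ is the space of tempered distributions with finite norm $\|u\|_{B^s_{p,r}}=\|\Delta_{-1}u\|_{L^p}+\|(\lambda_q^s\|\Delta_qu\|_{L^p})_{q\in\mathbb N}\|_{\ell^r(\mathbb N)}$, where $\mathbb N=\{0,1,2,\dots\}$. $B(u,v)=\mathbb P(u\cdot\nabla v)$ for $\nabla\cdot u=0$, where $\mathbb P$ is the Leray-Hodge projector onto divergence-free vector fields, and $\langle B(u,v),w\rangle=\int_{\mathbb R^3}B(u,v)\cdot w\,dx$. *)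

theory Defs
  imports "HOL-Analysis.Analysis"
begin

section \<open>Smooth and rapidly decaying functions\<close>

definition partial :: "3 \<Rightarrow> (real^3 \<Rightarrow> 'a::real_normed_vector) \<Rightarrow> real^3 \<Rightarrow> 'a"
  where "partial i f x = frechet_derivative f (at x) (axis i 1)"

definition partials :: "3 list \<Rightarrow> (real^3 \<Rightarrow> 'a::real_normed_vector) \<Rightarrow> real^3 \<Rightarrow> 'a"
  where "partials js f = foldr partial js f"

text \<open>A function all of whose iterated partial derivatives exist and are differentiable
  has continuous partial derivatives of every order, so this is the class \<open>C\<^sup>\<infinity>\<close>.\<close>

definition smooth :: "(real^3 \<Rightarrow> 'a::real_normed_vector) \<Rightarrow> bool"
  where "smooth f \<longleftrightarrow> (\<forall>js. partials js f differentiable_on UNIV)"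

definition schwartz :: "(real^3 \<Rightarrow> 'a::real_normed_vector) \<Rightarrow> bool"
  where "schwartz f \<longleftrightarrow> smooth f \<and>
    (\<forall>js N. bounded (range (\<lambda>x. (1 + norm x) ^ N *\<^sub>R partials js f x)))"

definition schwartz_seminorm :: "nat \<Rightarrow> (real^3 \<Rightarrow> 'a::real_normed_vector) \<Rightarrow> real"
  where "schwartz_seminorm N f =
    (SUP (js, x) \<in> {js. length js \<le> N} \<times> UNIV. (1 + norm x) ^ N * norm (partials js f x))"

section \<open>Fourier transform\<close>

text \<open>Normalisation: \<open>\<integral> e\<^bsup>-i x \<xi>\<^esup> f(x) dx\<close>, with the factor \<open>(2\<pi>)\<^sup>-\<^sup>3\<close> in the inverse.\<close>

definition fourier :: "(real^3 \<Rightarrow> complex) \<Rightarrow> real^3 \<Rightarrow> complex"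
  where "fourier f \<xi> = (\<integral>x. cis (- (x \<bullet> \<xi>)) * f x \<partial>lborel)"

definition inv_fourier :: "(real^3 \<Rightarrow> complex) \<Rightarrow> real^3 \<Rightarrow> complex"
  where "inv_fourier g x = (\<integral>\<xi>. cis (x \<bullet> \<xi>) * g \<xi> \<partial>lborel) / of_real ((2 * pi) ^ 3)"

section \<open>Vector-valued tempered distributions\<close>

text \<open>A \<open>\<complex>\<^sup>3\<close>-valued tempered distribution is a complex linear functional on scalar
  Schwartz functions that is continuous, i.e. dominated by one of the seminorms above (which
  are increasing in \<open>N\<close>). Its values off the Schwartz space are irrelevant.\<close>

type_synonym tdistr = "(real^3 \<Rightarrow> complex) \<Rightarrow> complex^3"

definition tempered :: "tdistr \<Rightarrow> bool"
  where "tempered T \<longleftrightarrow>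
    (\<forall>f g a b. schwartz f \<longrightarrow> schwartz g \<longrightarrow>
        T (\<lambda>x. a * f x + b * g x) = a *s T f + b *s T g) \<and>
    (\<exists>N C. \<forall>f. schwartz f \<longrightarrow> norm (T f) \<le> C * schwartz_seminorm N f)"

text \<open>The distributions with values in \<open>\<real>\<^sup>3\<close>: those equal to their complex conjugate.\<close>

definition real_distr :: "tdistr \<Rightarrow> bool"
  where "real_distr T \<longleftrightarrow>
    (\<forall>f i. schwartz f \<longrightarrow> T (\<lambda>x. cnj (f x)) $ i = cnj (T f $ i))"

definition cvec :: "real^3 \<Rightarrow> complex^3"
  where "cvec a = (\<chi> i. complex_of_real (a $ i))"

definition field_distr :: "(real^3 \<Rightarrow> real^3) \<Rightarrow> tdistr"
  where "field_distr u f = (\<integral>x. f x *s cvec (u x) \<partial>lborel)"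

definition distr_fourier :: "tdistr \<Rightarrow> tdistr"
  where "distr_fourier T f = T (fourier f)"

definition distr_inv_fourier :: "tdistr \<Rightarrow> tdistr"
  where "distr_inv_fourier T f = T (inv_fourier f)"

definition distr_mult :: "(real^3 \<Rightarrow> real) \<Rightarrow> tdistr \<Rightarrow> tdistr"
  where "distr_mult m T f = T (\<lambda>\<xi>. of_real (m \<xi>) * f \<xi>)"

section \<open>Littlewood-Paley blocks\<close>

definition lp_cutoff :: "(real^3 \<Rightarrow> real) \<Rightarrow> bool"
  where "lp_cutoff chi \<longleftrightarrow>
    smooth chi \<and> closure {\<xi>. chi \<xi> \<noteq> 0} \<subseteq> ball 0 1 \<and>
    (\<forall>\<xi>. chi \<xi> \<ge> 0) \<and> (\<forall>\<xi> \<eta>. norm \<xi> = norm \<eta> \<longrightarrow> chi \<xi> = chi \<eta>) \<and>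
    (\<forall>\<xi>. norm \<xi> \<le> 1/2 \<longrightarrow> chi \<xi> = 1)"

definition lp_phi :: "(real^3 \<Rightarrow> real) \<Rightarrow> real^3 \<Rightarrow> real"
  where "lp_phi chi \<xi> = chi ((1/2) *\<^sub>R \<xi>) - chi \<xi>"

definition lp_block_low :: "(real^3 \<Rightarrow> real) \<Rightarrow> tdistr \<Rightarrow> tdistr"
  where "lp_block_low chi T = distr_inv_fourier (distr_mult chi (distr_fourier T))"

definition lp_block :: "(real^3 \<Rightarrow> real) \<Rightarrow> nat \<Rightarrow> tdistr \<Rightarrow> tdistr"
  where "lp_block chi q T =
    distr_inv_fourier
      (distr_mult (\<lambda>\<xi>. lp_phi chi (inverse (2 ^ q) *\<^sub>R \<xi>)) (distr_fourier T))"

section \<open>Besov spaces\<close>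

text \<open>Used only for exponents \<open>a > 0\<close>.\<close>

definition epowr :: "ennreal \<Rightarrow> real \<Rightarrow> ennreal"
  where "epowr x a = (if x = \<infinity> then \<infinity> else ennreal (enn2real x powr a))"

definition Lp_norm :: "real \<Rightarrow> (real^3 \<Rightarrow> complex^3) \<Rightarrow> ennreal"
  where "Lp_norm p g = epowr (\<integral>\<^sup>+x. ennreal (norm (g x) powr p) \<partial>lborel) (1/p)"

definition represents :: "(real^3 \<Rightarrow> complex^3) \<Rightarrow> tdistr \<Rightarrow> bool"
  where "represents g T \<longleftrightarrow> g \<in> borel_measurable lborel \<and>
    (\<forall>f. schwartz f \<longrightarrow>
      integrable lborel (\<lambda>x. f x *s g x) \<and> T f = (\<integral>x. f x *s g x \<partial>lborel))"

text \<open>The representing function is unique up to null sets, so the infimum is the norm of that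
  function if there is one, and \<open>\<infinity>\<close> otherwise.\<close>

definition distr_Lp_norm :: "real \<Rightarrow> tdistr \<Rightarrow> ennreal"
  where "distr_Lp_norm p T = (INF g \<in> {g. represents g T}. Lp_norm p g)"

definition lr_norm :: "ennreal \<Rightarrow> (nat \<Rightarrow> ennreal) \<Rightarrow> ennreal"
  where "lr_norm r a =
    (if r = \<infinity> then (SUP q. a q)
     else epowr (\<Sum>q. epowr (a q) (enn2real r)) (1 / enn2real r))"

definition besov_norm ::
    "(real^3 \<Rightarrow> real) \<Rightarrow> real \<Rightarrow> real \<Rightarrow> ennreal \<Rightarrow> tdistr \<Rightarrow> ennreal"
  where "besov_norm chi s p r T =
    distr_Lp_norm p (lp_block_low chi T) +
    lr_norm r (\<lambda>q. ennreal ((2 ^ q) powr s) * distr_Lp_norm p (lp_block chi q T))"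

text \<open>The space of \<open>\<real>\<^sup>3\<close>-valued distributions in \<open>B\<^sup>s\<^sub>p\<^sub>,\<^sub>r\<close>.\<close>

definition besov_space ::
    "(real^3 \<Rightarrow> real) \<Rightarrow> real \<Rightarrow> real \<Rightarrow> ennreal \<Rightarrow> tdistr set"
  where "besov_space chi s p r =
    {T. tempered T \<and> real_distr T \<and> besov_norm chi s p r T < \<infinity>}"

definition besov_lim ::
    "(real^3 \<Rightarrow> real) \<Rightarrow> real \<Rightarrow> real \<Rightarrow> ennreal \<Rightarrow> (nat \<Rightarrow> real^3 \<Rightarrow> real^3) \<Rightarrow> tdistr \<Rightarrow> bool"
  where "besov_lim chi s p r un u \<longleftrightarrow>
    (\<lambda>n. besov_norm chi s p r (\<lambda>f. field_distr (un n) f - u f)) \<longlonglongrightarrow> 0"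

section \<open>The Euler nonlinearity\<close>

definition divergence :: "(real^3 \<Rightarrow> real^3) \<Rightarrow> real^3 \<Rightarrow> real"
  where "divergence u x = (\<Sum>i\<in>UNIV. partial i u x $ i)"

definition advect :: "(real^3 \<Rightarrow> real^3) \<Rightarrow> (real^3 \<Rightarrow> real^3) \<Rightarrow> real^3 \<Rightarrow> real^3"
  where "advect u v x = (\<Sum>j\<in>UNIV. u x $ j *\<^sub>R partial j v x)"

text \<open>The Leray-Hodge projector is the Fourier multiplier \<open>I - \<xi>\<otimes>\<xi> / |\<xi>|\<^sup>2\<close>. The transform of
  a real field \<open>f\<close> is Hermitian-symmetric and so is that of its projection; hence the inverse
  transform is real, and \<open>Re\<close> only adjusts its type. The junk value at \<open>\<xi> = 0\<close> is on a null set.\<close>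

definition leray :: "(real^3 \<Rightarrow> real^3) \<Rightarrow> real^3 \<Rightarrow> real^3"
  where "leray f x = (let F = (\<lambda>j. fourier (\<lambda>y. complex_of_real (f y $ j))) in
    \<chi> i. Re (inv_fourier
      (\<lambda>\<xi>. F i \<xi> - of_real (\<xi> $ i / (norm \<xi>)\<^sup>2) * (\<Sum>j\<in>UNIV. of_real (\<xi> $ j) * F j \<xi>)) x))"

definition euler_B :: "(real^3 \<Rightarrow> real^3) \<Rightarrow> (real^3 \<Rightarrow> real^3) \<Rightarrow> real^3 \<Rightarrow> real^3"
  where "euler_B u v = leray (advect u v)"

definition pairing :: "(real^3 \<Rightarrow> real^3) \<Rightarrow> (real^3 \<Rightarrow> real^3) \<Rightarrow> real"
  where "pairing f g = (\<integral>x. f x \<bullet> g x \<partial>lborel)"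

end

theory Submission
  imports Defs "HOL-Probability.Characteristic_Functions" "HOL-Probability.Sinc_Integral"
begin

text \<open>Put \<open>G(x) = exp (-|x|\<^sup>2/6)\<close> and \<open>a\<^sub>k = 2\<^bsup>-k/2\<^esup> (k+1)\<^bsup>-1/2\<^esup>\<close>, and take \<open>u\<close> proportional to
  \<open>(x\<^sub>2 G, -x\<^sub>1 G, 0)\<close>, \<open>v = S(x\<^sub>1) (0, 0, G)\<close> and \<open>w = \<Phi>(x\<^sub>1) (0, -x\<^sub>3 G, x\<^sub>2 G)\<close>, where
  \<open>S(t) = \<Sum> a\<^sub>k sin (2\<^sup>k t)\<close> and \<open>\<Phi>(t) = \<Sum> a\<^sub>k cos (2\<^sup>k t)\<close>. The block \<open>\<Delta>\<^sub>q\<close> of such a field is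
  \<open>O(\<Sum>\<^sub>k a\<^sub>k min(1, 2\<^bsup>k-q\<^esup>))\<close>, that is \<open>2\<^bsup>-q/2\<^esup> O((q+1)\<^bsup>-1/2\<^esup>)\<close>, in every \<open>L\<^sup>p\<close>; since \<open>r > 2\<close>
  and \<open>s \<le> 1/2\<close> the fields are in the Besov space and the partial sums converge there.
  As \<open>w\<close> is divergence free, the projector can be dropped from the trilinear form, and
  \<open>u \<cdot> \<nabla>v = x\<^sub>2 G\<^sup>2 S'(x\<^sub>1) e\<^sub>3\<close> gives \<open>\<integral> x\<^sub>2\<^sup>2 G\<^sup>3 S' \<Phi> dx\<close>. Its diagonal terms add up to a multiple of
  \<open>\<Sum> a\<^sub>k\<^sup>2 2\<^sup>k = \<Sum> 1/(k+1) = \<infinity>\<close>, and its off-diagonal terms are positive.\<close>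

section \<open>Fourier analysis on three-dimensional space\<close>

text \<open>The derivative in \<open>u \<cdot> \<nabla>v\<close> is paid half by \<open>v\<close>
  and half by \<open>w\<close>; up to a convergent scalar factor, \<open>u\<close> is a fixed smooth
  field. The weighted coefficients \<open>2 powr (k/2) * coef k\<close> are (k+1)^(-1/2), a sequence
  in l^r exactly for r > 2, and the trilinear form sees the sum of their squares. What fails is
  therefore square summability, at the critical smoothness 1/2. Gaussian envelopes turn every
  integral in the trilinear form into a closed expression with a sign. The price is that a wave
  times a Gaussian does not live in one dyadic shell, so the blocks cannot be read off from
  frequency supports. They are estimated in physical space instead: a block is the difference of
  averages of the field at the scales 2^-q and 2^-(q+1), and each average differs from the field by
  no more than its oscillation at that scale. All pointwise bounds are multiples of one integrable
  weight that is at most 1, so p enters only through a constant.\<close>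

lemma
  fixes f :: "'a::euclidean_space \<Rightarrow> 'b::{banach,second_countable_topology}"
  assumes [measurable]: "f \<in> borel_measurable borel" and c: "c \<noteq> 0"
  shows lborel_integral_affine:
      "(\<integral>x. f x \<partial>lborel) = \<bar>c\<bar> ^ DIM('a) *\<^sub>R (\<integral>x. f (t + c *\<^sub>R x) \<partial>lborel)" (is ?I)
    and lborel_integrable_affine_iff:
      "integrable lborel (\<lambda>x. f (t + c *\<^sub>R x)) \<longleftrightarrow> integrable lborel f" (is ?J)
proof -
  show ?I
    apply (subst lborel_affine[OF c, of t])
    apply (subst integral_density)
       apply (auto simp: integral_distr)
    done
  have "integrable lborel f \<longleftrightarrow>
    integrable (density (distr lborel borel (\<lambda>x. t + c *\<^sub>R x)) (\<lambda>_. \<bar>c\<bar> ^ DIM('a))) f"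
    using lborel_affine[OF c, of t] by simp
  also have "\<dots> \<longleftrightarrow> integrable lborel (\<lambda>x. f (t + c *\<^sub>R x))"
  proof -
    have *: "g = (\<lambda>x. inverse (\<bar>c\<bar> ^ DIM('a)) *\<^sub>R (\<bar>c\<bar> ^ DIM('a) *\<^sub>R g x))" for g :: "'a \<Rightarrow> 'b"
      using c by (auto simp: fun_eq_iff)
    show ?thesis
      using c by (subst integrable_density)
        (auto simp: integrable_distr_eq, subst *, rule integrable_scaleR_right)
  qed
  finally show ?J by simp
qed

lemma Basis_cart3: "(Basis :: (real^3) set) = {axis 1 1, axis 2 1, axis 3 1}"
  by (auto simp: Basis_vec_def UNIV_3)

lemma axis3_neq: "axis 1 (1::real) \<noteq> (axis 2 1 :: real^3)" "axis 1 (1::real) \<noteq> (axis 3 1 :: real^3)"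
  "axis 2 (1::real) \<noteq> (axis 3 1 :: real^3)"
  by (auto simp: axis_eq_axis)

text \<open>Lebesgue measure on \<open>real^3\<close> is the image of a product measure indexed by
  \<open>Basis\<close>. Arranging the three factors as a family \<open>F\<close> over the basis
  vectors makes the product rule for such measures applicable.\<close>

lemma
  fixes f g h :: "real \<Rightarrow> 'a::{real_normed_field,banach,second_countable_topology}"
  assumes f: "integrable lborel f" and g: "integrable lborel g" and h: "integrable lborel h"
  shows integral_prod3: "(\<integral>x. f (x$1) * g (x$2) * h (x$3) \<partial>(lborel :: (real^3) measure)) =
      (\<integral>x. f x \<partial>lborel) * (\<integral>x. g x \<partial>lborel) * (\<integral>x. h x \<partial>lborel)" (is ?I)
    and integrable_prod3: "integrable (lborel :: (real^3) measure) (\<lambda>x. f (x$1) * g (x$2) * h (x$3))" (is ?J)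
proof -
  define F where "F = (\<lambda>b::real^3. if b = axis 1 1 then f else if b = axis 2 1 then g else h)"
  interpret P: product_sigma_finite "\<lambda>_::real^3. lborel :: real measure" ..
  have [measurable]: "f \<in> borel_measurable borel" "g \<in> borel_measurable borel" "h \<in> borel_measurable borel"
    using f g h by (auto dest: borel_measurable_integrable)
  have Fint: "integrable lborel (F b)" for b using f g h by (auto simp: F_def)
  have *: "f (x$1) * g (x$2) * h (x$3) = (\<Prod>b\<in>Basis. F b (x \<bullet> b))" for x :: "real^3"
    by (simp add: Basis_cart3 axis3_neq axis3_neq[symmetric] F_def inner_axis mult.assoc)
  have **: "(\<Prod>b\<in>Basis. F b ((\<Sum>c\<in>Basis. y c *\<^sub>R c) \<bullet> b)) = (\<Prod>b\<in>Basis. F b (y b))" for y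
    by (intro prod.cong refl) (simp add: inner_sum_left inner_Basis if_distrib sum.delta cong: if_cong)
  have [measurable]: "(\<lambda>x::real^3. f (x$1) * g (x$2) * h (x$3)) \<in> borel_measurable borel" by measurable
  show ?I
    apply (subst lborel_eq)
    apply (subst integral_distr)
      apply simp
     apply simp
    apply (unfold * **)
    apply (subst P.product_integral_prod)
      apply simp
     apply (rule Fint)
    apply (simp add: Basis_cart3 axis3_neq axis3_neq[symmetric] F_def mult.assoc)
    done
  show ?J
    apply (subst lborel_eq)
    apply (subst integrable_distr_eq)
      apply simp
     apply simp
    apply (unfold * **)
    by (intro P.product_integrable_prod Fint) auto
qed

text \<open>The degree 6 lets (1 + |x|)^6 dominate the product of the three factors 1 + x_i^2, so
  that integrability reduces to the one-dimensional Cauchy density.\<close>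

definition decay :: "real^3 \<Rightarrow> real"
  where "decay x = inverse ((1 + norm x) ^ 6)"

lemma decay_pos: "0 < decay x"
  unfolding decay_def by (intro positive_imp_inverse_positive zero_less_power) (rule add_pos_nonneg, auto)

lemma decay_nonneg [simp]: "0 \<le> decay x"
  using decay_pos[of x] by simp

lemma decay_le_1: "decay x \<le> 1"
  unfolding decay_def inverse_le_1_iff by (intro disjI2 one_le_power) (simp only: le_add_same_cancel1 norm_ge_zero)

lemma measurable_decay [measurable]: "decay \<in> borel_measurable borel"
  unfolding decay_def[abs_def] by measurable

lemma integrable_cauchy: "integrable lborel (\<lambda>x::real. inverse (1 + x\<^sup>2))"
  using integrable_inverse_1_plus_square by (simp add: set_integrable_def)

lemma integrable_decay: "integrable lborel decay"
proof (rule Bochner_Integration.integrable_bound)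
  let ?c = "\<lambda>x::real. inverse (1 + x\<^sup>2)"
  show "integrable lborel (\<lambda>x::real^3. ?c (x$1) * ?c (x$2) * ?c (x$3))"
    by (intro integrable_prod3 integrable_cauchy)
  have "decay x \<le> ?c (x$1) * ?c (x$2) * ?c (x$3)" for x
  proof -
    have 1: "1 + (x$i)\<^sup>2 \<le> (1 + norm x)\<^sup>2" for i
    proof -
      have "(x$i)\<^sup>2 \<le> (norm x)\<^sup>2"
        using component_le_norm_cart[of x i] by (metis norm_ge_zero power2_abs power_mono abs_ge_zero)
      moreover have "(1 + norm x)\<^sup>2 = 1 + 2 * norm x + (norm x)\<^sup>2" by (simp add: power2_eq_square algebra_simps)
      ultimately show ?thesis using norm_ge_zero[of x] by linarith
    qed
    have 2: "0 < 1 + (x$i)\<^sup>2" for i by (simp add: add_pos_nonneg)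
    have "(1 + (x$1)\<^sup>2) * (1 + (x$2)\<^sup>2) * (1 + (x$3)\<^sup>2) \<le> (1 + norm x)\<^sup>2 * (1 + norm x)\<^sup>2 * (1 + norm x)\<^sup>2"
      by (intro mult_mono 1 mult_nonneg_nonneg) (auto intro: less_imp_le[OF 2])
    also have "\<dots> = (1 + norm x) ^ 6" by (simp add: power_add[symmetric])
    finally show ?thesis
      unfolding decay_def using 2 
      by (auto simp flip: inverse_mult_distrib intro!: le_imp_inverse_le mult_pos_pos)
  qed
  then show "AE x in lborel. norm (decay x) \<le> norm (?c (x$1) * ?c (x$2) * ?c (x$3))"
    by (auto simp: order_trans[OF _ abs_ge_self])
qed simp

text \<open>Peetre's inequality 1 + |x| \<le> (1 + |y|) (1 + |x - y|), raised to the sixth power: a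
  translation costs only a polynomial factor in its length.\<close>

lemma decay_shift: "decay (x - y) \<le> (1 + norm y) ^ 6 * decay x"
proof -
  have "1 + norm x \<le> 1 + norm (x - y) + norm y"
    using norm_triangle_ineq[of "x - y" y] by simp
  also have "\<dots> \<le> (1 + norm y) * (1 + norm (x - y))" by (simp add: algebra_simps)
  finally have "(1 + norm x) ^ 6 \<le> ((1 + norm y) * (1 + norm (x - y))) ^ 6" by (intro power_mono) auto
  then show ?thesis
    unfolding decay_def power_mult_distrib
    by (smt (verit) add_pos_nonneg divide_inverse norm_ge_zero pos_divide_le_eq pos_le_divide_eq zero_less_power mult.commute zero_less_one)
qed

lemma integrable_decay_bound:
  fixes f :: "real^3 \<Rightarrow> 'b::{banach,second_countable_topology}"
  assumes "f \<in> borel_measurable borel" "\<And>x. norm (f x) \<le> C * decay x"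
  shows "integrable lborel f"
proof (rule Bochner_Integration.integrable_bound)
  show "integrable lborel (\<lambda>x. C * decay x)" using integrable_decay by simp
qed (use assms in \<open>auto intro: order_trans[OF _ abs_ge_self]\<close>)

section \<open>Fourier integrals of integrable functions: continuity, bounds and exchange of
  integrals\<close>

lemma measurable_cis [measurable]: "cis \<in> borel_measurable borel"
  by (intro borel_measurable_continuous_onI continuous_intros)

lemma integrable_cis_mult:
  fixes f :: "real^3 \<Rightarrow> complex"
  assumes "integrable lborel f" "g \<in> borel_measurable borel"
  shows "integrable lborel (\<lambda>x. cis (g x) * f x)"
  using assms by (intro Bochner_Integration.integrable_bound[OF assms(1)]) (auto simp: norm_mult)

text \<open>The parameter \<open>c\<close> makes one proof by dominated convergence serve both
  transforms: \<open>c = -1\<close> gives \<open>fourier\<close>, and \<open>c = 1\<close> gives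
  \<open>inv_fourier\<close> up to its constant.\<close>

lemma continuous_fourier_kernel:
  fixes f :: "real^3 \<Rightarrow> complex"
  assumes f: "integrable lborel f"
  shows "continuous_on UNIV (\<lambda>\<xi>. \<integral>x. cis (c * (x \<bullet> \<xi>)) * f x \<partial>lborel)"
proof -
  have [measurable]: "f \<in> borel_measurable borel" using f by auto
  have "(\<lambda>n. \<integral>x. cis (c * (x \<bullet> (X n))) * f x \<partial>lborel) \<longlonglongrightarrow> (\<integral>x. cis (c * (x \<bullet> l)) * f x \<partial>lborel)"
    if "X \<longlonglongrightarrow> l" for X l
  proof (rule integral_dominated_convergence[where w="\<lambda>x. norm (f x)"])
    show "AE x in lborel. (\<lambda>n. cis (c * (x \<bullet> X n)) * f x) \<longlonglongrightarrow> cis (c * (x \<bullet> l)) * f x"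
      using that by (intro AE_I2 tendsto_intros)
  qed (use f in \<open>auto simp: norm_mult\<close>)
  then show ?thesis
    by (auto simp: continuous_on_sequentially comp_def)
qed

lemma fourier_alt: "fourier f \<xi> = (\<integral>x. cis ((-1) * (x \<bullet> \<xi>)) * f x \<partial>lborel)"
  by (simp add: fourier_def)

lemma inv_fourier_alt: "inv_fourier f \<xi> = (\<integral>x. cis (1 * (x \<bullet> \<xi>)) * f x \<partial>lborel) / of_real ((2 * pi) ^ 3)"
  by (simp add: inv_fourier_def inner_commute)

lemma inv_fourier_eq_fourier: "inv_fourier f x = fourier f (- x) / of_real ((2 * pi) ^ 3)"
  by (simp add: inv_fourier_def fourier_def inner_commute)

lemma continuous_on_fourier: "integrable lborel f \<Longrightarrow> continuous_on UNIV (fourier f)"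
  unfolding fourier_alt[abs_def] by (rule continuous_fourier_kernel)

lemma continuous_on_inv_fourier: "integrable lborel f \<Longrightarrow> continuous_on UNIV (inv_fourier f)"
  unfolding inv_fourier_alt[abs_def] by (intro continuous_intros continuous_fourier_kernel) auto

lemma measurable_fourier [measurable (raw)]: "integrable lborel f \<Longrightarrow> fourier f \<in> borel_measurable borel"
  by (intro borel_measurable_continuous_onI continuous_on_fourier)

lemma measurable_inv_fourier [measurable (raw)]: "integrable lborel f \<Longrightarrow> inv_fourier f \<in> borel_measurable borel"
  by (intro borel_measurable_continuous_onI continuous_on_inv_fourier)

lemma norm_fourier_le: "norm (fourier f \<xi>) \<le> (\<integral>x. norm (f x) \<partial>lborel)"
  unfolding fourier_def by (rule order_trans[OF integral_norm_bound]) (simp add: norm_mult)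

lemma norm_inv_fourier_le: "norm (inv_fourier f \<xi>) \<le> (\<integral>x. norm (f x) \<partial>lborel)"
proof -
  have "norm (inv_fourier f \<xi>) \<le> norm (fourier f (-\<xi>))"
  proof -
    \<comment> \<open>The normalising constant of the inverse is at least 1, so dividing by it only
      helps and the same bound holds for both transforms.\<close>
    have "1 \<le> (2 * pi) ^ 3" using pi_ge_two by (intro one_le_power) simp
    then show ?thesis
      unfolding inv_fourier_eq_fourier norm_divide norm_of_real
      using mult_left_mono[of 1 "(2 * pi) ^ 3" "norm (fourier f (- \<xi>))"] by (simp add: divide_le_eq)
  qed
  then show ?thesis using norm_fourier_le order_trans by blast
qed

text \<open>Fubini's theorem: the kernel has modulus 1, so |f(x) g(\<xi>)| is an integrable majorant
  on the product space. This exchange moves transforms between the two factors of an integral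
  throughout the development.\<close>

lemma fourier_kernel_swap:
  fixes f g :: "real^3 \<Rightarrow> complex"
  assumes f: "integrable lborel f" and g: "integrable lborel g"
  shows "(\<integral>\<xi>. (\<integral>x. cis (c * (x \<bullet> \<xi>)) * f x \<partial>lborel) * g \<xi> \<partial>lborel) =
    (\<integral>x. f x * (\<integral>\<xi>. cis (c * (\<xi> \<bullet> x)) * g \<xi> \<partial>lborel) \<partial>lborel)"
proof -
  have [measurable]: "f \<in> borel_measurable borel" "g \<in> borel_measurable borel" using f g by auto
  let ?F = "\<lambda>x \<xi>. cis (c * (x \<bullet> \<xi>)) * f x * g \<xi>"
  have int: "integrable (lborel \<Otimes>\<^sub>M lborel) (case_prod ?F)"
  proof (rule lborel_pair.Fubini_integrable)
    show "case_prod ?F \<in> borel_measurable (lborel \<Otimes>\<^sub>M lborel)" by measurable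
    show "integrable lborel (\<lambda>x. \<integral>y. norm (case_prod ?F (x, y)) \<partial>lborel)"
      using f by (simp add: norm_mult)
    show "AE x in lborel. integrable lborel (\<lambda>y. case_prod ?F (x, y))"
    proof (rule AE_I2)
      fix x
      have "integrable lborel (\<lambda>y. f x * (cis (c * (x \<bullet> y)) * g y))"
        by (intro integrable_mult_right integrable_cis_mult g) measurable
      then show "integrable lborel (\<lambda>y. case_prod ?F (x, y))" by (simp add: mult_ac)
    qed
  qed
  have "(\<integral>\<xi>. (\<integral>x. ?F x \<xi> \<partial>lborel) \<partial>lborel) = (\<integral>x. (\<integral>\<xi>. ?F x \<xi> \<partial>lborel) \<partial>lborel)"
    by (rule lborel_pair.Fubini_integral[OF int])
  moreover have "(\<integral>x. ?F x \<xi> \<partial>lborel) = (\<integral>x. cis (c * (x \<bullet> \<xi>)) * f x \<partial>lborel) * g \<xi>" for \<xi>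
    by (rule integral_mult_left_zero)
  moreover have "(\<integral>\<xi>. ?F x \<xi> \<partial>lborel) = f x * (\<integral>\<xi>. cis (c * (\<xi> \<bullet> x)) * g \<xi> \<partial>lborel)" for x
    by (subst integral_mult_right_zero[symmetric]) (simp add: mult_ac inner_commute)
  ultimately show ?thesis by simp
qed

lemma fourier_swap:
  assumes "integrable lborel f" and "integrable lborel g"
  shows "(\<integral>\<xi>. fourier f \<xi> * g \<xi> \<partial>lborel) = (\<integral>x. f x * fourier g x \<partial>lborel)"
  unfolding fourier_alt by (rule fourier_kernel_swap[OF assms])

lemma inv_fourier_swap:
  assumes "integrable lborel f" and "integrable lborel g"
  shows "(\<integral>\<xi>. inv_fourier f \<xi> * g \<xi> \<partial>lborel) = (\<integral>x. f x * inv_fourier g x \<partial>lborel)"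
  unfolding inv_fourier_alt using fourier_kernel_swap[OF assms, of 1] by simp


text \<open>The characteristic function of the standard normal distribution, freed from the
  normalisation of its density.\<close>

lemma
  shows integral_gauss_cis: "(\<integral>x. cis (t * x) * of_real (exp (- x\<^sup>2 / 2)) \<partial>lborel) = of_real (sqrt (2 * pi) * exp (- t\<^sup>2 / 2))" (is ?I)
    and integrable_gauss_cis: "integrable lborel (\<lambda>x. cis (t * x) * of_real (exp (- x\<^sup>2 / 2)))" (is ?J)
proof -
  have d: "std_normal_density x = exp (- x\<^sup>2 / 2) / sqrt (2 * pi)" for x :: real
    by (simp add: std_normal_density_def)
  have "of_real (exp (- t\<^sup>2 / 2)) = (\<integral>x. cis (t * x) \<partial>std_normal_distribution)"
    using fun_cong[OF char_std_normal_distribution, of t] by (simp add: char_def cis_conv_exp)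
  also have "\<dots> = (\<integral>x. std_normal_density x *\<^sub>R cis (t * x) \<partial>lborel)"
    by (subst integral_density) auto
  also have "\<dots> = (\<integral>x. (cis (t * x) * of_real (exp (- x\<^sup>2 / 2))) / of_real (sqrt (2 * pi)) \<partial>lborel)"
    by (intro Bochner_Integration.integral_cong refl) (simp add: d scaleR_conv_of_real)
  also have "\<dots> = (\<integral>x. (cis (t * x) * of_real (exp (- x\<^sup>2 / 2))) \<partial>lborel) / of_real (sqrt (2 * pi))"
    by simp
  finally show ?I by (simp add: field_simps)
  have "integrable lborel (\<lambda>x. sqrt (2 * pi) * std_normal_density x)"
    by (intro integrable_mult_right integrable_normal_density) auto
  then show ?J
    by (rule Bochner_Integration.integrable_bound) (auto simp: norm_mult d)
qed

definition gauss :: "real^3 \<Rightarrow> complex"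
  where "gauss x = of_real (exp (- (norm x)\<^sup>2 / 2))"

lemma norm_sq_3: "(norm (x::real^3))\<^sup>2 = (x$1)\<^sup>2 + (x$2)\<^sup>2 + (x$3)\<^sup>2"
  by (simp add: norm_vec_def L2_set_def sum_3 add_nonneg_nonneg)

lemma inner_3: "x \<bullet> y = x$1 * y$1 + x$2 * y$2 + x$3 * (y::real^3)$3"
  by (simp add: inner_vec_def sum_3)

lemma
  shows integrable_gauss: "integrable lborel gauss"
    and integral_gauss: "(\<integral>x. gauss x \<partial>lborel) = of_real (sqrt (2 * pi) ^ 3)"
    and fourier_gauss: "fourier gauss \<xi> = of_real (sqrt (2 * pi) ^ 3) * gauss \<xi>"
proof -
  let ?f = "\<lambda>t x::real. cis (t * x) * complex_of_real (exp (- x\<^sup>2 / 2))"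
  have *: "cis (- (x \<bullet> \<xi>)) * gauss x = ?f (- \<xi>$1) (x$1) * ?f (- \<xi>$2) (x$2) * ?f (- \<xi>$3) (x$3)" for x \<xi>
  proof -
    have "cis (- (x \<bullet> \<xi>)) = cis (- \<xi>$1 * x$1) * cis (- \<xi>$2 * x$2) * cis (- \<xi>$3 * x$3)"
      by (simp add: cis_mult inner_3 mult_ac)
    moreover have "gauss x = complex_of_real (exp (- (x$1)\<^sup>2 / 2)) * complex_of_real (exp (- (x$2)\<^sup>2 / 2)) * complex_of_real (exp (- (x$3)\<^sup>2 / 2))"
      unfolding gauss_def of_real_mult[symmetric] exp_add[symmetric] by (simp add: norm_sq_3 field_simps)
    ultimately show ?thesis by (simp add: mult_ac)
  qed
  have int: "integrable lborel (\<lambda>x. cis (- (x \<bullet> \<xi>)) * gauss x)" for \<xi>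
    unfolding * by (intro integrable_prod3 integrable_gauss_cis)
  from int[of 0] show "integrable lborel gauss" by simp
  have F: "fourier gauss \<xi> = of_real (sqrt (2 * pi) ^ 3) * gauss \<xi>" for \<xi>
  proof -
    have "fourier gauss \<xi> = (\<integral>x. ?f (- \<xi>$1) x \<partial>lborel) * (\<integral>x. ?f (- \<xi>$2) x \<partial>lborel) * (\<integral>x. ?f (- \<xi>$3) x \<partial>lborel)"
      unfolding fourier_def * by (rule integral_prod3 integrable_gauss_cis)+
    also have "\<dots> = of_real (sqrt (2 * pi) ^ 3 * exp (- (norm \<xi>)\<^sup>2 / 2))"
    proof -
      have "exp (- (norm \<xi>)\<^sup>2 / 2) = exp (- (- \<xi>$1)\<^sup>2 / 2) * exp (- (- \<xi>$2)\<^sup>2 / 2) * exp (- (- \<xi>$3)\<^sup>2 / 2)"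
        unfolding exp_add[symmetric] by (simp add: norm_sq_3 field_simps)
      then show ?thesis
        unfolding integral_gauss_cis of_real_mult[symmetric] by (simp only: power3_eq_cube mult_ac)
    qed
    finally show ?thesis by (simp add: gauss_def)
  qed
  show "fourier gauss \<xi> = of_real (sqrt (2 * pi) ^ 3) * gauss \<xi>" by (rule F)
  from F[of 0] show "(\<integral>x. gauss x \<partial>lborel) = of_real (sqrt (2 * pi) ^ 3)"
    by (simp add: fourier_def gauss_def)
qed

text \<open>Regularise with the Gaussian \<open>gauss (\<epsilon> x)\<close>, for which both sides can be computed by
  exchanging the integrals, and let \<open>\<epsilon> \<rightarrow> 0\<close>.\<close>

lemma integral_inv_fourier:
  assumes f: "integrable lborel f" and cont: "continuous_on UNIV f"
    and bdd: "\<And>x. norm (f x) \<le> C" and K: "integrable lborel (inv_fourier f)"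
  shows "(\<integral>x. inv_fourier f x \<partial>lborel) = f 0"
proof -
  define e where "e n = inverse (real (Suc n))" for n
  have e: "e n > 0" for n by (simp add: e_def)
  have e0: "e \<longlonglongrightarrow> 0" unfolding e_def by (rule LIMSEQ_inverse_real_of_nat)
  have [measurable]: "f \<in> borel_measurable borel" "gauss \<in> borel_measurable borel"
    "inv_fourier f \<in> borel_measurable borel"
    using f integrable_gauss K by auto
  have g1: "norm (gauss x) \<le> 1" for x by (simp add: gauss_def)
  have cg: "isCont gauss x" for x unfolding gauss_def by (intro continuous_intros) auto
  have inv_gauss: "inv_fourier gauss x = gauss x / of_real (sqrt (2 * pi) ^ 3)" for x
  proof -
    have "(2 * pi) ^ 3 = sqrt (2 * pi) ^ 3 * sqrt (2 * pi) ^ 3"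
      by (simp add: power_mult_distrib[symmetric])
    then show ?thesis
      unfolding inv_fourier_eq_fourier fourier_gauss by (simp add: gauss_def field_simps)
  qed
  have eq: "(\<integral>x. inv_fourier f x * gauss (e n *\<^sub>R x) \<partial>lborel) =
     (\<integral>x. f (e n *\<^sub>R x) * gauss x \<partial>lborel) / of_real (sqrt (2 * pi) ^ 3)" for n
  proof -
    let ?g = "\<lambda>x. gauss (e n *\<^sub>R x)"
    have ig: "integrable lborel ?g"
      using lborel_integrable_affine_iff[of gauss "e n" 0] e[of n] integrable_gauss by simp
    have fg: "inv_fourier ?g (e n *\<^sub>R x) = inv_fourier gauss x / of_real (e n ^ 3)" for x
    proof -
      have "(\<integral>\<xi>. cis (x \<bullet> \<xi>) * gauss \<xi> \<partial>lborel) = e n ^ 3 *\<^sub>R (\<integral>\<xi>. cis (e n *\<^sub>R x \<bullet> \<xi>) * gauss (e n *\<^sub>R \<xi>) \<partial>lborel)"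
        using e[of n] by (subst lborel_integral_affine[of _ "e n" 0]) auto
      then show ?thesis using e[of n]
        by (simp add: inv_fourier_def scaleR_conv_of_real)
    qed
    have "(\<integral>x. inv_fourier f x * ?g x \<partial>lborel) = (\<integral>x. f x * inv_fourier ?g x \<partial>lborel)"
      by (rule inv_fourier_swap[OF f ig])
    also have "\<dots> = e n ^ 3 *\<^sub>R (\<integral>x. f (e n *\<^sub>R x) * inv_fourier ?g (e n *\<^sub>R x) \<partial>lborel)"
      using e[of n] ig by (subst lborel_integral_affine[of _ "e n" 0]) auto
    also have "\<dots> = (\<integral>x. e n ^ 3 *\<^sub>R (f (e n *\<^sub>R x) * inv_fourier ?g (e n *\<^sub>R x)) \<partial>lborel)"
      by simp
    also have "\<dots> = (\<integral>x. (f (e n *\<^sub>R x) * gauss x) / of_real (sqrt (2 * pi) ^ 3) \<partial>lborel)"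
      using e[of n] by (intro Bochner_Integration.integral_cong refl)
        (simp add: fg inv_gauss scaleR_conv_of_real[where 'a=complex])
    finally show ?thesis by simp
  qed
  have "(\<lambda>n. \<integral>x. inv_fourier f x * gauss (e n *\<^sub>R x) \<partial>lborel) \<longlonglongrightarrow> (\<integral>x. inv_fourier f x * gauss (0 *\<^sub>R x) \<partial>lborel)"
  proof (rule integral_dominated_convergence[where w="\<lambda>x. norm (inv_fourier f x)"])
    show "AE x in lborel. (\<lambda>n. inv_fourier f x * gauss (e n *\<^sub>R x)) \<longlonglongrightarrow> inv_fourier f x * gauss (0 *\<^sub>R x)"
      by (intro AE_I2 tendsto_intros isCont_tendsto_compose[OF cg] e0)
    show "AE x in lborel. norm (inv_fourier f x * gauss (e n *\<^sub>R x)) \<le> norm (inv_fourier f x)" for n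
      using g1 by (auto simp: norm_mult intro!: mult_left_le)
  qed (use K in auto)
  then have 1: "(\<lambda>n. \<integral>x. inv_fourier f x * gauss (e n *\<^sub>R x) \<partial>lborel) \<longlonglongrightarrow> (\<integral>x. inv_fourier f x \<partial>lborel)"
    by (simp add: gauss_def)
  have cf: "isCont f x" for x using cont by (simp add: continuous_on_eq_continuous_at)
  have "(\<lambda>n. \<integral>x. f (e n *\<^sub>R x) * gauss x \<partial>lborel) \<longlonglongrightarrow> (\<integral>x. f (0 *\<^sub>R x) * gauss x \<partial>lborel)"
  proof (rule integral_dominated_convergence[where w="\<lambda>x. C * norm (gauss x)"])
    show "AE x in lborel. (\<lambda>n. f (e n *\<^sub>R x) * gauss x) \<longlonglongrightarrow> f (0 *\<^sub>R x) * gauss x"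
      by (intro AE_I2 tendsto_intros isCont_tendsto_compose[OF cf] e0)
    show "AE x in lborel. norm (f (e n *\<^sub>R x) * gauss x) \<le> C * norm (gauss x)" for n
      using bdd by (auto simp: norm_mult intro!: mult_right_mono)
    show "integrable lborel (\<lambda>x. C * norm (gauss x))" using integrable_gauss by auto
  qed auto
  then have "(\<lambda>n. (\<integral>x. f (e n *\<^sub>R x) * gauss x \<partial>lborel) / of_real (sqrt (2 * pi) ^ 3))
     \<longlonglongrightarrow> (f 0 * of_real (sqrt (2 * pi) ^ 3)) / of_real (sqrt (2 * pi) ^ 3)"
    by (intro tendsto_divide tendsto_const) (auto simp: integral_gauss)
  then have 2: "(\<lambda>n. \<integral>x. inv_fourier f x * gauss (e n *\<^sub>R x) \<partial>lborel) \<longlonglongrightarrow> f 0"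
    unfolding eq by simp
  show ?thesis using LIMSEQ_unique[OF 1 2] .
qed

text \<open>Reflecting \<open>f\<close> and translating it by \<open>x\<close> moves the point of
  evaluation to the origin, while its inverse transform becomes \<open>fourier f\<close> times the
  character \<open>cis (x \<bullet> y)\<close> and a constant. The claim is then the previous lemma
  for the function \<open>?g\<close>.\<close>

lemma inv_fourier_fourier:
  assumes f: "integrable lborel f" and cont: "continuous_on UNIV f"
    and bdd: "\<And>x. norm (f x) \<le> C" and K: "integrable lborel (fourier f)"
  shows "inv_fourier (fourier f) x = f x"
proof -
  have [measurable]: "f \<in> borel_measurable borel" "fourier f \<in> borel_measurable borel" using f by auto
  let ?g = "\<lambda>y. f (x + (-1) *\<^sub>R y)"
  have g: "integrable lborel ?g" using f by (subst lborel_integrable_affine_iff) auto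
  have F: "inv_fourier ?g y = cis (x \<bullet> y) * fourier f y / of_real ((2 * pi) ^ 3)" for y
  proof -
    have "(\<integral>\<xi>. cis (- (\<xi> \<bullet> y)) * f \<xi> \<partial>lborel) = (\<integral>\<xi>. cis (- ((x + (-1) *\<^sub>R \<xi>) \<bullet> y)) * ?g \<xi> \<partial>lborel)"
      by (subst lborel_integral_affine[of _ "-1" x]) auto
    also have "\<dots> = (\<integral>\<xi>. cis (- (x \<bullet> y)) * (cis (y \<bullet> \<xi>) * ?g \<xi>) \<partial>lborel)"
      by (intro Bochner_Integration.integral_cong refl)
         (simp add: cis_mult inner_diff_left inner_diff_right inner_commute flip: mult.assoc)
    finally have *: "fourier f y = cis (- (x \<bullet> y)) * (\<integral>\<xi>. (cis (y \<bullet> \<xi>) * ?g \<xi>) \<partial>lborel)"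
      by (simp add: fourier_def)
    have "cis (x \<bullet> y) * fourier f y = (cis (x \<bullet> y) * cis (- (x \<bullet> y))) * (\<integral>\<xi>. (cis (y \<bullet> \<xi>) * ?g \<xi>) \<partial>lborel)"
      unfolding * by (simp only: mult.assoc)
    then show ?thesis by (simp add: cis_mult inv_fourier_def)
  qed
  have "(\<integral>y. inv_fourier ?g y \<partial>lborel) = ?g 0"
  proof (rule integral_inv_fourier[OF g, of C])
    show "continuous_on UNIV ?g" using cont by (intro continuous_on_compose2[OF cont] continuous_intros) auto
    show "integrable lborel (inv_fourier ?g)"
      unfolding F using K by (intro Bochner_Integration.integrable_divide integrable_cis_mult) measurable
  qed (rule bdd)
  then show ?thesis unfolding F by (simp add: inv_fourier_def)
qed

section \<open>Schwartz functions and the Leray projector\<close>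

lemma partial_eq: "(f has_derivative D) (at x) \<Longrightarrow> partial i f x = D (axis i 1)"
  unfolding partial_def by (simp add: frechet_derivative_at[symmetric])

lemma partials_Nil [simp]: "partials [] f = f"
  and partials_Cons: "partials (j # js) f = partial j (partials js f)"
  and partials_snoc: "partials (js @ [j]) f = partials js (partial j f)"
  by (simp_all add: partials_def)

lemma smooth_partials_differentiable: "smooth f \<Longrightarrow> partials js f differentiable (at x)"
  unfolding smooth_def differentiable_on_def by auto

lemma smooth_differentiable: "smooth f \<Longrightarrow> f differentiable (at x)"
  using smooth_partials_differentiable[of f "[]" x] by simp

lemma smooth_partial: "smooth f \<Longrightarrow> smooth (partial i f)"
  unfolding smooth_def by (metis partials_snoc)

lemma continuous_on_partials: "smooth f \<Longrightarrow> continuous_on UNIV (partials js f)"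
  by (simp add: differentiable_imp_continuous_on smooth_def)

lemma continuous_on_smooth: "smooth f \<Longrightarrow> continuous_on UNIV f"
  using continuous_on_partials[of f "[]"] by simp

lemma partials_bounded_linear:
  assumes L: "bounded_linear L" and f: "smooth f"
  shows "partials js (\<lambda>x. L (f x)) = (\<lambda>x. L (partials js f x))"
proof (induction js)
  case (Cons j js)
  have "partial j (\<lambda>x. L (partials js f x)) x = L (partial j (partials js f) x)" for x
  proof -
    have "((\<lambda>x. L (partials js f x)) has_derivative
        (\<lambda>h. L (frechet_derivative (partials js f) (at x) h))) (at x)"
      using smooth_partials_differentiable[OF f, of js x]
      by (intro bounded_linear.has_derivative[OF L]) (simp add: frechet_derivative_works)
    from partial_eq[OF this] show ?thesis by (simp add: partial_def)
  qed
  then show ?case by (auto simp: partials_Cons Cons.IH)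
qed simp

lemma smooth_bounded_linear:
  assumes "bounded_linear L" and "smooth f"
  shows "smooth (\<lambda>x. L (f x))"
  unfolding smooth_def partials_bounded_linear[OF assms]
proof
  fix js
  have "(\<lambda>x. L (partials js f x)) differentiable (at x)" for x
    using smooth_partials_differentiable[OF assms(2), of js x] bounded_linear.has_derivative[OF assms(1)]
    unfolding differentiable_def by blast
  then show "(\<lambda>x. L (partials js f x)) differentiable_on UNIV" by (simp add: differentiable_on_def)
qed

lemma schwartz_smooth: "schwartz f \<Longrightarrow> smooth f"
  by (simp add: schwartz_def)

lemma schwartz_bound:
  assumes "schwartz f"
  obtains C where "C \<ge> 0" "\<And>x. (1 + norm x) ^ N * norm (partials js f x) \<le> C"
proof -
  have "bounded (range (\<lambda>x. (1 + norm x) ^ N *\<^sub>R partials js f x))"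
    using assms unfolding schwartz_def by blast
  then obtain C where "\<forall>x. norm ((1 + norm x) ^ N *\<^sub>R partials js f x) \<le> C"
    unfolding bounded_iff by blast
  moreover have "norm ((1 + norm x) ^ N *\<^sub>R partials js f x) = (1 + norm x) ^ N * norm (partials js f x)" for x
    by (simp add: abs_of_nonneg)
  ultimately have *: "(1 + norm x) ^ N * norm (partials js f x) \<le> C" for x by simp
  have "0 \<le> (1 + norm (0::real^3)) ^ N * norm (partials js f 0)" by simp
  then have "0 \<le> C" using *[of 0] by (rule order_trans)
  then show ?thesis using that * by blast
qed

lemma schwartzI:
  assumes "smooth f" "\<And>js N. \<exists>C. \<forall>x. (1 + norm x) ^ N * norm (partials js f x) \<le> C"
  shows "schwartz f"
  unfolding schwartz_def bounded_iff
proof (intro conjI allI assms)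
  fix js N
  have "norm ((1 + norm x) ^ N *\<^sub>R partials js f x) = (1 + norm x) ^ N * norm (partials js f x)" for x
    by (simp add: abs_of_nonneg)
  then show "\<exists>a. \<forall>x\<in>range (\<lambda>x. (1 + norm x) ^ N *\<^sub>R partials js f x). norm x \<le> a"
    using assms(2)[of N js] by auto
qed

lemma schwartz_bounded_linear:
  assumes L: "bounded_linear L" and f: "schwartz f"
  shows "schwartz (\<lambda>x. L (f x))"
proof (rule schwartzI)
  show "smooth (\<lambda>x. L (f x))" by (rule smooth_bounded_linear[OF L schwartz_smooth[OF f]])
  fix js N
  obtain K where K: "\<And>x. norm (L x) \<le> norm x * K" "K > 0" using bounded_linear.pos_bounded[OF L] by blast
  obtain C where C: "\<And>x. (1 + norm x) ^ N * norm (partials js f x) \<le> C"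
    using schwartz_bound[OF f] by metis
  have "(1 + norm x) ^ N * norm (L (partials js f x)) \<le> C * K" for x
  proof -
    have "(1 + norm x) ^ N * norm (L (partials js f x)) \<le> ((1 + norm x) ^ N * norm (partials js f x)) * K"
      unfolding mult.assoc by (intro mult_left_mono K) simp
    also have "\<dots> \<le> C * K" using C K by (intro mult_right_mono) auto
    finally show ?thesis .
  qed
  then show "\<exists>C. \<forall>x. (1 + norm x) ^ N * norm (partials js (\<lambda>x. L (f x)) x) \<le> C"
    using assms by (auto simp: partials_bounded_linear schwartz_smooth)
qed

lemma schwartz_partial: "schwartz f \<Longrightarrow> schwartz (partial i f)"
  unfolding schwartz_def by (simp add: smooth_partial flip: partials_snoc)

lemma schwartz_partials: "schwartz f \<Longrightarrow> schwartz (partials js f)"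
  by (induction js) (auto simp: partials_Cons schwartz_partial)

lemma le_decayI:
  assumes "(1 + norm x) ^ 6 * a \<le> C"
  shows "a \<le> C * decay x"
proof -
  have "0 < (1 + norm x) ^ 6" by (intro zero_less_power add_pos_nonneg) auto
  then show ?thesis using assms by (simp add: decay_def field_simps)
qed

lemma schwartz_decay:
  assumes "schwartz f"
  obtains C where "C \<ge> 0" "\<And>x. norm (f x) \<le> C * decay x"
  using schwartz_bound[OF assms, of 6 "[]"] le_decayI by (metis partials_Nil)

lemma schwartz_bounded:
  assumes "schwartz f"
  obtains C where "C \<ge> 0" "\<And>x. norm (f x) \<le> C"
  using schwartz_bound[OF assms, of 0 "[]"] by auto

lemma schwartz_measurable [measurable (raw)]: 
  "schwartz f \<Longrightarrow> f \<in> borel_measurable borel"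
  by (intro borel_measurable_continuous_onI continuous_on_smooth schwartz_smooth)

lemma schwartz_integrable:
  fixes f :: "real^3 \<Rightarrow> 'b::{banach,second_countable_topology}"
  assumes "schwartz f"
  shows "integrable lborel f"
  using schwartz_decay[OF assms] schwartz_measurable[OF assms] integrable_decay_bound by metis

text \<open>Differentiation is local, so every iterated derivative vanishes on the open exterior of
  the ball; on the closed ball, continuity and compactness give the bound.\<close>

lemma smooth_compact_support_schwartz:
  fixes f :: "real^3 \<Rightarrow> 'b::real_normed_vector"
  assumes f: "smooth f" and supp: "\<And>x. norm x > R \<Longrightarrow> f x = 0"
  shows "schwartz f"
proof (rule schwartzI[OF f])
  fix js :: "3 list" and N
  have z: "partials js f x = 0" if "norm x > R" for x
    using that
  proof (induction js arbitrary: x)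
    case (Cons j js)
    have "open {y::real^3. norm y > R}" by (intro open_Collect_less continuous_intros)
    have "((\<lambda>_. 0) has_derivative (\<lambda>_. 0)) (at x)" by simp
    then have "(partials js f has_derivative (\<lambda>_. 0)) (at x)"
      by (rule has_derivative_transform_within_open[OF _ \<open>open {y. norm y > R}\<close>])
         (use Cons in auto)
    then show ?case by (simp add: partials_Cons partial_eq)
  qed (use supp in auto)
  have "compact (cball (0::real^3) R)" by simp
  moreover have "continuous_on (cball 0 R) (\<lambda>x. (1 + norm x) ^ N * norm (partials js f x))"
    by (intro continuous_intros continuous_on_subset[OF continuous_on_partials[OF f]]) auto
  ultimately have "bounded ((\<lambda>x. (1 + norm x) ^ N * norm (partials js f x)) ` cball 0 R)"
    using compact_continuous_image compact_imp_bounded by blast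
  then obtain C where "\<forall>x\<in>cball 0 R. norm ((1 + norm x) ^ N * norm (partials js f x)) \<le> C"
    unfolding bounded_iff by blast
  then have "(1 + norm x) ^ N * norm (partials js f x) \<le> C" if "x \<in> cball 0 R" for x
    using that abs_ge_self order_trans unfolding real_norm_def by blast
  then have "(1 + norm x) ^ N * norm (partials js f x) \<le> max C 0" for x
    by (cases "norm x > R") (simp_all add: z le_max_iff_disj)
  then show "\<exists>C. \<forall>x. (1 + norm x) ^ N * norm (partials js f x) \<le> C" by blast
qed

text \<open>Difference quotients have integral 0 by translation invariance. The decay of the
  derivative dominates them uniformly for steps of length at most 1, so the limit has integral 0 as
  well.\<close>

lemma integral_partial:
  fixes g :: "real^3 \<Rightarrow> complex"
  assumes diff: "\<And>x. g differentiable (at x)" and bd: "\<And>x. norm (partial i g x) \<le> C * decay x"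
    and int: "integrable lborel g"
  shows "(\<integral>x. partial i g x \<partial>lborel) = 0"
proof -
  define e where "e n = inverse (real (Suc n))" for n
  have e: "e n > 0" "e n \<le> 1" for n by (auto simp: e_def inverse_le_1_iff)
  have e0: "e \<longlonglongrightarrow> 0" unfolding e_def by (rule LIMSEQ_inverse_real_of_nat)
  let ?a = "axis i 1 :: real^3"
  let ?q = "\<lambda>n x. (g (x + e n *\<^sub>R ?a) - g x) /\<^sub>R e n"
  have C: "C \<ge> 0"
    using order_trans[OF norm_ge_zero bd[of 0]] by (simp add: decay_def)
  have [measurable]: "g \<in> borel_measurable borel" using int by auto
  have der: "((\<lambda>t. g (x + t *\<^sub>R ?a)) has_vector_derivative partial i g (x + t *\<^sub>R ?a)) (at t within S)" for x t S
  proof -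
    have 1: "((\<lambda>t. x + t *\<^sub>R ?a) has_vector_derivative ?a) (at t within S)"
      by (auto intro!: derivative_eq_intros)
    have 2: "(g has_derivative (frechet_derivative g (at (x + t *\<^sub>R ?a)))) (at (x + t *\<^sub>R ?a))"
      using diff frechet_derivative_works by blast
    show ?thesis
      using vector_derivative_diff_chain_within[OF 1 has_derivative_at_withinI[OF 2]]
      by (simp add: o_def partial_def)
  qed
  have "(\<lambda>n. \<integral>x. ?q n x \<partial>lborel) \<longlonglongrightarrow> (\<integral>x. partial i g x \<partial>lborel)"
  proof (rule integral_dominated_convergence[where w="\<lambda>x. C * 64 * decay x"])
    have lim: "(\<lambda>n. ?q n x) \<longlonglongrightarrow> partial i g x" for x
    proof -
      have "((\<lambda>t. (g (x + t *\<^sub>R ?a) - g x) /\<^sub>R t) \<longlongrightarrow> partial i g x) (at 0)"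
      proof -
        have "((\<lambda>t. norm (g (x + t *\<^sub>R ?a) - g x - t *\<^sub>R partial i g x) / norm t) \<longlongrightarrow> 0) (at 0)"
          using der[of x 0 UNIV] unfolding has_vector_derivative_def has_derivative_at by simp
        moreover have "\<forall>\<^sub>F t in at 0. norm (g (x + t *\<^sub>R ?a) - g x - t *\<^sub>R partial i g x) / norm t =
            norm ((g (x + t *\<^sub>R ?a) - g x) /\<^sub>R t - partial i g x)"
        proof (rule eventually_at_topological[THEN iffD2], intro exI[of _ UNIV] conjI ballI impI)
          fix t :: real assume "t \<noteq> 0"
          then have "(g (x + t *\<^sub>R ?a) - g x) /\<^sub>R t - partial i g x = (g (x + t *\<^sub>R ?a) - g x - t *\<^sub>R partial i g x) /\<^sub>R t"
            by (simp add: scaleR_diff_right)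
          then show "norm (g (x + t *\<^sub>R ?a) - g x - t *\<^sub>R partial i g x) / norm t =
            norm ((g (x + t *\<^sub>R ?a) - g x) /\<^sub>R t - partial i g x)" by (simp add: divide_inverse mult.commute)
        qed auto
        ultimately have "((\<lambda>t. norm ((g (x + t *\<^sub>R ?a) - g x) /\<^sub>R t - partial i g x)) \<longlongrightarrow> 0) (at 0)"
          by (rule Lim_transform_eventually)
        then show ?thesis using LIM_zero_iff tendsto_norm_zero_iff by blast
      qed
      moreover have "filterlim e (at 0) sequentially"
        using e0 e by (auto simp: filterlim_at intro!: always_eventually) (metis less_irrefl)
      ultimately show ?thesis by (rule filterlim_compose)
    qed
    then show "AE x in lborel. (\<lambda>n. ?q n x) \<longlonglongrightarrow> partial i g x" by simp
    show "partial i g \<in> borel_measurable lborel"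
      by (rule borel_measurable_LIMSEQ_metric[OF _ lim]) measurable
    show "AE x in lborel. norm (?q n x) \<le> C * 64 * decay x" for n
    proof (rule AE_I2)
      fix x
      have "norm (g (x + e n *\<^sub>R ?a) - g (x + 0 *\<^sub>R ?a)) \<le> (C * 64 * decay x) * norm (e n - 0)"
      proof (rule differentiable_bound[where S="{0..1}" and f="\<lambda>t. g (x + t *\<^sub>R ?a)" and f'="\<lambda>t h. h *\<^sub>R partial i g (x + t *\<^sub>R ?a)"])
        fix t :: real assume t: "t \<in> {0..1}"
        show "((\<lambda>t. g (x + t *\<^sub>R ?a)) has_derivative (\<lambda>h. h *\<^sub>R partial i g (x + t *\<^sub>R ?a))) (at t within {0..1})"
          using der unfolding has_vector_derivative_def .
        have "norm (partial i g (x + t *\<^sub>R ?a)) \<le> C * decay (x - (- t) *\<^sub>R ?a)" using bd[of "x + t *\<^sub>R ?a"] by simp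
        also have "\<dots> \<le> C * ((1 + norm ((- t) *\<^sub>R ?a)) ^ 6 * decay x)"
          by (intro mult_left_mono decay_shift C)
        \<comment> \<open>This is the origin of the factor 64 in the majorant: the weight is shifted
          by a vector of length at most 1.\<close>
        also have "(1 + norm ((- t) *\<^sub>R ?a)) ^ 6 \<le> 2 ^ 6"
          using t by (intro power_mono) auto
        finally have "norm (partial i g (x + t *\<^sub>R ?a)) \<le> C * 64 * decay x"
          using C by (simp add: mult_left_mono mult_right_mono)
        then show "onorm (\<lambda>h. h *\<^sub>R partial i g (x + t *\<^sub>R ?a)) \<le> C * 64 * decay x"
          by (intro onorm_le) (simp add: mult.commute mult_left_mono)
      qed (use e[of n] in auto)
      then show "norm (?q n x) \<le> C * 64 * decay x" using e[of n] by (simp add: divide_simps mult_ac)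
    qed
    show "integrable lborel (\<lambda>x. C * 64 * decay x)" using integrable_decay by simp
  qed measurable
  moreover have "(\<integral>x. ?q n x \<partial>lborel) = 0" for n
  proof -
    have *: "integrable lborel (\<lambda>x. g (x + e n *\<^sub>R ?a))" "(\<integral>x. g (x + e n *\<^sub>R ?a) \<partial>lborel) = (\<integral>x. g x \<partial>lborel)"
      using lborel_integrable_affine_iff[of g 1 "e n *\<^sub>R ?a"] lborel_integral_affine[of g 1 "e n *\<^sub>R ?a"] int
      by (auto simp: add.commute)
    then show ?thesis using int by simp
  qed
  ultimately have "(\<lambda>n::nat. 0) \<longlonglongrightarrow> (\<integral>x. partial i g x \<partial>lborel)" by (simp only:)
  then show ?thesis by (simp add: LIMSEQ_const_iff)
qed

section \<open>Fourier transforms of Schwartz functions and inversion\<close>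

lemma has_derivative_cis_inner:
  "((\<lambda>x::real^3. cis (c * (x \<bullet> \<xi>))) has_derivative (\<lambda>h. (c * (h \<bullet> \<xi>)) *\<^sub>R (\<i> * cis (c * (x \<bullet> \<xi>))))) (at x)"
  by (rule has_derivative_cis) (auto intro!: derivative_eq_intros)

text \<open>Integration by parts: the partial derivative of the character times \<open>f\<close>
  integrates to 0, and the product rule splits it into the two sides.\<close>

lemma fourier_partial:
  assumes f: "schwartz f"
  shows "fourier (partial i f) \<xi> = \<i> * of_real (\<xi> $ i) * fourier f \<xi>"
proof -
  let ?g = "\<lambda>x. cis (- (x \<bullet> \<xi>)) * f x"
  have [measurable]: "f \<in> borel_measurable borel" using f by measurable
  have der: "(?g has_derivative (\<lambda>h. cis (- (x \<bullet> \<xi>)) * frechet_derivative f (at x) h +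
       ((- (h \<bullet> \<xi>)) *\<^sub>R (\<i> * cis (- (x \<bullet> \<xi>)))) * f x)) (at x)" for x
    using has_derivative_cis_inner[of "-1" \<xi> x] smooth_differentiable[OF schwartz_smooth[OF f], of x]
    by (intro has_derivative_mult) (auto simp: frechet_derivative_works)
  have pg: "partial i ?g x = cis (- (x \<bullet> \<xi>)) * partial i f x - \<i> * of_real (\<xi> $ i) * (cis (- (x \<bullet> \<xi>)) * f x)" for x
    by (subst partial_eq[OF der]) (simp add: partial_def inner_axis' scaleR_conv_of_real[where 'a=complex])
  obtain C1 where C1: "\<And>x. norm (f x) \<le> C1 * decay x" using schwartz_decay[OF f] by metis
  obtain C2 where C2: "\<And>x. norm (partial i f x) \<le> C2 * decay x" using schwartz_decay[OF schwartz_partial[OF f]] by metis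
  have I1: "integrable lborel ?g"
    by (rule integrable_cis_mult) (use schwartz_integrable[OF f] in auto)
  have I2: "integrable lborel (\<lambda>x. cis (- (x \<bullet> \<xi>)) * partial i f x)"
    by (rule integrable_cis_mult) (use schwartz_integrable[OF schwartz_partial[OF f]] in auto)
  have "(\<integral>x. partial i ?g x \<partial>lborel) = 0"
  proof (rule integral_partial[OF _ _ I1, where C="C2 + norm (\<xi> $ i) * C1"])
    show "?g differentiable (at x)" for x using der differentiable_def by blast
    fix x
    have "norm (partial i ?g x) \<le> norm (partial i f x) + norm (\<xi> $ i) * norm (f x)"
      unfolding pg by (rule order_trans[OF norm_triangle_ineq4]) (simp add: norm_mult)
    also have "\<dots> \<le> C2 * decay x + norm (\<xi> $ i) * (C1 * decay x)"
      by (intro add_mono mult_left_mono C1 C2) auto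
    finally show "norm (partial i ?g x) \<le> (C2 + norm (\<xi> $ i) * C1) * decay x" by (simp add: algebra_simps)
  qed
  then show ?thesis
    unfolding pg using I1 I2 by (simp add: fourier_def)
qed

lemma fourier_partials_replicate:
  assumes f: "schwartz f"
  shows "fourier (partials (replicate N i) f) \<xi> = (\<i> * of_real (\<xi> $ i)) ^ N * fourier f \<xi>"
  by (induction N) (simp_all add: partials_Cons fourier_partial schwartz_partials f)

text \<open>With \<open>m\<close> the largest of 1 and the moduli of the coordinates, 1 + |x| \<le>
  4 m, and \<open>m ^ N\<close> is itself one of the four summands. Decay in the norm thus follows
  from pure powers of single coordinates.\<close>

lemma one_plus_norm_power_le:
  "(1 + norm (x::real^3)) ^ N \<le> 4 ^ N * (1 + \<bar>x$1\<bar> ^ N + \<bar>x$2\<bar> ^ N + \<bar>x$3\<bar> ^ N)"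
proof -
  define m where "m = Max {1, \<bar>x$1\<bar>, \<bar>x$2\<bar>, \<bar>x$3\<bar>}"
  have m: "1 \<le> m" "\<bar>x$1\<bar> \<le> m" "\<bar>x$2\<bar> \<le> m" "\<bar>x$3\<bar> \<le> m" "m \<in> {1, \<bar>x$1\<bar>, \<bar>x$2\<bar>, \<bar>x$3\<bar>}"
    unfolding m_def by (rule Max_ge Max_in; simp)+
  have "norm x \<le> \<bar>x$1\<bar> + \<bar>x$2\<bar> + \<bar>x$3\<bar>"
    using norm_le_l1_cart[of x] by (simp add: sum_3)
  then have "1 + norm x \<le> 4 * m" using m by linarith
  then have "(1 + norm x) ^ N \<le> (4 * m) ^ N" by (intro power_mono) auto
  also have "\<dots> = 4 ^ N * m ^ N" by (simp add: power_mult_distrib)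
  also have "m ^ N \<le> 1 + \<bar>x$1\<bar> ^ N + \<bar>x$2\<bar> ^ N + \<bar>x$3\<bar> ^ N"
    using m(5) by (auto simp: add_nonneg_nonneg)
  finally show ?thesis by simp
qed

text \<open>Multiplying the transform by the N-th power of a coordinate corresponds to N derivatives
  in that direction, whose transform is bounded by an L^1 norm. The preceding lemma assembles the
  three directions.\<close>

lemma fourier_rapid_decay:
  assumes f: "schwartz f"
  obtains C where "C \<ge> 0" "\<And>\<xi>. (1 + norm \<xi>) ^ N * norm (fourier f \<xi>) \<le> C"
proof -
  define A where "A i = (\<integral>x. norm (partials (replicate N i) f x) \<partial>lborel)" for i
  define A0 where "A0 = (\<integral>x. norm (f x) \<partial>lborel)"
  have A: "\<bar>\<xi> $ i\<bar> ^ N * norm (fourier f \<xi>) \<le> A i" for \<xi> i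
    using norm_fourier_le[of "partials (replicate N i) f" \<xi>]
    by (simp add: fourier_partials_replicate f A_def norm_mult norm_power)
  have A0: "norm (fourier f \<xi>) \<le> A0" for \<xi> unfolding A0_def by (rule norm_fourier_le)
  show ?thesis
  proof (rule that[of "4 ^ N * (A0 + A 1 + A 2 + A 3)"])
    show "0 \<le> 4 ^ N * (A0 + A 1 + A 2 + A 3)" unfolding A_def A0_def by (intro mult_nonneg_nonneg add_nonneg_nonneg) auto
    fix \<xi>
    have "(1 + norm \<xi>) ^ N * norm (fourier f \<xi>) \<le>
      (4 ^ N * (1 + \<bar>\<xi>$1\<bar> ^ N + \<bar>\<xi>$2\<bar> ^ N + \<bar>\<xi>$3\<bar> ^ N)) * norm (fourier f \<xi>)"
      by (intro mult_right_mono one_plus_norm_power_le) auto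
    also have "\<dots> = 4 ^ N * (norm (fourier f \<xi>) + \<bar>\<xi>$1\<bar> ^ N * norm (fourier f \<xi>) + \<bar>\<xi>$2\<bar> ^ N * norm (fourier f \<xi>) + \<bar>\<xi>$3\<bar> ^ N * norm (fourier f \<xi>))"
      by (simp add: algebra_simps)
    also have "\<dots> \<le> 4 ^ N * (A0 + A 1 + A 2 + A 3)"
      by (intro mult_left_mono add_mono A A0) auto
    finally show "(1 + norm \<xi>) ^ N * norm (fourier f \<xi>) \<le> 4 ^ N * (A0 + A 1 + A 2 + A 3)" .
  qed
qed

lemma fourier_schwartz_integrable:
  assumes f: "schwartz f"
  shows "integrable lborel (fourier f)"
proof -
  obtain C where "\<And>\<xi>. (1 + norm \<xi>) ^ 6 * norm (fourier f \<xi>) \<le> C"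
    using fourier_rapid_decay[OF f] by metis
  then have "norm (fourier f \<xi>) \<le> C * decay \<xi>" for \<xi> by (rule le_decayI)
  then show ?thesis
    by (intro integrable_decay_bound[of _ C] measurable_fourier schwartz_integrable f)
qed

lemma inv_fourier_fourier_schwartz:
  assumes f: "schwartz f"
  shows "inv_fourier (fourier f) x = f x"
proof -
  obtain C where "\<And>x. norm (f x) \<le> C" using schwartz_bounded[OF f] by metis
  then show ?thesis
    by (intro inv_fourier_fourier schwartz_integrable fourier_schwartz_integrable continuous_on_smooth schwartz_smooth f)
qed

text \<open>The projector removes the gradient part of \<open>f\<close>, whose transform
  \<open>c i\<close> is a multiple of \<xi>_i with a factor common to all \<open>i\<close>.
  Exchanging the transforms pairs it with that of \<open>w\<close>, and the sum over
  \<open>i\<close> vanishes because the transform of a divergence-free field is orthogonal to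
  \<xi>.\<close>

lemma pairing_leray_divergence_free:
  assumes f: "schwartz f" and w: "schwartz w" and div: "\<And>x. divergence w x = 0"
  shows "pairing (leray f) w = pairing f w"
proof -
  define f' where "f' i x = complex_of_real (f x $ i)" for i x
  define w' where "w' i x = complex_of_real (w x $ i)" for i x
  define F where "F i = fourier (f' i)" for i
  define P where "P \<xi> = (\<Sum>j\<in>UNIV. of_real (\<xi> $ j) * F j \<xi>)" for \<xi>
  define c where "c i \<xi> = of_real (\<xi> $ i / (norm \<xi>)\<^sup>2) * P \<xi>" for i \<xi>
  have L: "bounded_linear (\<lambda>v::real^3. complex_of_real (v $ i))" for i
    by (intro bounded_linear_compose[OF bounded_linear_of_real bounded_linear_vec_nth])
  have sf: "schwartz (f' i)" and sw: "schwartz (w' i)" for i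
    unfolding f'_def w'_def by (rule schwartz_bounded_linear[OF L f] schwartz_bounded_linear[OF L w])+
  have Fint: "integrable lborel (F i)" for i unfolding F_def by (rule fourier_schwartz_integrable[OF sf])
  have [measurable]: "F i \<in> borel_measurable borel" for i using Fint by auto
  \<comment> \<open>The symbol \<xi>_i \<xi>_j / |\<xi>|^2 is discontinuous at the origin but
    bounded by 1, which gives the majorant. At the origin the quotient is 0 by the convention on
    division.\<close>
  have cint: "integrable lborel (c i)" for i
  proof (rule Bochner_Integration.integrable_bound)
    show "integrable lborel (\<lambda>\<xi>. \<Sum>j\<in>UNIV. norm (F j \<xi>))" using Fint by auto
    show "c i \<in> borel_measurable lborel" unfolding c_def P_def by measurable
    have "norm (c i \<xi>) \<le> (\<Sum>j\<in>UNIV. norm (F j \<xi>))" for \<xi>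
    proof (cases "\<xi> = 0")
      case False
      have "norm (c i \<xi>) \<le> \<bar>\<xi> $ i / (norm \<xi>)\<^sup>2\<bar> * (\<Sum>j\<in>UNIV. \<bar>\<xi> $ j\<bar> * norm (F j \<xi>))"
        unfolding c_def P_def norm_mult norm_of_real
        by (intro mult_left_mono order_trans[OF norm_sum]) (auto simp: norm_mult)
      also have "\<dots> \<le> (norm \<xi> / (norm \<xi>)\<^sup>2) * (\<Sum>j\<in>UNIV. norm \<xi> * norm (F j \<xi>))"
        by (intro mult_mono sum_mono mult_right_mono)
          (auto simp: abs_divide intro!: divide_right_mono component_le_norm_cart sum_nonneg)
      also have "\<dots> = (\<Sum>j\<in>UNIV. norm (F j \<xi>))"
        using False by (simp add: sum_distrib_left[symmetric] power2_eq_square)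
      finally show ?thesis .
    qed (simp add: c_def sum_nonneg)
    then show "AE \<xi> in lborel. norm (c i \<xi>) \<le> norm (\<Sum>j\<in>UNIV. norm (F j \<xi>))"
      by (auto intro: order_trans[OF _ abs_ge_self])
  qed
  have inv_diff: "inv_fourier (\<lambda>\<xi>. F i \<xi> - c i \<xi>) x = inv_fourier (F i) x - inv_fourier (c i) x" for i x
    unfolding inv_fourier_def right_diff_distrib
    by (subst Bochner_Integration.integral_diff)
      (auto intro!: integrable_cis_mult Fint cint simp: diff_divide_distrib)
  have ler: "leray f x $ i = f x $ i - Re (inv_fourier (c i) x)" for x i
  proof -
    have "leray f x $ i = Re (inv_fourier (\<lambda>\<xi>. F i \<xi> - c i \<xi>) x)"
      unfolding leray_def Let_def F_def c_def P_def f'_def by simp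
    also have "inv_fourier (F i) x = of_real (f x $ i)"
      unfolding F_def by (subst inv_fourier_fourier_schwartz[OF sf]) (simp add: f'_def)
    ultimately show ?thesis by (simp add: inv_diff)
  qed
  have wint: "integrable lborel (w' i)" for i by (rule schwartz_integrable[OF sw])
  have div0: "(\<Sum>i\<in>UNIV. of_real (\<xi> $ i) * fourier (w' i) \<xi>) = 0" for \<xi>
  proof -
    have "partial i (w' i) x = of_real (partial i w x $ i)" for i x
      using partials_bounded_linear[OF L schwartz_smooth[OF w], of "[i]" i]
      by (simp add: w'_def[abs_def] partials_Cons fun_eq_iff)
    then have "(\<Sum>i\<in>UNIV. partial i (w' i) x) = 0" for x
      using div[of x] unfolding divergence_def by (simp flip: of_real_sum)
    then have "0 = (\<integral>x. cis (- (x \<bullet> \<xi>)) * (\<Sum>i\<in>UNIV. partial i (w' i) x) \<partial>lborel)" by simp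
    also have "\<dots> = (\<Sum>i\<in>UNIV. fourier (partial i (w' i)) \<xi>)"
      unfolding sum_distrib_left fourier_def
      by (intro Bochner_Integration.integral_sum integrable_cis_mult schwartz_integrable schwartz_partial sw) measurable
    also have "\<dots> = \<i> * (\<Sum>i\<in>UNIV. of_real (\<xi> $ i) * fourier (w' i) \<xi>)"
      by (simp add: fourier_partial[OF sw] sum_distrib_left mult.assoc)
    finally show ?thesis by simp
  qed
  have cw_int: "integrable lborel (\<lambda>x. inv_fourier (c i) x * w' i x)" for i
  proof (rule Bochner_Integration.integrable_bound)
    show "integrable lborel (\<lambda>x. (\<integral>\<xi>. norm (c i \<xi>) \<partial>lborel) * norm (w' i x))" using wint by auto
    show "(\<lambda>x. inv_fourier (c i) x * w' i x) \<in> borel_measurable lborel"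
      using measurable_inv_fourier[OF cint] wint by measurable
    show "AE x in lborel. norm (inv_fourier (c i) x * w' i x) \<le> norm ((\<integral>\<xi>. norm (c i \<xi>) \<partial>lborel) * norm (w' i x))"
      by (auto simp: norm_mult intro!: mult_right_mono order_trans[OF norm_inv_fourier_le])
  qed
  have "(\<Sum>i\<in>UNIV. \<integral>x. inv_fourier (c i) x * w' i x \<partial>lborel) = (\<Sum>i\<in>UNIV. \<integral>\<xi>. c i \<xi> * inv_fourier (w' i) \<xi> \<partial>lborel)"
    by (intro sum.cong refl inv_fourier_swap cint wint)
  also have "\<dots> = (\<integral>\<xi>. (\<Sum>i\<in>UNIV. c i \<xi> * inv_fourier (w' i) \<xi>) \<partial>lborel)"
  proof (rule Bochner_Integration.integral_sum[symmetric])
    fix i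
    show "integrable lborel (\<lambda>\<xi>. c i \<xi> * inv_fourier (w' i) \<xi>)"
    proof (rule Bochner_Integration.integrable_bound)
      show "integrable lborel (\<lambda>x. norm (c i x) * (\<integral>\<xi>. norm (w' i \<xi>) \<partial>lborel))" using cint by auto
      show "(\<lambda>x. c i x * inv_fourier (w' i) x) \<in> borel_measurable lborel"
        using measurable_inv_fourier[OF wint] cint by measurable
      show "AE x in lborel. norm (c i x * inv_fourier (w' i) x) \<le> norm (norm (c i x) * (\<integral>\<xi>. norm (w' i \<xi>) \<partial>lborel))"
        by (auto simp: norm_mult intro!: mult_left_mono order_trans[OF norm_inv_fourier_le])
    qed
  qed
  also have "(\<lambda>\<xi>. \<Sum>i\<in>UNIV. c i \<xi> * inv_fourier (w' i) \<xi>) = (\<lambda>\<xi>. 0)"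
  proof
    fix \<xi> :: "real^3"
    \<comment> \<open>The inverse transform is a multiple of the transform at
      \<open>- \<xi>\<close>. The minus sign rewrites the vector \<xi> in \<open>c i\<close> as the
      reflected argument, so that \<open>div0\<close> applies at \<open>- \<xi>\<close>.\<close>
    have "(\<Sum>i\<in>UNIV. c i \<xi> * inv_fourier (w' i) \<xi>) =
      P \<xi> / of_real ((norm \<xi>)\<^sup>2) / of_real ((2 * pi) ^ 3) * (- (\<Sum>i\<in>UNIV. of_real ((- \<xi>) $ i) * fourier (w' i) (- \<xi>)))"
      unfolding sum_negf[symmetric] sum_distrib_left
      by (intro sum.cong refl) (simp add: c_def inv_fourier_eq_fourier)
    then show "(\<Sum>i\<in>UNIV. c i \<xi> * inv_fourier (w' i) \<xi>) = 0" unfolding div0 by simp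
  qed
  finally have zero: "(\<Sum>i\<in>UNIV. \<integral>x. inv_fourier (c i) x * w' i x \<partial>lborel) = 0" by simp
  have Re_int: "integrable lborel (\<lambda>x. Re (inv_fourier (c i) x) * w x $ i)"
       "(\<integral>x. Re (inv_fourier (c i) x) * w x $ i \<partial>lborel) = Re (\<integral>x. inv_fourier (c i) x * w' i x \<partial>lborel)" for i
  proof -
    have *: "Re (inv_fourier (c i) x) * w x $ i = Re (inv_fourier (c i) x * w' i x)" for x by (simp add: w'_def)
    show "integrable lborel (\<lambda>x. Re (inv_fourier (c i) x) * w x $ i)" unfolding * by (rule integrable_Re[OF cw_int])
    show "(\<integral>x. Re (inv_fourier (c i) x) * w x $ i \<partial>lborel) = Re (\<integral>x. inv_fourier (c i) x * w' i x \<partial>lborel)"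
      unfolding * by (rule integral_Re[OF cw_int])
  qed
  have fw: "integrable lborel (\<lambda>x. f x \<bullet> w x)"
  proof -
    obtain C where C: "\<And>x. norm (f x) \<le> C" using schwartz_bounded[OF f] by metis
    have [measurable]: "f \<in> borel_measurable borel" "w \<in> borel_measurable borel"
      using f w by (auto intro: schwartz_measurable)
    show ?thesis
    proof (rule Bochner_Integration.integrable_bound)
      show "integrable lborel (\<lambda>x. C * norm (w x))" using schwartz_integrable[OF w] by auto
      have "norm (f x \<bullet> w x) \<le> norm (C * norm (w x))" for x
      proof -
        have "norm (f x \<bullet> w x) \<le> norm (f x) * norm (w x)" by (simp add: Cauchy_Schwarz_ineq2)
        also have "\<dots> \<le> C * norm (w x)" by (intro mult_right_mono C) auto
        finally show ?thesis by (simp add: order_trans[OF _ abs_ge_self])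
      qed
      then show "AE x in lborel. norm (f x \<bullet> w x) \<le> norm (C * norm (w x))" by simp
    qed measurable
  qed
  have "pairing (leray f) w = (\<integral>x. f x \<bullet> w x - (\<Sum>i\<in>UNIV. Re (inv_fourier (c i) x) * w x $ i) \<partial>lborel)"
    unfolding pairing_def by (intro Bochner_Integration.integral_cong refl)
      (simp add: inner_vec_def ler left_diff_distrib sum_subtractf)
  also have "\<dots> = pairing f w - (\<Sum>i\<in>UNIV. \<integral>x. Re (inv_fourier (c i) x) * w x $ i \<partial>lborel)"
    using fw Re_int by (simp add: pairing_def Bochner_Integration.integral_sum)
  also have "(\<Sum>i\<in>UNIV. \<integral>x. Re (inv_fourier (c i) x) * w x $ i \<partial>lborel) = 0"
    unfolding Re_int(2) Re_sum[symmetric] zero by simp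
  finally show ?thesis by simp
qed

section \<open>Littlewood-Paley blocks of integrable fields\<close>

lemma vec_eq_sum_axis: "v = (\<Sum>i\<in>UNIV. axis i (v $ i))"
  by (simp add: vec_eq_iff axis_def if_distrib cong: if_cong)

section \<open>Componentwise integration and the distribution of an integrable field\<close>

lemma bounded_linear_axis: "bounded_linear (axis i :: 'b::real_normed_vector \<Rightarrow> 'b ^ 'n::finite)"
proof (rule bounded_linear_intro[where K=1])
  show "norm (axis i x :: 'b ^ 'n) \<le> norm x * 1" for x :: 'b
  proof -
    have "norm (axis i x :: 'b ^ 'n) \<le> (\<Sum>j\<in>UNIV. norm ((axis i x :: 'b ^ 'n) $ j))"
      unfolding norm_vec_def by (rule L2_set_le_sum) simp
    also have "\<dots> = norm x" by (simp add: axis_def if_distrib cong: if_cong)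
    finally show ?thesis by simp
  qed
qed (auto simp: vec_eq_iff axis_def)

lemma norm_le_sum_components: "norm (v :: 'b::real_normed_vector ^ 'n::finite) \<le> (\<Sum>i\<in>UNIV. norm (v $ i))"
  unfolding norm_vec_def by (rule L2_set_le_sum) simp

lemma integrable_componentwise:
  fixes f :: "'a \<Rightarrow> 'b::euclidean_space ^ 'n::finite"
  assumes "\<And>i. integrable M (\<lambda>x. f x $ i)"
  shows "integrable M f"
proof -
  have "integrable M (\<lambda>x. \<Sum>i\<in>UNIV. axis i (f x $ i))"
    by (intro Bochner_Integration.integrable_sum integrable_bounded_linear[OF bounded_linear_axis] assms)
  then show ?thesis by (simp flip: vec_eq_sum_axis)
qed

lemma integral_component:
  fixes f :: "'a \<Rightarrow> 'b::euclidean_space ^ 'n::finite"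
  assumes "integrable M f"
  shows "(\<integral>x. f x \<partial>M) $ i = (\<integral>x. f x $ i \<partial>M)"
  using integral_bounded_linear[OF bounded_linear_vec_nth[of i] assms] by simp

lemma integrable_component:
  fixes f :: "'a \<Rightarrow> 'b::euclidean_space ^ 'n::finite"
  shows "integrable M f \<Longrightarrow> integrable M (\<lambda>x. f x $ i)"
  by (rule integrable_bounded_linear[OF bounded_linear_vec_nth])

lemma integrable_bounded_mult:
  fixes f g :: "'a \<Rightarrow> complex"
  assumes f: "f \<in> borel_measurable M" "\<And>x. norm (f x) \<le> C" and g: "integrable M g"
  shows "integrable M (\<lambda>x. f x * g x)"
proof (rule Bochner_Integration.integrable_bound)
  show "integrable M (\<lambda>x. C * norm (g x))" using g by auto
  show "(\<lambda>x. f x * g x) \<in> borel_measurable M" using f g by auto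
  show "AE x in M. norm (f x * g x) \<le> norm (C * norm (g x))"
    using f(2) by (auto simp: norm_mult intro!: order_trans[OF _ abs_ge_self] mult_right_mono)
qed

abbreviation ccomp :: "(real^3 \<Rightarrow> real^3) \<Rightarrow> 3 \<Rightarrow> real^3 \<Rightarrow> complex"
  where "ccomp h i \<equiv> \<lambda>x. complex_of_real (h x $ i)"

lemma integrable_ccomp: "integrable lborel h \<Longrightarrow> integrable lborel (ccomp h i)"
  by (intro integrable_of_real integrable_component)

lemma
  assumes h: "integrable lborel h" and f: "f \<in> borel_measurable borel" "\<And>x. norm (f x) \<le> C"
  shows field_distr_integrable: "integrable lborel (\<lambda>x. f x *s cvec (h x))" (is ?I)
    and field_distr_component: "field_distr h f $ i = (\<integral>x. f x * ccomp h i x \<partial>lborel)" (is ?J)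
proof -
  show ?I
    by (rule integrable_componentwise)
      (use f in \<open>auto simp: cvec_def intro!: integrable_bounded_mult integrable_ccomp h\<close>)
  then show ?J
    by (simp add: field_distr_def integral_component cvec_def)
qed

lemma field_distr_diff:
  assumes "integrable lborel h" "integrable lborel k" "f \<in> borel_measurable borel" "\<And>x. norm (f x) \<le> C"
  shows "field_distr (\<lambda>x. h x - k x) f = field_distr h f - field_distr k f"
proof -
  have *: "f x *s cvec (h x - k x) = f x *s cvec (h x) - f x *s cvec (k x)" for x
    by (simp add: vec_eq_iff cvec_def algebra_simps)
  show ?thesis
    unfolding field_distr_def * using field_distr_integrable assms
    by (intro Bochner_Integration.integral_diff) blast+
qed

lemma schwartz_seminorm_upper:
  assumes "schwartz f"
  shows "norm (f x) \<le> schwartz_seminorm 0 f"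
proof -
  obtain C where C: "\<And>x. norm (f x) \<le> C" using schwartz_bounded[OF assms] by metis
  have eq: "{js::3 list. length js \<le> 0} = {[]}" by auto
  have "norm (f x) = (case ([]::3 list, x) of (js, x) \<Rightarrow> (1 + norm x) ^ 0 * norm (partials js f x))" by simp
  also have "\<dots> \<le> schwartz_seminorm 0 f"
    unfolding schwartz_seminorm_def eq
    by (rule cSUP_upper) (use C in \<open>auto intro!: bdd_aboveI[of _ C]\<close>)
  finally show ?thesis .
qed

lemma tempered_field_distr:
  assumes h: "integrable lborel h"
  shows "tempered (field_distr h)"
  unfolding tempered_def
proof (intro conjI allI impI exI)
  fix f g :: "real^3 \<Rightarrow> complex" and a b
  assume f: "schwartz f" and g: "schwartz g"
  obtain C D where CD: "\<And>x. norm (f x) \<le> C" "\<And>x. norm (g x) \<le> D"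
    using schwartz_bounded[OF f] schwartz_bounded[OF g] by metis
  have [measurable]: "f \<in> borel_measurable borel" "g \<in> borel_measurable borel"
    using f g by (auto intro: schwartz_measurable)
  have bd: "norm (a * f x + b * g x) \<le> norm a * C + norm b * D" for x
    by (rule order_trans[OF norm_triangle_ineq]) (auto simp: norm_mult intro!: add_mono mult_left_mono CD)
  have 1: "integrable lborel (\<lambda>x. f x * ccomp h i x)" "integrable lborel (\<lambda>x. g x * ccomp h i x)" for i
    using CD by (auto intro!: integrable_bounded_mult integrable_ccomp h)
  have "field_distr h (\<lambda>x. a * f x + b * g x) $ i = a * field_distr h f $ i + b * field_distr h g $ i" for i
  proof -
    have "field_distr h (\<lambda>x. a * f x + b * g x) $ i = (\<integral>x. a * (f x * ccomp h i x) + b * (g x * ccomp h i x) \<partial>lborel)"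
      by (subst field_distr_component[OF h _ bd]) (auto simp: algebra_simps)
    also have "\<dots> = a * field_distr h f $ i + b * field_distr h g $ i"
      using 1 by (subst Bochner_Integration.integral_add)
        (auto simp: field_distr_component[OF h _ CD(1)] field_distr_component[OF h _ CD(2)])
    finally show ?thesis .
  qed
  then show "field_distr h (\<lambda>x. a * f x + b * g x) = a *s field_distr h f + b *s field_distr h g"
    by (simp add: vec_eq_iff)
next
  \<comment> \<open>The seminorm of order 0, which dominates the supremum, suffices; the constant is
    the sum of the L^1 norms of the components of \<open>h\<close>.\<close>
  fix f :: "real^3 \<Rightarrow> complex" assume f: "schwartz f"
  have [measurable]: "f \<in> borel_measurable borel" using f by (auto intro: schwartz_measurable)
  have "norm (field_distr h f) \<le> (\<Sum>i\<in>UNIV. norm (field_distr h f $ i))" by (rule norm_le_sum_components)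
  also have "\<dots> \<le> (\<Sum>i\<in>UNIV. (\<integral>x. norm (ccomp h i x) \<partial>lborel) * schwartz_seminorm 0 f)"
  proof (rule sum_mono)
    fix i
    have "norm (field_distr h f $ i) \<le> (\<integral>x. norm (f x * ccomp h i x) \<partial>lborel)"
      by (subst field_distr_component[OF h _ schwartz_seminorm_upper[OF f]]) auto
    also have "\<dots> \<le> (\<integral>x. norm (ccomp h i x) * schwartz_seminorm 0 f \<partial>lborel)"
    proof (rule integral_mono)
      show "integrable lborel (\<lambda>x. norm (f x * ccomp h i x))"
        by (intro integrable_norm integrable_bounded_mult[OF _ schwartz_seminorm_upper[OF f]] integrable_ccomp h) auto
      show "integrable lborel (\<lambda>x. norm (ccomp h i x) * schwartz_seminorm 0 f)"
        by (intro integrable_mult_left integrable_norm integrable_ccomp h)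
      show "norm (f x * ccomp h i x) \<le> norm (ccomp h i x) * schwartz_seminorm 0 f" for x
        unfolding norm_mult using schwartz_seminorm_upper[OF f] by (subst mult.commute) (intro mult_left_mono, auto)
    qed
    finally show "norm (field_distr h f $ i) \<le> (\<integral>x. norm (ccomp h i x) \<partial>lborel) * schwartz_seminorm 0 f" by simp
  qed
  finally show "norm (field_distr h f) \<le> (\<Sum>i\<in>UNIV. (\<integral>x. norm (ccomp h i x) \<partial>lborel)) * schwartz_seminorm 0 f"
    by (simp add: sum_distrib_right)
qed

lemma real_field_distr:
  assumes h: "integrable lborel h"
  shows "real_distr (field_distr h)"
  unfolding real_distr_def
proof (intro allI impI)
  fix f :: "real^3 \<Rightarrow> complex" and i assume f: "schwartz f"
  have [measurable]: "f \<in> borel_measurable borel" using f by (auto intro: schwartz_measurable)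
  have b: "norm (cnj (f x)) \<le> schwartz_seminorm 0 f" for x using schwartz_seminorm_upper[OF f] by simp
  have [measurable]: "(\<lambda>x. cnj (f x)) \<in> borel_measurable borel"
    by (intro borel_measurable_continuous_onI continuous_intros continuous_on_smooth schwartz_smooth f)
  have 1: "field_distr h (\<lambda>x. cnj (f x)) $ i = (\<integral>x. cnj (f x) * ccomp h i x \<partial>lborel)"
    by (rule field_distr_component[OF h _ b]) measurable
  have 2: "field_distr h f $ i = (\<integral>x. f x * ccomp h i x \<partial>lborel)"
    by (rule field_distr_component[OF h _ schwartz_seminorm_upper[OF f]]) measurable
  have "integrable lborel (\<lambda>x. f x * ccomp h i x)"
    by (rule integrable_bounded_mult[OF _ schwartz_seminorm_upper[OF f] integrable_ccomp[OF h]]) measurable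
  then have "cnj (\<integral>x. f x * ccomp h i x \<partial>lborel) = (\<integral>x. cnj (f x * ccomp h i x) \<partial>lborel)"
    by (rule integral_bounded_linear[OF bounded_linear_cnj, symmetric])
  then show "field_distr h (\<lambda>x. cnj (f x)) $ i = cnj (field_distr h f $ i)"
    unfolding 1 2 by simp
qed

text \<open>Two exchanges of integrals carry the distributional definition to the function obtained
  by multiplying the transform of \<open>h\<close> by \<open>m\<close> and transforming back.
  Integrability of \<open>m\<close> makes every function that is transformed on the way
  integrable.\<close>

lemma represents_multiplier:
  fixes m :: "real^3 \<Rightarrow> real"
  assumes h: "integrable lborel h" and m: "integrable lborel m"
  shows "represents (\<lambda>x. \<chi> i. inv_fourier (\<lambda>\<xi>. of_real (m \<xi>) * fourier (ccomp h i) \<xi>) x)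
     (distr_inv_fourier (distr_mult m (distr_fourier (field_distr h))))" (is "represents ?g ?T")
proof -
  have [measurable]: "m \<in> borel_measurable borel" "h \<in> borel_measurable borel" using m h by auto
  have mc: "integrable lborel (\<lambda>\<xi>. complex_of_real (m \<xi>))" using m by (rule integrable_of_real)
  note fb = norm_fourier_le[of "ccomp h _"]
  have mF: "integrable lborel (\<lambda>\<xi>. of_real (m \<xi>) * fourier (ccomp h i) \<xi>)" for i
    using integrable_bounded_mult[OF _ fb mc] measurable_fourier[OF integrable_ccomp[OF h]] by (simp add: mult.commute)
  have [measurable]: "(\<lambda>x. ?g x $ i) \<in> borel_measurable borel" for i
    using measurable_inv_fourier[OF mF] by simp
  have gm: "?g \<in> borel_measurable borel"
  proof -
    have "(\<lambda>x. \<Sum>i\<in>UNIV. axis i (?g x $ i)) \<in> borel_measurable borel"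
      by (intro borel_measurable_sum measurable_compose[OF _ borel_measurable_continuous_onI[OF linear_continuous_on[OF bounded_linear_axis]]]) measurable
    then show ?thesis by (simp only: flip: vec_eq_sum_axis)
  qed
  show ?thesis
    unfolding represents_def
  proof (intro conjI allI impI)
    show "?g \<in> borel_measurable lborel" using gm by simp
    fix f :: "real^3 \<Rightarrow> complex" assume f: "schwartz f"
    have fi: "integrable lborel f" by (rule schwartz_integrable[OF f])
    have gf: "integrable lborel (\<lambda>x. inv_fourier (\<lambda>\<xi>. of_real (m \<xi>) * fourier (ccomp h i) \<xi>) x * f x)" for i
      by (rule integrable_bounded_mult[OF _ norm_inv_fourier_le fi]) (use measurable_inv_fourier[OF mF] in simp)
    show int: "integrable lborel (\<lambda>x. f x *s ?g x)"
      by (rule integrable_componentwise) (use gf in \<open>simp add: mult.commute\<close>)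
    let ?F = "\<lambda>\<xi>. complex_of_real (m \<xi>) * inv_fourier f \<xi>"
    have Fi: "integrable lborel ?F"
      using integrable_bounded_mult[OF _ norm_inv_fourier_le mc, of f "\<lambda>\<xi>. \<xi>"] measurable_inv_fourier[OF fi]
      by (simp add: mult.commute)
    have "?T f $ i = (\<integral>x. f x *s ?g x \<partial>lborel) $ i" for i
    proof -
      have "?T f $ i = field_distr h (fourier ?F) $ i"
        by (simp add: distr_inv_fourier_def distr_mult_def distr_fourier_def)
      also have "\<dots> = (\<integral>x. fourier ?F x * ccomp h i x \<partial>lborel)"
        by (rule field_distr_component[OF h measurable_fourier[OF Fi] norm_fourier_le])
      also have "\<dots> = (\<integral>x. ?F x * fourier (ccomp h i) x \<partial>lborel)"
        by (rule fourier_swap[OF Fi integrable_ccomp[OF h]])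
      also have "\<dots> = (\<integral>x. inv_fourier f x * (of_real (m x) * fourier (ccomp h i) x) \<partial>lborel)"
        by (simp add: mult_ac)
      also have "\<dots> = (\<integral>x. f x * inv_fourier (\<lambda>\<xi>. of_real (m \<xi>) * fourier (ccomp h i) \<xi>) x \<partial>lborel)"
        by (rule inv_fourier_swap[OF fi mF])
      finally show ?thesis by (simp add: integral_component[OF int])
    qed
    then show "?T f = (\<integral>x. f x *s ?g x \<partial>lborel)" by (simp add: vec_eq_iff)
  qed
qed

text \<open>The convolution kernel of the low-frequency cutoff. The kernels of all dyadic blocks are
  differences of its L^1-normalised dilates.\<close>

definition lp_kernel :: "(real^3 \<Rightarrow> real) \<Rightarrow> real^3 \<Rightarrow> complex"
  where "lp_kernel chi = inv_fourier (\<lambda>\<xi>. of_real (chi \<xi>))"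

context
  fixes chi :: "real^3 \<Rightarrow> real"
  assumes chi: "lp_cutoff chi"
begin

lemma chi_zero: "norm \<xi> > 1 \<Longrightarrow> chi \<xi> = 0"
proof (rule ccontr)
  assume \<xi>: "norm \<xi> > 1" and "chi \<xi> \<noteq> 0"
  then have "\<xi> \<in> {\<xi>. chi \<xi> \<noteq> 0}" by simp
  then have "\<xi> \<in> closure {\<xi>. chi \<xi> \<noteq> 0}" by (rule subsetD[OF closure_subset])
  moreover have "closure {\<xi>. chi \<xi> \<noteq> 0} \<subseteq> ball 0 1" using chi unfolding lp_cutoff_def by (elim conjE)
  ultimately have "\<xi> \<in> ball 0 1" by blast
  then show False using \<xi> by simp
qed

lemma schwartz_chi: "schwartz chi"
proof (rule smooth_compact_support_schwartz)
  show "smooth chi" using chi unfolding lp_cutoff_def by (elim conjE)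
qed (rule chi_zero)

lemma schwartz_chi_complex: "schwartz (\<lambda>\<xi>. complex_of_real (chi \<xi>))"
  by (rule schwartz_bounded_linear[OF bounded_linear_of_real schwartz_chi])

lemma integrable_chi_scaled:
  assumes "c \<noteq> 0"
  shows "integrable lborel (\<lambda>\<xi>. chi (c *\<^sub>R \<xi>))"
  using lborel_integrable_affine_iff[of chi c 0] assms schwartz_integrable[OF schwartz_chi] schwartz_measurable[OF schwartz_chi]
  by simp

lemma lp_kernel_decay:
  obtains C where "C \<ge> 0" "\<And>x. (1 + norm x) ^ N * norm (lp_kernel chi x) \<le> C"
proof -
  obtain C where C: "C \<ge> 0" "\<And>x. (1 + norm x) ^ N * norm (fourier (\<lambda>\<xi>. complex_of_real (chi \<xi>)) x) \<le> C"
    using fourier_rapid_decay[OF schwartz_chi_complex] by metis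
  show ?thesis
  proof (rule that[of "C / (2 * pi) ^ 3"])
    show "(1 + norm x) ^ N * norm (lp_kernel chi x) \<le> C / (2 * pi) ^ 3" for x
      using C(2)[of "- x"] by (simp add: lp_kernel_def inv_fourier_eq_fourier norm_divide norm_power norm_mult divide_right_mono)
  qed (use C(1) in simp)
qed

lemma measurable_lp_kernel: "lp_kernel chi \<in> borel_measurable borel"
  unfolding lp_kernel_def by (rule measurable_inv_fourier[OF schwartz_integrable[OF schwartz_chi_complex]])

lemma integrable_lp_kernel_moment: "integrable lborel (\<lambda>x. norm (lp_kernel chi x) * (1 + norm x) ^ N)"
proof -
  obtain C where C: "\<And>x. (1 + norm x) ^ (6 + N) * norm (lp_kernel chi x) \<le> C" using lp_kernel_decay by metis
  have *: "norm (norm (lp_kernel chi x) * (1 + norm x) ^ N) \<le> C * decay x" for x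
    by (rule le_decayI) (use C[of x] in \<open>simp add: power_add mult_ac abs_mult\<close>)
  note [measurable] = measurable_lp_kernel
  show ?thesis by (rule integrable_decay_bound[OF _ *]) measurable
qed

lemma integrable_lp_kernel: "integrable lborel (lp_kernel chi)"
  using integrable_lp_kernel_moment[of 0] by (simp add: integrable_norm_iff measurable_lp_kernel)

text \<open>The mass of the kernel is the value of the cutoff at the origin. Mass one is what makes
  an average minus the field an average of increments of the field.\<close>

lemma integral_lp_kernel: "(\<integral>x. lp_kernel chi x \<partial>lborel) = 1"
proof -
  obtain C where C: "\<And>x. norm (complex_of_real (chi x)) \<le> C" using schwartz_bounded[OF schwartz_chi_complex] by metis
  have "(\<integral>x. lp_kernel chi x \<partial>lborel) = of_real (chi 0)"
    unfolding lp_kernel_def using integrable_lp_kernel[unfolded lp_kernel_def]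
    by (intro integral_inv_fourier[OF _ _ C] schwartz_integrable[OF schwartz_chi_complex]
        continuous_on_smooth[OF schwartz_smooth[OF schwartz_chi_complex]])
  also have "chi 0 = 1"
  proof -
    have "\<forall>\<xi>. norm \<xi> \<le> 1/2 \<longrightarrow> chi \<xi> = 1" using chi unfolding lp_cutoff_def by (elim conjE)
    from this[rule_format, of 0] show ?thesis by simp
  qed
  finally show ?thesis by simp
qed

text \<open>The low-frequency cutoff at frequency 1/c is a convolution with a dilated kernel. In
  this form the kernel stays fixed and the scale sits in the displacement
  \<open>c *\<^sub>R z\<close>, so that increments of \<open>v\<close> at scale \<open>c\<close>
  appear directly.\<close>

lemma inv_fourier_chi_mult:
  assumes v: "integrable lborel v" and c: "c > 0"
  shows "inv_fourier (\<lambda>\<xi>. of_real (chi (c *\<^sub>R \<xi>)) * fourier v \<xi>) x = (\<integral>z. lp_kernel chi z * v (x - c *\<^sub>R z) \<partial>lborel)"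
proof -
  let ?m = "\<lambda>\<xi>. complex_of_real (chi (c *\<^sub>R \<xi>))"
  have [measurable]: "v \<in> borel_measurable borel" "chi \<in> borel_measurable borel"
    using v schwartz_measurable[OF schwartz_chi] by auto
  have m: "integrable lborel ?m" using c by (intro integrable_of_real integrable_chi_scaled) simp
  have K: "inv_fourier ?m (c *\<^sub>R z) = lp_kernel chi z / of_real (c ^ 3)" for z
  proof -
    have "(\<integral>\<xi>. cis (z \<bullet> \<xi>) * complex_of_real (chi \<xi>) \<partial>lborel) = c ^ 3 *\<^sub>R (\<integral>\<xi>. cis (c *\<^sub>R z \<bullet> \<xi>) * ?m \<xi> \<partial>lborel)"
      using c by (subst lborel_integral_affine[of _ c 0]) auto
    then show ?thesis using c
      by (simp add: lp_kernel_def inv_fourier_def scaleR_conv_of_real[where 'a=complex])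
  qed
  have F: "fourier (\<lambda>\<xi>. cis (x \<bullet> \<xi>) * ?m \<xi>) y = of_real ((2 * pi) ^ 3) * inv_fourier ?m (x - y)" for y
    by (simp add: fourier_def inv_fourier_def inner_diff_left inner_diff_right inner_commute cis_mult flip: mult.assoc)
  have mi: "integrable lborel (\<lambda>\<xi>. cis (x \<bullet> \<xi>) * ?m \<xi>)" using m by (intro integrable_cis_mult) auto
  have [measurable]: "inv_fourier ?m \<in> borel_measurable borel" by (rule measurable_inv_fourier[OF m])
  have "(\<integral>\<xi>. cis (x \<bullet> \<xi>) * (?m \<xi> * fourier v \<xi>) \<partial>lborel) = (\<integral>\<xi>. fourier v \<xi> * (cis (x \<bullet> \<xi>) * ?m \<xi>) \<partial>lborel)"
    by (simp add: mult_ac)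
  also have "\<dots> = (\<integral>y. v y * fourier (\<lambda>\<xi>. cis (x \<bullet> \<xi>) * ?m \<xi>) y \<partial>lborel)"
    by (rule fourier_swap[OF v mi])
  also have "\<dots> = (\<integral>y. of_real ((2 * pi) ^ 3) * (v y * inv_fourier ?m (x - y)) \<partial>lborel)"
    unfolding F by (simp add: mult_ac)
  also have "\<dots> = of_real ((2 * pi) ^ 3) * (\<integral>y. v y * inv_fourier ?m (x - y) \<partial>lborel)"
    by (rule integral_mult_right_zero)
  \<comment> \<open>Substituting y = x - c z; the Jacobian c^3 cancels the power of \<open>c\<close>
    in \<open>K\<close>.\<close>
  also have "(\<integral>y. v y * inv_fourier ?m (x - y) \<partial>lborel) =
      c ^ 3 *\<^sub>R (\<integral>z. v (x + (- c) *\<^sub>R z) * inv_fourier ?m (x - (x + (- c) *\<^sub>R z)) \<partial>lborel)"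
    using c by (subst lborel_integral_affine[of _ "- c" x]) auto
  also have "\<dots> = (\<integral>z. c ^ 3 *\<^sub>R (v (x - c *\<^sub>R z) * inv_fourier ?m (c *\<^sub>R z)) \<partial>lborel)" by simp
  also have "\<dots> = (\<integral>z. lp_kernel chi z * v (x - c *\<^sub>R z) \<partial>lborel)"
    unfolding K using c by (intro Bochner_Integration.integral_cong refl) (simp add: scaleR_conv_of_real[where 'a=complex])
  finally show ?thesis by (simp add: inv_fourier_def)
qed

end

section \<open>Besov norms of modulated fields\<close>

lemma epowr_mono: "x \<le> y \<Longrightarrow> a \<ge> 0 \<Longrightarrow> epowr x a \<le> epowr y a"
  unfolding epowr_def
  by (cases "y = \<infinity>") (auto intro!: ennreal_leI powr_mono2 enn2real_mono simp: top_unique less_top)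

lemma epowr_ennreal: "x \<ge> 0 \<Longrightarrow> epowr (ennreal x) a = ennreal (x powr a)"
  by (simp add: epowr_def)

text \<open>Since the weight is at most 1 and p > 1, its p-th power is below the weight itself. One
  integrable majorant therefore serves all p.\<close>

lemma distr_Lp_norm_le:
  assumes "represents g T" and p: "p > 1" and A: "A \<ge> 0" and g: "\<And>x. norm (g x) \<le> A * decay x"
  shows "distr_Lp_norm p T \<le> ennreal (A * (\<integral>x. decay x \<partial>lborel) powr (1/p))"
proof -
  let ?J = "\<integral>x. decay x \<partial>lborel"
  have J: "?J \<ge> 0" by (intro Bochner_Integration.integral_nonneg) simp
  have "norm (g x) powr p \<le> A powr p * decay x" for x
  proof -
    have "norm (g x) powr p \<le> (A * decay x) powr p" using p g by (intro powr_mono2) auto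
    also have "\<dots> = A powr p * decay x powr p" using A by (simp add: powr_mult)
    also have "decay x powr p \<le> decay x powr 1" 
      using p decay_le_1[of x] decay_pos[of x] by (intro powr_mono') auto
    also have "decay x powr 1 = decay x" by simp
    finally show ?thesis by (simp add: mult_left_mono)
  qed
  then have "(\<integral>\<^sup>+x. ennreal (norm (g x) powr p) \<partial>lborel) \<le> (\<integral>\<^sup>+x. ennreal (A powr p * decay x) \<partial>lborel)"
    by (intro nn_integral_mono ennreal_leI)
  also have "\<dots> = ennreal (A powr p * ?J)"
    by (subst nn_integral_eq_integral) (auto intro!: integrable_decay)
  finally have "Lp_norm p g \<le> epowr (ennreal (A powr p * ?J)) (1/p)"
    unfolding Lp_norm_def using p by (intro epowr_mono) auto
  also have "\<dots> = ennreal (A * ?J powr (1/p))"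
    using p J A by (simp add: epowr_ennreal powr_mult powr_powr)
  finally show ?thesis
    unfolding distr_Lp_norm_def using assms(1) by (meson INF_lower2 mem_Collect_eq)
qed

text \<open>The constant depends on \<open>e\<close> and \<open>r\<close> only, which later makes
  the bounds on tails uniform. For infinite \<open>r\<close> a supremum is bounded by 1; otherwise
  \<open>L\<close> comes from the convergent sum of (q+1)^(-e r). The condition on \<open>r\<close>
  is restricted to the finite case because \<open>enn2real\<close> maps infinity to 0.\<close>

lemma lr_norm_le:
  fixes r :: ennreal
  assumes e: "e > 0" and r: "r \<noteq> \<infinity> \<Longrightarrow> enn2real r > 0 \<and> e * enn2real r > 1"
  obtains L where "L \<ge> 0"
    "\<And>a B. B \<ge> 0 \<Longrightarrow> (\<And>q. a q \<le> ennreal (B * (real q + 1) powr (- e))) \<Longrightarrow> lr_norm r a \<le> ennreal (B * L)"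
proof (cases "r = \<infinity>")
  case True
  show ?thesis
  proof (rule that[of 1])
    fix a :: "nat \<Rightarrow> ennreal" and B :: real assume B: "B \<ge> 0" and a: "\<And>q. a q \<le> ennreal (B * (real q + 1) powr (- e))"
    have "a q \<le> ennreal (B * 1)" for q
    proof (rule order_trans[OF a ennreal_leI])
      have "(real q + 1) powr (- e) \<le> 1" using powr_mono2'[of "- e" 1 "real q + 1"] e by simp
      then show "B * (real q + 1) powr (- e) \<le> B * 1" using B by (intro mult_left_mono) auto
    qed
    then show "lr_norm r a \<le> ennreal (B * 1)" using True by (auto simp: lr_norm_def intro!: SUP_least)
  qed simp
next
  case False
  define R where "R = enn2real r"
  have R: "R > 0" "e * R > 1" using r False by (auto simp: R_def)
  define S where "S = (\<Sum>q. (real q + 1) powr (- (e * R)))"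
  have sm: "summable (\<lambda>q. (real q + 1) powr (- (e * R)))"
  proof -
    have "summable (\<lambda>q. real q powr (- (e * R)))" using R(2) by (subst summable_real_powr_iff) simp
    then have "summable (\<lambda>q. real (Suc q) powr (- (e * R)))" by (subst summable_Suc_iff)
    then show ?thesis by (simp add: add.commute)
  qed
  have S: "S \<ge> 0" unfolding S_def by (intro suminf_nonneg sm) auto
  show ?thesis
  proof (rule that[of "S powr (1/R)"])
    fix a :: "nat \<Rightarrow> ennreal" and B :: real assume B: "B \<ge> 0" and a: "\<And>q. a q \<le> ennreal (B * (real q + 1) powr (- e))"
    have "epowr (a q) R \<le> ennreal (B powr R * (real q + 1) powr (- (e * R)))" for q
    proof -
      have "epowr (a q) R \<le> epowr (ennreal (B * (real q + 1) powr (- e))) R"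
        using R a by (intro epowr_mono) auto
      also have "\<dots> = ennreal (B powr R * (real q + 1) powr (- (e * R)))"
        using B by (simp add: epowr_ennreal powr_mult powr_powr)
      finally show ?thesis .
    qed
    then have "(\<Sum>q. epowr (a q) R) \<le> (\<Sum>q. ennreal (B powr R * (real q + 1) powr (- (e * R))))"
      by (intro suminf_le) auto
    also have "\<dots> = ennreal (B powr R * S)"
      unfolding S_def by (subst suminf_mult[symmetric, OF sm], intro suminf_ennreal2 summable_mult sm) auto
    finally have "lr_norm r a \<le> epowr (ennreal (B powr R * S)) (1/R)"
      unfolding lr_norm_def using False R by (auto simp: R_def intro!: epowr_mono)
    also have "\<dots> = ennreal (B * S powr (1/R))"
      using R B S by (simp add: epowr_ennreal powr_mult powr_powr)
    finally show "lr_norm r a \<le> ennreal (B * S powr (1/R))" .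
  qed simp
qed

text \<open>The slowly varying spatial envelope: \<open>M\<close> bounds both its size and its
  Lipschitz constant relative to the weight. The sixth power is the price of comparing the weights
  at \<open>x - y\<close> and \<open>x\<close>.\<close>

definition profile :: "real \<Rightarrow> (real^3 \<Rightarrow> real^3) \<Rightarrow> bool"
  where "profile M \<psi> \<longleftrightarrow> M \<ge> 0 \<and> \<psi> \<in> borel_measurable borel \<and> (\<forall>x. norm (\<psi> x) \<le> M * decay x) \<and>
    (\<forall>x y. norm (\<psi> (x - y) - \<psi> x) \<le> M * norm y * (1 + norm y) ^ 6 * decay x)"

text \<open>\<open>\<sigma> q\<close> controls the oscillation of \<open>\<Theta>\<close> on the scale \<open>2\<^sup>-\<^sup>q\<close>.\<close>

definition modulation :: "real \<Rightarrow> (nat \<Rightarrow> real) \<Rightarrow> (real \<Rightarrow> real) \<Rightarrow> bool"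
  where "modulation A \<sigma> \<Theta> \<longleftrightarrow> A \<ge> 0 \<and> \<Theta> \<in> borel_measurable borel \<and> (\<forall>t. \<bar>\<Theta> t\<bar> \<le> A) \<and>
    (\<forall>q. A / 2 ^ q \<le> \<sigma> q) \<and> (\<forall>q t t'. \<bar>\<Theta> t - \<Theta> t'\<bar> \<le> (1 + 2 ^ q * \<bar>t - t'\<bar>) * \<sigma> q)"

text \<open>The product rule for increments: one term moves the envelope, the other the oscillating
  factor. The exponent 7 is the 6 lost in shifting the weight plus 1 for the displacement.\<close>

lemma modulated_profile_bounds:
  assumes \<psi>: "profile M \<psi>" and \<Theta>: "modulation A \<sigma> \<Theta>"
  defines "h \<equiv> \<lambda>x. \<Theta> (x$1) *\<^sub>R \<psi> x"
  shows "h \<in> borel_measurable borel" "norm (h x) \<le> A * M * decay x"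
    "norm (h (x - z /\<^sub>R 2 ^ q) - h x) \<le> 2 * M * \<sigma> q * (1 + norm z) ^ 7 * decay x"
proof -
  have M: "M \<ge> 0" and \<psi>1: "\<And>x. norm (\<psi> x) \<le> M * decay x"
    and \<psi>2: "\<And>x y. norm (\<psi> (x - y) - \<psi> x) \<le> M * norm y * (1 + norm y) ^ 6 * decay x"
    and [measurable]: "\<psi> \<in> borel_measurable borel" using \<psi> by (auto simp: profile_def)
  have A: "A \<ge> 0" and \<Theta>1: "\<And>t. \<bar>\<Theta> t\<bar> \<le> A" and \<sigma>: "\<And>q. A / 2 ^ q \<le> \<sigma> q"
    and \<Theta>2: "\<And>q t t'. \<bar>\<Theta> t - \<Theta> t'\<bar> \<le> (1 + 2 ^ q * \<bar>t - t'\<bar>) * \<sigma> q"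
    and [measurable]: "\<Theta> \<in> borel_measurable borel" using \<Theta> by (auto simp: modulation_def)
  show "h \<in> borel_measurable borel" unfolding h_def by measurable
  have "norm (h x) \<le> A * (M * decay x)"
    unfolding h_def norm_scaleR by (intro mult_mono \<Theta>1 \<psi>1 A) auto
  then show "norm (h x) \<le> A * M * decay x" by simp
  have \<sigma>0: "\<sigma> q \<ge> 0" using \<sigma>[of q] A by (meson divide_nonneg_nonneg order_trans zero_le_numeral zero_le_power)
  let ?y = "z /\<^sub>R 2 ^ q"
  have y: "norm ?y = norm z / 2 ^ q" "norm ?y \<le> norm z"
    by (auto simp: divide_inverse mult.commute[of "inverse _"] inverse_le_1_iff intro!: mult_left_le)
  have eq: "h (x - ?y) - h x = \<Theta> ((x - ?y)$1) *\<^sub>R (\<psi> (x - ?y) - \<psi> x) + (\<Theta> ((x - ?y)$1) - \<Theta> (x$1)) *\<^sub>R \<psi> x"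
    by (simp add: h_def algebra_simps)
  have 1: "norm (\<Theta> ((x - ?y)$1) *\<^sub>R (\<psi> (x - ?y) - \<psi> x)) \<le> M * \<sigma> q * (1 + norm z) ^ 7 * decay x"
  proof -
    have "norm (\<Theta> ((x - ?y)$1) *\<^sub>R (\<psi> (x - ?y) - \<psi> x)) \<le> A * (M * norm ?y * (1 + norm ?y) ^ 6 * decay x)"
      unfolding norm_scaleR[of "\<Theta> _"] by (rule mult_mono[OF \<Theta>1 \<psi>2 A norm_ge_zero])
    also have "\<dots> = (A / 2 ^ q) * (M * decay x) * (norm z * (1 + norm ?y) ^ 6)"
      unfolding y(1) by simp
    \<comment> \<open>Moving the envelope costs \<open>A / 2 ^ q\<close>; the lower bound on
      \<open>\<sigma> q\<close> in \<open>modulation\<close> is there to absorb it.\<close>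
    also have "\<dots> \<le> \<sigma> q * (M * decay x) * ((1 + norm z) * (1 + norm z) ^ 6)"
      using y(2) M \<sigma>0 by (intro mult_mono \<sigma> power_mono mult_nonneg_nonneg) auto
    also have "(1 + norm z) * (1 + norm z) ^ 6 = (1 + norm z) ^ 7"
      using power_Suc[of "1 + norm z" 6] by simp
    finally show ?thesis by (simp add: mult_ac)
  qed
  have 2: "norm ((\<Theta> ((x - ?y)$1) - \<Theta> (x$1)) *\<^sub>R \<psi> x) \<le> M * \<sigma> q * (1 + norm z) ^ 7 * decay x"
  proof -
    \<comment> \<open>The dilation of the displacement by 2^-q cancels the factor 2^q in the
      oscillation bound, which leaves a factor independent of \<open>q\<close>.\<close>
    have "2 ^ q * \<bar>(x - ?y)$1 - x$1\<bar> = \<bar>z$1\<bar>" by (simp add: abs_mult)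
    then have "\<bar>\<Theta> ((x - ?y)$1) - \<Theta> (x$1)\<bar> \<le> (1 + \<bar>z$1\<bar>) * \<sigma> q"
      using \<Theta>2[of "(x - ?y)$1" "x$1" q] by simp
    also have "\<dots> \<le> (1 + norm z) * \<sigma> q"
      using component_le_norm_cart[of z 1] \<sigma>0 by (intro mult_right_mono) auto
    also have "\<dots> \<le> (1 + norm z) ^ 7 * \<sigma> q"
      using \<sigma>0 power_increasing[of 1 7 "1 + norm z"] by (intro mult_right_mono) auto
    finally have "\<bar>\<Theta> ((x - ?y)$1) - \<Theta> (x$1)\<bar> \<le> (1 + norm z) ^ 7 * \<sigma> q" .
    then have "norm ((\<Theta> ((x - ?y)$1) - \<Theta> (x$1)) *\<^sub>R \<psi> x) \<le> ((1 + norm z) ^ 7 * \<sigma> q) * (M * decay x)"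
      unfolding norm_scaleR using \<sigma>0 by (intro mult_mono \<psi>1) auto
    then show ?thesis by (simp add: mult_ac)
  qed
  show "norm (h (x - ?y) - h x) \<le> 2 * M * \<sigma> q * (1 + norm z) ^ 7 * decay x"
    unfolding eq using norm_triangle_mono[OF 1 2] by (simp add: mult_ac)
qed

lemma integrable_modulated_profile:
  assumes "profile M \<psi>" and "modulation A \<sigma> \<Theta>"
  shows "integrable lborel (\<lambda>x. \<Theta> (x$1) *\<^sub>R \<psi> x)"
  using modulated_profile_bounds(1,2)[OF assms] by (rule integrable_decay_bound)

context
  fixes chi :: "real^3 \<Rightarrow> real"
  assumes chi: "lp_cutoff chi"
begin

text \<open>The order 7 matches the polynomial growth in \<open>z\<close> of the increments of a
  modulated profile.\<close>

definition kernel_moment :: real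
  where "kernel_moment = (\<integral>z. norm (lp_kernel chi z) * (1 + norm z) ^ 7 \<partial>lborel)"

lemma kernel_moment_nonneg: "kernel_moment \<ge> 0"
  unfolding kernel_moment_def by (intro Bochner_Integration.integral_nonneg) simp

text \<open>Because the kernel has mass one, the difference is the average of the increments of
  \<open>h\<close> at displacement 2^-q z, each bounded by \<sigma> q times a power of 1 + |z| that
  the kernel moment integrates.\<close>

lemma smoothing_error:
  assumes \<psi>: "profile M \<psi>" and \<Theta>: "modulation A \<sigma> \<Theta>"
  defines "h \<equiv> \<lambda>x. \<Theta> (x$1) *\<^sub>R \<psi> x"
  shows "norm (inv_fourier (\<lambda>\<xi>. of_real (chi (inverse (2 ^ q) *\<^sub>R \<xi>)) * fourier (ccomp h i) \<xi>) x - ccomp h i x)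
     \<le> 2 * M * kernel_moment * \<sigma> q * decay x"
proof -
  note b = modulated_profile_bounds[OF \<psi> \<Theta>, folded h_def]
  have [measurable]: "h \<in> borel_measurable borel" by (rule b(1))
  have hi: "integrable lborel h" unfolding h_def by (rule integrable_modulated_profile[OF \<psi> \<Theta>])
  let ?K = "lp_kernel chi"
  note [measurable] = measurable_lp_kernel[OF chi]
  have bd: "norm (?K z * (ccomp h i (x - inverse (2 ^ q) *\<^sub>R z) - ccomp h i x))
     \<le> (2 * M * \<sigma> q * decay x) * (norm (?K z) * (1 + norm z) ^ 7)" for z
  proof -
    have "norm (ccomp h i (x - inverse (2 ^ q) *\<^sub>R z) - ccomp h i x) \<le> norm (h (x - z /\<^sub>R 2 ^ q) - h x)"
      using component_le_norm_cart[of "h (x - z /\<^sub>R 2 ^ q) - h x" i]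
      by (simp flip: of_real_diff)
    also have "\<dots> \<le> 2 * M * \<sigma> q * (1 + norm z) ^ 7 * decay x"
      unfolding h_def by (rule modulated_profile_bounds(3)[OF \<psi> \<Theta>])
    finally have "norm (?K z) * norm (ccomp h i (x - inverse (2 ^ q) *\<^sub>R z) - ccomp h i x) \<le> norm (?K z) * (2 * M * \<sigma> q * (1 + norm z) ^ 7 * decay x)"
      by (intro mult_left_mono) auto
    then show ?thesis by (simp add: norm_mult mult_ac)
  qed
  have int: "integrable lborel (\<lambda>z. ?K z * (ccomp h i (x - inverse (2 ^ q) *\<^sub>R z) - ccomp h i x))"
  proof (rule Bochner_Integration.integrable_bound)
    show "integrable lborel (\<lambda>z. (2 * M * \<sigma> q * decay x) * (norm (?K z) * (1 + norm z) ^ 7))"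
      by (intro integrable_mult_right integrable_lp_kernel_moment[OF chi])
    show "(\<lambda>z. ?K z * (ccomp h i (x - inverse (2 ^ q) *\<^sub>R z) - ccomp h i x)) \<in> borel_measurable lborel"
    proof -
      have [measurable]: "ccomp h i \<in> borel_measurable borel" using integrable_ccomp[OF hi] by auto
      have "(\<lambda>z. ccomp h i (x - inverse (2 ^ q) *\<^sub>R z)) \<in> borel_measurable borel"
        by (rule measurable_compose[where g="ccomp h i"]) measurable
      then show ?thesis by measurable
    qed
  qed (use bd in \<open>auto intro!: order_trans[OF _ abs_ge_self]\<close>)
  have int2: "integrable lborel (\<lambda>z. ?K z * ccomp h i x)"
    using integrable_lp_kernel[OF chi] by simp
  have "inv_fourier (\<lambda>\<xi>. of_real (chi (inverse (2 ^ q) *\<^sub>R \<xi>)) * fourier (ccomp h i) \<xi>) x =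
     (\<integral>z. ?K z * ccomp h i (x - inverse (2 ^ q) *\<^sub>R z) \<partial>lborel)"
    by (rule inv_fourier_chi_mult[OF chi integrable_ccomp[OF hi]]) simp
  also have "\<dots> = (\<integral>z. ?K z * (ccomp h i (x - inverse (2 ^ q) *\<^sub>R z) - ccomp h i x) + ?K z * ccomp h i x \<partial>lborel)"
    by (simp add: algebra_simps)
  also have "\<dots> = (\<integral>z. ?K z * (ccomp h i (x - inverse (2 ^ q) *\<^sub>R z) - ccomp h i x) \<partial>lborel) + ccomp h i x"
    by (subst Bochner_Integration.integral_add[OF int int2]) (simp add: integral_lp_kernel[OF chi])
  finally have "norm (inv_fourier (\<lambda>\<xi>. of_real (chi (inverse (2 ^ q) *\<^sub>R \<xi>)) * fourier (ccomp h i) \<xi>) x - ccomp h i x) =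
     norm (\<integral>z. ?K z * (ccomp h i (x - inverse (2 ^ q) *\<^sub>R z) - ccomp h i x) \<partial>lborel)" by simp
  also have "\<dots> \<le> (\<integral>z. norm (?K z * (ccomp h i (x - inverse (2 ^ q) *\<^sub>R z) - ccomp h i x)) \<partial>lborel)"
    by (rule integral_norm_bound)
  also have "\<dots> \<le> (\<integral>z. (2 * M * \<sigma> q * decay x) * (norm (?K z) * (1 + norm z) ^ 7) \<partial>lborel)"
    by (intro integral_mono bd integrable_norm int integrable_mult_right integrable_lp_kernel_moment[OF chi])
  also have "\<dots> = 2 * M * kernel_moment * \<sigma> q * decay x"
    by (simp add: kernel_moment_def mult_ac)
  finally show ?thesis .
qed

lemma modulation_nonneg: "modulation A \<sigma> \<Theta> \<Longrightarrow> \<sigma> q \<ge> 0"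
  unfolding modulation_def by (meson divide_nonneg_nonneg order_trans zero_le_numeral zero_le_power)

text \<open>The symbol of a block is the cutoff at scale q+1 minus the cutoff at scale q, so the
  block is a difference of two smoothing errors and the field itself cancels. The factor 6 is 2 from
  the smoothing error times 3 components.\<close>

lemma lp_block_bound:
  assumes \<psi>: "profile M \<psi>" and \<Theta>: "modulation A \<sigma> \<Theta>" and p: "p > 1"
  shows "distr_Lp_norm p (lp_block chi q (field_distr (\<lambda>x. \<Theta> (x$1) *\<^sub>R \<psi> x))) \<le>
    ennreal (6 * M * kernel_moment * (\<sigma> q + \<sigma> (Suc q)) * (\<integral>x. decay x \<partial>lborel) powr (1/p))"
proof -
  define h where "h = (\<lambda>x::real^3. \<Theta> (x$1) *\<^sub>R \<psi> x)"
  have hi: "integrable lborel h" unfolding h_def by (rule integrable_modulated_profile[OF \<psi> \<Theta>])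
  have M: "M \<ge> 0" using \<psi> by (simp add: profile_def)
  let ?m = "\<lambda>q \<xi>. chi (inverse (2 ^ q) *\<^sub>R \<xi>)"
  let ?P = "\<lambda>q i. inv_fourier (\<lambda>\<xi>. of_real (?m q \<xi>) * fourier (ccomp h i) \<xi>)"
  have m: "integrable lborel (?m q)" for q by (rule integrable_chi_scaled[OF chi]) simp
  have phi: "lp_phi chi (inverse (2 ^ q) *\<^sub>R \<xi>) = ?m (Suc q) \<xi> - ?m q \<xi>" for \<xi>
    by (simp add: lp_phi_def mult.commute)
  have mF: "integrable lborel (\<lambda>\<xi>. of_real (?m q \<xi>) * fourier (ccomp h i) \<xi>)" for q i
    using integrable_bounded_mult[OF _ norm_fourier_le integrable_of_real[OF m], of "ccomp h i" "\<lambda>\<xi>. \<xi>"]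
      measurable_fourier[OF integrable_ccomp[OF hi]] by (simp add: mult.commute)
  define g where "g x = (\<chi> i. inv_fourier (\<lambda>\<xi>. of_real (lp_phi chi (inverse (2 ^ q) *\<^sub>R \<xi>)) * fourier (ccomp h i) \<xi>) x)" for x
  have g: "g x $ i = ?P (Suc q) i x - ?P q i x" for x i
  proof -
    have "(\<lambda>\<xi>. cis (x \<bullet> \<xi>) * (of_real (lp_phi chi (inverse (2 ^ q) *\<^sub>R \<xi>)) * fourier (ccomp h i) \<xi>)) =
      (\<lambda>\<xi>. cis (x \<bullet> \<xi>) * (of_real (?m (Suc q) \<xi>) * fourier (ccomp h i) \<xi>) - cis (x \<bullet> \<xi>) * (of_real (?m q \<xi>) * fourier (ccomp h i) \<xi>))"
      unfolding phi by (simp add: algebra_simps)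
    moreover have "integrable lborel (\<lambda>\<xi>. cis (x \<bullet> \<xi>) * (of_real (?m q \<xi>) * fourier (ccomp h i) \<xi>))" for q
      by (rule integrable_cis_mult[OF mF]) simp
    ultimately show ?thesis
      unfolding g_def vec_lambda_beta inv_fourier_def
      by (simp only: Bochner_Integration.integral_diff diff_divide_distrib)
  qed
  have "represents g (lp_block chi q (field_distr h))"
    unfolding g_def lp_block_def
    by (rule represents_multiplier[OF hi]) (unfold phi, intro Bochner_Integration.integrable_diff m)
  moreover have "norm (g x) \<le> (6 * M * kernel_moment * (\<sigma> q + \<sigma> (Suc q))) * decay x" for x
  proof -
    have "norm (g x $ i) \<le> 2 * M * kernel_moment * \<sigma> (Suc q) * decay x + 2 * M * kernel_moment * \<sigma> q * decay x" for i
    proof -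
      have eq: "g x $ i = (?P (Suc q) i x - ccomp h i x) - (?P q i x - ccomp h i x)" by (simp add: g)
      have 1: "norm (?P q i x - ccomp h i x) \<le> 2 * M * kernel_moment * \<sigma> q * decay x" for q
        unfolding h_def by (rule smoothing_error[OF \<psi> \<Theta>])
      show ?thesis
        unfolding eq by (rule order_trans[OF norm_triangle_ineq4 add_mono[OF 1 1]])
    qed
    then have "(\<Sum>i\<in>UNIV. norm (g x $ i)) \<le> (\<Sum>i\<in>(UNIV::3 set). 2 * M * kernel_moment * \<sigma> (Suc q) * decay x + 2 * M * kernel_moment * \<sigma> q * decay x)"
      by (intro sum_mono)
    then show ?thesis using norm_le_sum_components[of "g x"] by (simp add: algebra_simps)
  qed
  ultimately show ?thesis
    unfolding h_def[symmetric] using M kernel_moment_nonneg modulation_nonneg[OF \<Theta>]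
    by (intro distr_Lp_norm_le[OF _ p, of g]) auto
qed

text \<open>The lowest block has no cancelling partner: it is the smoothing error at scale 1 plus
  the field, whose size contributes the term with \<open>A\<close>.\<close>

lemma lp_block_low_bound:
  assumes \<psi>: "profile M \<psi>" and \<Theta>: "modulation A \<sigma> \<Theta>" and p: "p > 1"
  shows "distr_Lp_norm p (lp_block_low chi (field_distr (\<lambda>x. \<Theta> (x$1) *\<^sub>R \<psi> x))) \<le>
    ennreal ((6 * M * kernel_moment * \<sigma> 0 + 3 * M * A) * (\<integral>x. decay x \<partial>lborel) powr (1/p))"
proof -
  define h where "h = (\<lambda>x::real^3. \<Theta> (x$1) *\<^sub>R \<psi> x)"
  have hi: "integrable lborel h" unfolding h_def by (rule integrable_modulated_profile[OF \<psi> \<Theta>])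
  have M: "M \<ge> 0" using \<psi> by (simp add: profile_def)
  have A: "A \<ge> 0" using \<Theta> by (simp add: modulation_def)
  define g where "g x = (\<chi> i. inv_fourier (\<lambda>\<xi>. of_real (chi \<xi>) * fourier (ccomp h i) \<xi>) x)" for x
  have "represents g (lp_block_low chi (field_distr h))"
    unfolding g_def lp_block_low_def
    by (rule represents_multiplier[OF hi schwartz_integrable[OF schwartz_chi[OF chi]]])
  moreover have "norm (g x) \<le> (6 * M * kernel_moment * \<sigma> 0 + 3 * M * A) * decay x" for x
  proof -
    have "norm (g x $ i) \<le> 2 * M * kernel_moment * \<sigma> 0 * decay x + A * M * decay x" for i
    proof -
      have "norm (g x $ i - ccomp h i x) \<le> 2 * M * kernel_moment * \<sigma> 0 * decay x"
        using smoothing_error[OF \<psi> \<Theta>, of 0 i x] by (simp add: g_def h_def)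
      moreover have "norm (ccomp h i x) \<le> A * M * decay x"
        unfolding norm_of_real
        using order_trans[OF component_le_norm_cart modulated_profile_bounds(2)[OF \<psi> \<Theta>, of x]]
        unfolding h_def by simp
      ultimately show ?thesis using norm_triangle_ineq[of "g x $ i - ccomp h i x" "ccomp h i x"] by simp
    qed
    then have "(\<Sum>i\<in>UNIV. norm (g x $ i)) \<le> (\<Sum>i\<in>(UNIV::3 set). 2 * M * kernel_moment * \<sigma> 0 * decay x + A * M * decay x)"
      by (intro sum_mono)
    then show ?thesis using norm_le_sum_components[of "g x"] by (simp add: algebra_simps)
  qed
  ultimately show ?thesis
    unfolding h_def[symmetric] using M A kernel_moment_nonneg modulation_nonneg[OF \<Theta>]
    by (intro distr_Lp_norm_le[OF _ p, of g]) auto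
qed

text \<open>\<open>C\<close> is chosen before the modulation, so the norm is linear in the amplitude
  \<open>d\<close>. This uniformity lets the same bound show finiteness of a norm and smallness of a
  remainder.\<close>

lemma besov_norm_modulated:
  fixes r :: ennreal
  assumes \<psi>: "profile M \<psi>" and p: "p > 1" and s: "0 \<le> s" "s \<le> 1/2"
    and e: "e > 0" and r: "r \<noteq> \<infinity> \<Longrightarrow> enn2real r > 0 \<and> e * enn2real r > 1"
  obtains C where "C \<ge> 0"
    "\<And>A \<sigma> \<Theta> d. modulation A \<sigma> \<Theta> \<Longrightarrow> A \<le> d \<Longrightarrow> (\<And>q. 2 powr (real q / 2) * \<sigma> q \<le> d * (real q + 1) powr (- e)) \<Longrightarrow>
      besov_norm chi s p r (field_distr (\<lambda>x. \<Theta> (x$1) *\<^sub>R \<psi> x)) \<le> ennreal (C * d)"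
proof -
  obtain L where L: "L \<ge> 0"
    "\<And>a B. B \<ge> 0 \<Longrightarrow> (\<And>q. a q \<le> ennreal (B * (real q + 1) powr (- e))) \<Longrightarrow> lr_norm r a \<le> ennreal (B * L)"
    using lr_norm_le[OF e r] by metis
  have M: "M \<ge> 0" using \<psi> by (simp add: profile_def)
  define D where "D = (\<integral>x. decay x \<partial>lborel) powr (1/p)"
  have D: "D \<ge> 0" by (simp add: D_def)
  define k where "k = 6 * M * kernel_moment * D"
  have k: "k \<ge> 0" using M D kernel_moment_nonneg by (simp add: k_def)
  show ?thesis
  proof (rule that[of "k + 3 * M * D + 2 * k * L"])
    show "k + 3 * M * D + 2 * k * L \<ge> 0" using k M D L by simp
    fix A \<sigma> \<Theta> d assume \<Theta>: "modulation A \<sigma> \<Theta>" and A: "A \<le> d"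
      and \<sigma>: "\<And>q. 2 powr (real q / 2) * \<sigma> q \<le> d * (real q + 1) powr (- e)"
    let ?h = "\<lambda>x::real^3. \<Theta> (x$1) *\<^sub>R \<psi> x"
    have d: "d \<ge> 0" using A \<Theta> by (simp add: modulation_def)
    have \<sigma>0: "\<sigma> q \<ge> 0" for q using modulation_nonneg[OF \<Theta>] .
    have "distr_Lp_norm p (lp_block_low chi (field_distr ?h)) \<le> ennreal (k * \<sigma> 0 + 3 * M * A * D)"
      using lp_block_low_bound[OF \<psi> \<Theta> p] by (simp add: k_def D_def algebra_simps)
    also have "\<dots> \<le> ennreal ((k + 3 * M * D) * d)"
    proof (rule ennreal_leI)
      have "k * \<sigma> 0 \<le> k * d" using \<sigma>[of 0] k by (intro mult_left_mono) auto
      moreover have "3 * M * A * D \<le> 3 * M * d * D" using A M D by (intro mult_right_mono mult_left_mono) auto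
      ultimately show "k * \<sigma> 0 + 3 * M * A * D \<le> (k + 3 * M * D) * d" by (simp add: algebra_simps)
    qed
    finally have low: "distr_Lp_norm p (lp_block_low chi (field_distr ?h)) \<le> ennreal ((k + 3 * M * D) * d)" .
    have "lr_norm r (\<lambda>q. ennreal ((2 ^ q) powr s) * distr_Lp_norm p (lp_block chi q (field_distr ?h))) \<le> ennreal (2 * k * d * L)"
    proof (rule L(2))
      show "0 \<le> 2 * k * d" using k d by simp
      fix q
      have "ennreal ((2 ^ q) powr s) * distr_Lp_norm p (lp_block chi q (field_distr ?h)) \<le>
          ennreal ((2 ^ q) powr s) * ennreal (k * (\<sigma> q + \<sigma> (Suc q)))"
      proof (intro mult_left_mono)
        have "6 * M * kernel_moment * (\<sigma> q + \<sigma> (Suc q)) * (\<integral>x. decay x \<partial>lborel) powr (1/p) = k * (\<sigma> q + \<sigma> (Suc q))"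
          by (simp add: k_def D_def algebra_simps)
        then show "distr_Lp_norm p (lp_block chi q (field_distr ?h)) \<le> ennreal (k * (\<sigma> q + \<sigma> (Suc q)))"
          using lp_block_bound[OF \<psi> \<Theta> p, of q] by (simp only:)
      qed simp
      also have "\<dots> = ennreal ((2 ^ q) powr s * (k * (\<sigma> q + \<sigma> (Suc q))))"
        by (simp add: ennreal_mult')
      also have "\<dots> \<le> ennreal (2 * k * d * (real q + 1) powr (- e))"
      proof (rule ennreal_leI)
        \<comment> \<open>Here s \<le> 1/2 enters: all smoothness exponents are reduced to the
          critical one.\<close>
        have 1: "(2 ^ q) powr s \<le> 2 powr (real q / 2)"
          using mult_left_mono[OF s(2), of "real q"] by (simp add: powr_powr flip: powr_realpow)
        have "2 powr (real q / 2) * \<sigma> (Suc q) \<le> 2 powr (real (Suc q) / 2) * \<sigma> (Suc q)"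
          using \<sigma>0 by (intro mult_right_mono powr_mono) auto
        also have "\<dots> \<le> d * (real (Suc q) + 1) powr (- e)" by (rule \<sigma>)
        also have "\<dots> \<le> d * (real q + 1) powr (- e)"
          using e d by (intro mult_left_mono powr_mono2') auto
        finally have 2: "2 powr (real q / 2) * \<sigma> (Suc q) \<le> d * (real q + 1) powr (- e)" .
        have "(2 ^ q) powr s * (k * (\<sigma> q + \<sigma> (Suc q))) \<le> 2 powr (real q / 2) * (k * (\<sigma> q + \<sigma> (Suc q)))"
          using k \<sigma>0 by (intro mult_right_mono 1) auto
        also have "\<dots> = k * (2 powr (real q / 2) * \<sigma> q + 2 powr (real q / 2) * \<sigma> (Suc q))" by (simp add: algebra_simps)
        also have "\<dots> \<le> k * (d * (real q + 1) powr (- e) + d * (real q + 1) powr (- e))"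
          using k by (intro mult_left_mono add_mono \<sigma> 2) auto
        finally show "(2 ^ q) powr s * (k * (\<sigma> q + \<sigma> (Suc q))) \<le> 2 * k * d * (real q + 1) powr (- e)" by simp
      qed
      finally show "ennreal ((2 ^ q) powr s) * distr_Lp_norm p (lp_block chi q (field_distr ?h)) \<le> ennreal (2 * k * d * (real q + 1) powr (- e))" .
    qed
    then have "besov_norm chi s p r (field_distr ?h) \<le> ennreal ((k + 3 * M * D) * d) + ennreal (2 * k * d * L)"
      unfolding besov_norm_def using low by (intro add_mono)
    also have "\<dots> = ennreal ((k + 3 * M * D + 2 * k * L) * d)"
      using k M D d L by (subst ennreal_plus[symmetric]) (auto simp: algebra_simps)
    finally show "besov_norm chi s p r (field_distr ?h) \<le> ennreal ((k + 3 * M * D + 2 * k * L) * d)" .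
  qed
qed

end

text \<open>\<open>besov_lim\<close> subtracts functionals, and this agrees with the functional of
  the difference field wherever both integrals converge. Blocks evaluate their functional only at
  transforms of integrable functions, so agreement on bounded Borel functions is enough.\<close>

lemma besov_norm_cong:
  assumes T: "\<And>f C. f \<in> borel_measurable borel \<Longrightarrow> (\<And>x. norm (f x) \<le> C) \<Longrightarrow> T f = U f"
    and chi: "lp_cutoff chi"
  shows "besov_norm chi s p r T = besov_norm chi s p r U"
proof -
  have rep: "represents g (distr_inv_fourier (distr_mult m (distr_fourier T))) \<longleftrightarrow>
    represents g (distr_inv_fourier (distr_mult m (distr_fourier U)))"
    if m: "integrable lborel m" for g and m :: "real^3 \<Rightarrow> real"
  proof -
    have "distr_inv_fourier (distr_mult m (distr_fourier T)) f = distr_inv_fourier (distr_mult m (distr_fourier U)) f"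
      if f: "schwartz f" for f
    proof -
      have "integrable lborel (\<lambda>\<xi>. of_real (m \<xi>) * inv_fourier f \<xi>)"
        using integrable_bounded_mult[OF _ norm_inv_fourier_le integrable_of_real[OF m], of f "\<lambda>\<xi>. \<xi>"]
          measurable_inv_fourier[OF schwartz_integrable[OF f]] by (simp add: mult.commute)
      from T[OF measurable_fourier[OF this] norm_fourier_le] show ?thesis
        by (simp add: distr_inv_fourier_def distr_mult_def distr_fourier_def)
    qed
    then show ?thesis by (auto simp: represents_def)
  qed
  have m: "integrable lborel (\<lambda>\<xi>. lp_phi chi (inverse (2 ^ q) *\<^sub>R \<xi>))" for q :: nat
    using Bochner_Integration.integrable_diff[OF integrable_chi_scaled[OF chi, of "inverse (2 ^ Suc q)"] integrable_chi_scaled[OF chi, of "inverse (2 ^ q)"]]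
    by (simp add: lp_phi_def mult.commute)
  show ?thesis
    unfolding besov_norm_def distr_Lp_norm_def lp_block_def lp_block_low_def
    by (simp only: rep[OF m] rep[OF schwartz_integrable[OF schwartz_chi[OF chi]]])
qed

section \<open>Gaussians times trigonometric polynomials\<close>

text \<open>A class closed under differentiation and under multiplication by coordinates, hence such
  that its Gaussian multiples are closed under every \<open>partial\<close>. Waves in the first
  coordinate are all that the construction contains.\<close>

inductive trig_poly :: "(real^3 \<Rightarrow> 'a::real_normed_vector) \<Rightarrow> bool" where
  const: "trig_poly (\<lambda>_. c)"
| scale: "trig_poly g \<Longrightarrow> trig_poly (\<lambda>x. c *\<^sub>R g x)"
| coord: "trig_poly g \<Longrightarrow> trig_poly (\<lambda>x. x $ i *\<^sub>R g x)"
| cos: "trig_poly g \<Longrightarrow> trig_poly (\<lambda>x. cos (\<mu> * x $ 1) *\<^sub>R g x)"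
| sin: "trig_poly g \<Longrightarrow> trig_poly (\<lambda>x. sin (\<mu> * x $ 1) *\<^sub>R g x)"
| add: "trig_poly f \<Longrightarrow> trig_poly g \<Longrightarrow> trig_poly (\<lambda>x. f x + g x)"

lemma trig_poly_if: "trig_poly g \<Longrightarrow> trig_poly (\<lambda>x. if b then g x else 0)"
  by (cases b) (auto intro: trig_poly.const)

lemma sum_scaleR_delta: "(\<Sum>j\<in>UNIV. h j *\<^sub>R (if j = (i::3) then g else 0)) = h i *\<^sub>R (g::'a::real_vector)"
  by (simp add: if_distrib cong: if_cong)

lemma has_derivative_component: "((\<lambda>x::real^3. x $ i) has_derivative (\<lambda>h. h $ i)) (at x)"
  by (rule bounded_linear_imp_has_derivative[OF bounded_linear_vec_nth])

lemma trig_poly_derivative: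
  assumes "trig_poly g"
  shows "\<exists>g'. (\<forall>i. trig_poly (g' i)) \<and>
    (\<forall>x. (g has_derivative (\<lambda>h. \<Sum>i\<in>UNIV. h $ i *\<^sub>R g' i x)) (at x))"
  using assms
proof induction
  case (const c)
  show ?case by (rule exI[of _ "\<lambda>_ _. 0"]) (auto intro: trig_poly.const)
next
  case (scale g c)
  then obtain g' where g': "\<And>i. trig_poly (g' i)" "\<And>x. (g has_derivative (\<lambda>h. \<Sum>i\<in>UNIV. h $ i *\<^sub>R g' i x)) (at x)" by blast
  have "((\<lambda>x. c *\<^sub>R g x) has_derivative (\<lambda>h. \<Sum>i\<in>UNIV. h $ i *\<^sub>R (c *\<^sub>R g' i x))) (at x)" for x
    by (rule has_derivative_eq_rhs[OF has_derivative_scaleR_right[OF g'(2)]])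
      (simp add: scaleR_sum_right mult.commute)
  then show ?case using g'(1) trig_poly.scale by (intro exI[of _ "\<lambda>i x. c *\<^sub>R g' i x"]) blast
next
  case (coord g j)
  then obtain g' where g': "\<And>i. trig_poly (g' i)" "\<And>x. (g has_derivative (\<lambda>h. \<Sum>i\<in>UNIV. h $ i *\<^sub>R g' i x)) (at x)" by blast
  have "((\<lambda>x. x $ j *\<^sub>R g x) has_derivative (\<lambda>h. \<Sum>i\<in>UNIV. h $ i *\<^sub>R (x $ j *\<^sub>R g' i x + (if i = j then g x else 0)))) (at x)" for x
    by (rule has_derivative_eq_rhs[OF has_derivative_scaleR[OF has_derivative_component g'(2)]])
      (simp add: scaleR_add_right sum.distrib sum_scaleR_delta scaleR_sum_right mult.commute)
  then show ?case
    by (intro exI[of _ "\<lambda>i x. x $ j *\<^sub>R g' i x + (if i = j then g x else 0)"])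
      (auto intro!: trig_poly.add trig_poly.coord trig_poly_if g' coord)
next
  case (cos g \<mu>)
  then obtain g' where g': "\<And>i. trig_poly (g' i)" "\<And>x. (g has_derivative (\<lambda>h. \<Sum>i\<in>UNIV. h $ i *\<^sub>R g' i x)) (at x)" by blast
  have c: "((\<lambda>x::real^3. cos (\<mu> * x $ 1)) has_derivative (\<lambda>h. - \<mu> * sin (\<mu> * x $ 1) * h $ 1)) (at x)" for x
    by (auto intro!: derivative_eq_intros has_derivative_component)
  have "((\<lambda>x. cos (\<mu> * x $ 1) *\<^sub>R g x) has_derivative (\<lambda>h. \<Sum>i\<in>UNIV. h $ i *\<^sub>R
      (cos (\<mu> * x $ 1) *\<^sub>R g' i x + (if i = 1 then (- \<mu>) *\<^sub>R (sin (\<mu> * x $ 1) *\<^sub>R g x) else 0)))) (at x)" for x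
    by (rule has_derivative_eq_rhs[OF has_derivative_scaleR[OF c g'(2)]])
      (simp add: scaleR_add_right sum.distrib sum_scaleR_delta scaleR_sum_right mult_ac)
  then show ?case
    by (intro exI[of _ "\<lambda>i x. cos (\<mu> * x $ 1) *\<^sub>R g' i x + (if i = 1 then (- \<mu>) *\<^sub>R (sin (\<mu> * x $ 1) *\<^sub>R g x) else 0)"] conjI allI)
      (intro trig_poly.add trig_poly.cos trig_poly.sin trig_poly.scale trig_poly_if g' cos)
next
  case (sin g \<mu>)
  then obtain g' where g': "\<And>i. trig_poly (g' i)" "\<And>x. (g has_derivative (\<lambda>h. \<Sum>i\<in>UNIV. h $ i *\<^sub>R g' i x)) (at x)" by blast
  have c: "((\<lambda>x::real^3. sin (\<mu> * x $ 1)) has_derivative (\<lambda>h. \<mu> * cos (\<mu> * x $ 1) * h $ 1)) (at x)" for x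
    by (auto intro!: derivative_eq_intros has_derivative_component)
  have "((\<lambda>x. sin (\<mu> * x $ 1) *\<^sub>R g x) has_derivative (\<lambda>h. \<Sum>i\<in>UNIV. h $ i *\<^sub>R
      (sin (\<mu> * x $ 1) *\<^sub>R g' i x + (if i = 1 then \<mu> *\<^sub>R (cos (\<mu> * x $ 1) *\<^sub>R g x) else 0)))) (at x)" for x
    by (rule has_derivative_eq_rhs[OF has_derivative_scaleR[OF c g'(2)]])
      (simp add: scaleR_add_right sum.distrib sum_scaleR_delta scaleR_sum_right mult_ac)
  then show ?case
    by (intro exI[of _ "\<lambda>i x. sin (\<mu> * x $ 1) *\<^sub>R g' i x + (if i = 1 then \<mu> *\<^sub>R (cos (\<mu> * x $ 1) *\<^sub>R g x) else 0)"] conjI allI)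
      (intro trig_poly.add trig_poly.cos trig_poly.sin trig_poly.scale trig_poly_if g' sin)
next
  case (add f g)
  then obtain f' g' where g': "\<And>i. trig_poly (g' i)" "\<And>x. (g has_derivative (\<lambda>h. \<Sum>i\<in>UNIV. h $ i *\<^sub>R g' i x)) (at x)"
    and f': "\<And>i. trig_poly (f' i)" "\<And>x. (f has_derivative (\<lambda>h. \<Sum>i\<in>UNIV. h $ i *\<^sub>R f' i x)) (at x)" by blast
  have "((\<lambda>x. f x + g x) has_derivative (\<lambda>h. \<Sum>i\<in>UNIV. h $ i *\<^sub>R (f' i x + g' i x))) (at x)" for x
    by (rule has_derivative_eq_rhs[OF has_derivative_add[OF f'(2) g'(2)]]) (simp add: scaleR_add_right sum.distrib)
  then show ?case
    by (intro exI[of _ "\<lambda>i x. f' i x + g' i x"]) (auto intro: trig_poly.add f' g')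
qed

lemma trig_poly_growth:
  assumes "trig_poly g"
  shows "\<exists>C N. C \<ge> 0 \<and> (\<forall>x. norm (g x) \<le> C * (1 + norm x) ^ N)"
  using assms
proof induction
  case (const c)
  show ?case by (rule exI[of _ "norm c"], rule exI[of _ 0]) auto
next
  case (scale g c)
  then obtain C N where CN: "C \<ge> 0" "\<And>x. norm (g x) \<le> C * (1 + norm x) ^ N" by blast
  have "norm (c *\<^sub>R g x) \<le> (\<bar>c\<bar> * C) * (1 + norm x) ^ N" for x
    using mult_left_mono[OF CN(2), of "\<bar>c\<bar>"] by (simp add: mult_ac)
  then show ?case using CN(1) by (intro exI[of _ "\<bar>c\<bar> * C"] exI[of _ N]) auto
next
  case (coord g j)
  then obtain C N where CN: "C \<ge> 0" "\<And>x. norm (g x) \<le> C * (1 + norm x) ^ N" by blast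
  have "norm (x $ j *\<^sub>R g x) \<le> C * (1 + norm x) ^ Suc N" for x
  proof -
    have "norm (x $ j *\<^sub>R g x) \<le> (1 + norm x) * (C * (1 + norm x) ^ N)"
      unfolding norm_scaleR using component_le_norm_cart[of x j] by (intro mult_mono CN) auto
    then show ?thesis by (simp add: mult_ac)
  qed
  then show ?case using CN(1) by blast
next
  case (cos g \<mu>)
  then obtain C N where CN: "C \<ge> 0" "\<And>x. norm (g x) \<le> C * (1 + norm x) ^ N" by blast
  have "norm (cos (\<mu> * x $ 1) *\<^sub>R g x) \<le> 1 * (C * (1 + norm x) ^ N)" for x
    unfolding norm_scaleR by (intro mult_mono CN) auto
  then show ?case using CN(1) by auto
next
  case (sin g \<mu>)
  then obtain C N where CN: "C \<ge> 0" "\<And>x. norm (g x) \<le> C * (1 + norm x) ^ N" by blast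
  have "norm (sin (\<mu> * x $ 1) *\<^sub>R g x) \<le> 1 * (C * (1 + norm x) ^ N)" for x
    unfolding norm_scaleR by (intro mult_mono CN) auto
  then show ?case using CN(1) by auto
next
  case (add f g)
  then obtain C N D M where CN: "C \<ge> 0" "\<And>x. norm (g x) \<le> C * (1 + norm x) ^ N"
    and DM: "D \<ge> 0" "\<And>x. norm (f x) \<le> D * (1 + norm x) ^ M" by blast
  have "norm (f x + g x) \<le> (D + C) * (1 + norm x) ^ (M + N)" for x
  proof -
    have "norm (f x + g x) \<le> D * (1 + norm x) ^ M + C * (1 + norm x) ^ N"
      by (rule norm_triangle_mono[OF DM(2) CN(2)])
    also have "\<dots> \<le> D * (1 + norm x) ^ (M + N) + C * (1 + norm x) ^ (M + N)"
      by (intro add_mono mult_left_mono power_increasing CN DM) auto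
    finally show ?thesis by (simp add: distrib_right)
  qed
  then show ?case using CN(1) DM(1) by (intro exI[of _ "D + C"] exI[of _ "M + N"]) auto
qed

text \<open>A single term of the exponential series is at most its sum.\<close>

lemma power_le_fact_exp: "0 \<le> (u::real) \<Longrightarrow> u ^ N \<le> fact N * exp u"
proof -
  assume u: "0 \<le> u"
  have "(\<Sum>n\<in>{N}. u ^ n /\<^sub>R fact n) \<le> (\<Sum>n. u ^ n /\<^sub>R fact n)"
    using u by (intro sum_le_suminf summable_exp_generic) auto
  then have "u ^ N / fact N \<le> exp u" by (simp add: exp_def divide_inverse mult.commute)
  then show ?thesis by (simp add: divide_le_eq mult.commute)
qed

lemma gaussian_rapid_decay:
  assumes c: "c > 0"
  shows "\<exists>C. \<forall>x::real^3. (1 + norm x) ^ N * exp (- (c * (x \<bullet> x))) \<le> C"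
proof (intro exI allI)
  fix x :: "real^3"
  let ?t = "norm x"
  have "(1 + ?t) ^ N \<le> (2 * max 1 ?t) ^ N" by (intro power_mono) auto
  also have "\<dots> = 2 ^ N * (max 1 ?t) ^ N" by (simp add: power_mult_distrib)
  also have "(max 1 ?t) ^ N \<le> 1 + (?t ^ 2) ^ N"
  proof (cases "?t \<le> 1")
    case False
    then have "?t ^ N \<le> (?t ^ 2) ^ N" using mult_left_mono[of 1 ?t ?t] by (intro power_mono) (auto simp: power2_eq_square)
    then show ?thesis using False by simp
  qed auto
  also have "(?t ^ 2) ^ N = (c * (x \<bullet> x)) ^ N / c ^ N" using c by (simp add: power_mult_distrib dot_square_norm)
  also have "\<dots> \<le> fact N * exp (c * (x \<bullet> x)) / c ^ N"
    using c by (intro divide_right_mono power_le_fact_exp) auto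
  finally have "(1 + ?t) ^ N * exp (- (c * (x \<bullet> x))) \<le> (2 ^ N * (1 + fact N * exp (c * (x \<bullet> x)) / c ^ N)) * exp (- (c * (x \<bullet> x)))"
    by (intro mult_right_mono) auto
  also have "\<dots> = 2 ^ N * (exp (- (c * (x \<bullet> x))) + fact N / c ^ N * (exp (c * (x \<bullet> x)) * exp (- (c * (x \<bullet> x)))))"
    by (simp add: algebra_simps)
  also have "exp (c * (x \<bullet> x)) * exp (- (c * (x \<bullet> x))) = 1" by (simp add: exp_add[symmetric])
  also have "2 ^ N * (exp (- (c * (x \<bullet> x))) + fact N / c ^ N * 1) \<le> 2 ^ N * (1 + fact N / c ^ N)"
    using c by (intro mult_left_mono add_mono) auto
  finally show "(1 + ?t) ^ N * exp (- (c * (x \<bullet> x))) \<le> 2 ^ N * (1 + fact N / c ^ N)" .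
qed

lemma has_derivative_gaussian_mult:
  fixes g :: "real^3 \<Rightarrow> 'a::real_normed_vector"
  assumes g: "(g has_derivative g') (at x)"
  shows "((\<lambda>x. exp (- (c * (x \<bullet> x))) *\<^sub>R g x) has_derivative
    (\<lambda>h. exp (- (c * (x \<bullet> x))) *\<^sub>R (g' h - (2 * c * (x \<bullet> h)) *\<^sub>R g x))) (at x)"
proof -
  have e: "((\<lambda>x::real^3. exp (- (c * (x \<bullet> x)))) has_derivative (\<lambda>h. - (2 * c * (x \<bullet> h)) * exp (- (c * (x \<bullet> x))))) (at x)"
    by (auto intro!: derivative_eq_intros simp: inner_commute)
  show ?thesis
    by (rule has_derivative_eq_rhs[OF has_derivative_scaleR[OF e g]])
      (simp add: scaleR_diff_right fun_eq_iff mult_ac)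
qed

lemma partial_gaussian_mult:
  fixes g :: "real^3 \<Rightarrow> 'a::real_normed_vector"
  assumes "(g has_derivative g') (at x)"
  shows "partial i (\<lambda>x. exp (- (c * (x \<bullet> x))) *\<^sub>R g x) x =
    exp (- (c * (x \<bullet> x))) *\<^sub>R (g' (axis i 1) - (2 * c * x $ i) *\<^sub>R g x)"
  by (subst partial_eq[OF has_derivative_gaussian_mult[OF assms]]) (simp add: inner_axis)

text \<open>Every iterated derivative is again the same Gaussian times a trigonometric polynomial,
  as stated in \<open>P\<close>. Polynomial growth of the second factor then loses against the
  Gaussian.\<close>

lemma schwartz_gaussian_trig_poly:
  fixes g :: "real^3 \<Rightarrow> 'a::real_normed_vector"
  assumes c: "c > 0" and g: "trig_poly g"
  shows "schwartz (\<lambda>x. exp (- (c * (x \<bullet> x))) *\<^sub>R g x)"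
proof -
  let ?G = "\<lambda>g x. exp (- (c * (x \<bullet> x))) *\<^sub>R g x"
  have P: "\<exists>k. trig_poly k \<and> partials js (?G g) = ?G k" for js
  proof (induction js)
    case (Cons j js)
    then obtain k where k: "trig_poly k" "partials js (?G g) = ?G k" by blast
    obtain k' where k': "\<And>i. trig_poly (k' i)" "\<And>x. (k has_derivative (\<lambda>h. \<Sum>i\<in>UNIV. h $ i *\<^sub>R k' i x)) (at x)"
      using trig_poly_derivative[OF k(1)] by blast
    have "partials (j # js) (?G g) = ?G (\<lambda>x. k' j x + (- (2 * c)) *\<^sub>R (x $ j *\<^sub>R k x))"
    proof
      fix x
      have "(\<Sum>i\<in>UNIV. axis j 1 $ i *\<^sub>R k' i x) = k' j x"
        by (simp add: axis_def if_distrib[of "\<lambda>b. b *\<^sub>R _"] cong: if_cong)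
      then show "partials (j # js) (?G g) x = ?G (\<lambda>x. k' j x + (- (2 * c)) *\<^sub>R (x $ j *\<^sub>R k x)) x"
        by (simp add: partials_Cons k(2) partial_gaussian_mult[OF k'(2)])
    qed
    then show ?case using trig_poly.add[OF k'(1) trig_poly.scale[OF trig_poly.coord[OF k(1)]]] by blast
  qed (use g in auto)
  show ?thesis
  proof (rule schwartzI)
    show "smooth (?G g)"
      unfolding smooth_def differentiable_on_def
    proof (intro allI ballI)
      fix js and x :: "real^3"
      obtain k where k: "trig_poly k" "partials js (?G g) = ?G k" using P by blast
      obtain k' where "\<And>i. trig_poly (k' i)" and k': "\<And>x. (k has_derivative (\<lambda>h. \<Sum>i\<in>UNIV. h $ i *\<^sub>R k' i x)) (at x)"
        using trig_poly_derivative[OF k(1)] by blast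
      from has_derivative_gaussian_mult[OF k', of c] show "partials js (?G g) differentiable (at x)"
        unfolding k(2) by (rule differentiableI)
    qed
    fix js N
    obtain k where k: "trig_poly k" "partials js (?G g) = ?G k" using P by blast
    obtain D M where DM: "D \<ge> 0" "\<And>x. norm (k x) \<le> D * (1 + norm x) ^ M" using trig_poly_growth[OF k(1)] by blast
    obtain C where C: "\<And>x::real^3. (1 + norm x) ^ (N + M) * exp (- (c * (x \<bullet> x))) \<le> C"
      using gaussian_rapid_decay[OF c] by blast
    have "(1 + norm x) ^ N * norm (?G k x) \<le> D * C" for x
    proof -
      have "(1 + norm x) ^ N * norm (?G k x) \<le> (1 + norm x) ^ N * (exp (- (c * (x \<bullet> x))) * (D * (1 + norm x) ^ M))"
        by (intro mult_left_mono) (auto intro!: mult_left_mono DM)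
      also have "\<dots> = D * ((1 + norm x) ^ (N + M) * exp (- (c * (x \<bullet> x))))" by (simp add: power_add)
      also have "\<dots> \<le> D * C" by (intro mult_left_mono C DM)
      finally show ?thesis .
    qed
    then show "\<exists>C. \<forall>x. (1 + norm x) ^ N * norm (partials js (?G g) x) \<le> C" unfolding k(2) by blast
  qed
qed

text \<open>The mean value inequality along the segment from \<open>x\<close> to
  \<open>x - y\<close>: the derivative decays like the weight, and shifting the weight along the
  segment costs at most (1 + |y|)^6.\<close>

lemma schwartz_profile:
  fixes \<psi> :: "real^3 \<Rightarrow> real^3"
  assumes \<psi>: "schwartz \<psi>"
  obtains M where "profile M \<psi>"
proof -
  obtain C0 where C0: "C0 \<ge> 0" "\<And>x. norm (\<psi> x) \<le> C0 * decay x" using schwartz_decay[OF \<psi>] by metis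
  have "\<forall>i. \<exists>C\<ge>0. \<forall>x. norm (partial i \<psi> x) \<le> C * decay x" using schwartz_decay[OF schwartz_partial[OF \<psi>]] by metis
  then obtain C where C: "\<And>i. C i \<ge> 0" "\<And>i x. norm (partial i \<psi> x) \<le> C i * decay x" by metis
  define B where "B = (\<Sum>i\<in>UNIV. C i)"
  have B: "B \<ge> 0" unfolding B_def by (intro sum_nonneg C)
  let ?D = "\<lambda>x. frechet_derivative \<psi> (at x)"
  have der: "(\<psi> has_derivative ?D x) (at x)" for x
    using smooth_differentiable[OF schwartz_smooth[OF \<psi>]] frechet_derivative_works by blast
  have D: "norm (?D x h) \<le> B * decay x * norm h" for x h
  proof -
    interpret bounded_linear "?D x" using der by (rule has_derivative_bounded_linear)
    have "h = (\<Sum>i\<in>UNIV. h $ i *\<^sub>R axis i 1)"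
      using basis_expansion[of h] by (simp add: scalar_mult_eq_scaleR)
    then have "?D x h = ?D x (\<Sum>i\<in>UNIV. h $ i *\<^sub>R axis i 1)" by simp
    also have "\<dots> = (\<Sum>i\<in>UNIV. h $ i *\<^sub>R partial i \<psi> x)" by (simp add: sum scaleR partial_def)
    finally have "norm (?D x h) \<le> (\<Sum>i\<in>UNIV. norm (h $ i *\<^sub>R partial i \<psi> x))" by (simp only: norm_sum)
    also have "\<dots> \<le> (\<Sum>i\<in>UNIV. norm h * (C i * decay x))"
      by (intro sum_mono) (auto intro!: mult_mono C component_le_norm_cart)
    also have "\<dots> = B * decay x * norm h" by (simp add: B_def sum_distrib_left sum_distrib_right mult_ac)
    finally show ?thesis .
  qed
  have L: "norm (\<psi> (x - y) - \<psi> x) \<le> B * norm y * (1 + norm y) ^ 6 * decay x" for x y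
  proof -
    have "norm (\<psi> (x - 1 *\<^sub>R y) - \<psi> (x - 0 *\<^sub>R y)) \<le> (B * norm y * (1 + norm y) ^ 6 * decay x) * norm (1 - 0 :: real)"
    proof (rule differentiable_bound[where S="{0..1}" and f="\<lambda>t. \<psi> (x - t *\<^sub>R y)" and f'="\<lambda>t h. ?D (x - t *\<^sub>R y) (- (h *\<^sub>R y))"])
      fix t :: real assume t: "t \<in> {0..1}"
      have "((\<lambda>t. x - t *\<^sub>R y) has_derivative (\<lambda>h. - (h *\<^sub>R y))) (at t within {0..1})"
        by (auto intro!: derivative_eq_intros)
      from has_derivative_compose[OF this der]
      show "((\<lambda>t. \<psi> (x - t *\<^sub>R y)) has_derivative (\<lambda>h. ?D (x - t *\<^sub>R y) (- (h *\<^sub>R y)))) (at t within {0..1})" .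
      show "onorm (\<lambda>h. ?D (x - t *\<^sub>R y) (- (h *\<^sub>R y))) \<le> B * norm y * (1 + norm y) ^ 6 * decay x"
      proof (rule onorm_le)
        fix h :: real
        have "decay (x - t *\<^sub>R y) \<le> (1 + norm (t *\<^sub>R y)) ^ 6 * decay x" by (rule decay_shift)
        also have "\<dots> \<le> (1 + norm y) ^ 6 * decay x"
          using t by (intro mult_right_mono power_mono) (auto intro!: mult_left_le_one_le)
        finally have "B * decay (x - t *\<^sub>R y) * norm (- (h *\<^sub>R y)) \<le> B * ((1 + norm y) ^ 6 * decay x) * norm (- (h *\<^sub>R y))"
          using B by (intro mult_right_mono mult_left_mono) auto
        then show "norm (?D (x - t *\<^sub>R y) (- (h *\<^sub>R y))) \<le> B * norm y * (1 + norm y) ^ 6 * decay x * norm h"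
          using D[of "x - t *\<^sub>R y" "- (h *\<^sub>R y)"] by (simp add: mult_ac)
      qed
    qed auto
    then show ?thesis by simp
  qed
  show ?thesis
  proof (rule that[of "C0 + B"])
    have "norm (\<psi> x) \<le> (C0 + B) * decay x" for x
      using C0(2)[of x] B by (simp add: distrib_right add_increasing2)
    moreover have "norm (\<psi> (x - y) - \<psi> x) \<le> (C0 + B) * norm y * (1 + norm y) ^ 6 * decay x" for x y
    proof -
      have "0 \<le> C0 * norm y * (1 + norm y) ^ 6 * decay x" using C0(1) by simp
      then show ?thesis using L[of x y] by (simp add: distrib_right)
    qed
    ultimately show "profile (C0 + B) \<psi>"
      unfolding profile_def using C0(1) B schwartz_measurable[OF \<psi>] by auto
  qed
qed

section \<open>Lacunary series in Besov spaces\<close>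

definition coef :: "nat \<Rightarrow> real"
  where "coef k = 2 powr (- real k / 2) * (real k + 1) powr (- 1/2)"

text \<open>Zeros instead of a shifted index keep each coefficient attached to its frequency 2^k, so
  a tail is a lacunary series of the same kind.\<close>

definition coef_tail :: "nat \<Rightarrow> nat \<Rightarrow> real"
  where "coef_tail n k = (if n \<le> k then coef k else 0)"

text \<open>At the scale 2^-q a wave of frequency 2^k oscillates by at most a multiple of min(1,
  2^(k-q)): its size counts for k \<ge> q, its Lipschitz constant for k < q.\<close>

definition oscillation_sum :: "(nat \<Rightarrow> real) \<Rightarrow> nat \<Rightarrow> real"
  where "oscillation_sum a q = (\<Sum>k. a k * min 1 (2 ^ k / 2 ^ q))"

definition unit_wave :: "(real \<Rightarrow> real) \<Rightarrow> bool"
  where "unit_wave c \<longleftrightarrow> c \<in> borel_measurable borel \<and> (\<forall>t. \<bar>c t\<bar> \<le> 1) \<and> (\<forall>t t'. \<bar>c t - c t'\<bar> \<le> \<bar>t - t'\<bar>)"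

lemma coef_pos: "coef k > 0"
  by (simp add: coef_def)

lemma summable_coef: "summable coef"
proof (rule summable_comparison_test'[where N=0])
  have "2 powr (- 1/2) < (2::real) powr 0" by (intro powr_less_mono) auto
  then show "summable (\<lambda>k. (2 powr (- 1/2) :: real) ^ k)" by (intro summable_geometric) simp
  fix k
  have "(real k + 1) powr (- 1/2) \<le> 1" using powr_mono2'[of "- 1/2" 1 "real k + 1"] by simp
  then have "coef k \<le> 2 powr (- real k / 2) * 1" unfolding coef_def by (intro mult_left_mono) auto
  also have "\<dots> = (2 powr (- 1/2)) ^ k" by (simp add: powr_powr flip: powr_realpow)
  finally show "norm (coef k) \<le> (2 powr (- 1/2)) ^ k" using coef_pos[of k] by simp
qed

lemma coef_tail_nonneg: "coef_tail n k \<ge> 0"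
  using coef_pos[of k] by (simp add: coef_tail_def)

lemma coef_tail_0: "coef_tail 0 = coef"
  by (simp add: coef_tail_def fun_eq_iff)

lemma summable_coef_tail: "summable (coef_tail n)"
  by (rule summable_comparison_test'[OF summable_coef, of 0]) (use coef_pos in \<open>auto simp: coef_tail_def less_imp_le\<close>)

lemma summable_oscillation:
  assumes "\<And>k. a k \<ge> 0" "summable a"
  shows "summable (\<lambda>k. a k * min 1 (2 ^ k / 2 ^ q :: real))"
  by (rule summable_comparison_test'[OF assms(2), of 0]) (use assms(1) in \<open>auto simp: abs_mult intro!: mult_left_le\<close>)

lemma summable_wave:
  assumes a: "\<And>k. a k \<ge> 0" "summable a" and c: "unit_wave c"
  shows "summable (\<lambda>k. a k * c (2 ^ k * t))" "summable (\<lambda>k. \<bar>a k * c (2 ^ k * t)\<bar>)"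
proof -
  have "\<bar>a k * c (2 ^ k * t)\<bar> \<le> a k" for k
    using a(1)[of k] c by (auto simp: abs_mult unit_wave_def intro!: mult_left_le)
  then show "summable (\<lambda>k. a k * c (2 ^ k * t))" "summable (\<lambda>k. \<bar>a k * c (2 ^ k * t)\<bar>)"
    by (auto intro!: summable_comparison_test'[OF a(2), of 0])
qed

lemma modulation_series:
  assumes a: "\<And>k. a k \<ge> 0" "summable a" and c: "unit_wave c"
  shows "modulation (suminf a) (\<lambda>q. 2 * oscillation_sum a q) (\<lambda>t. \<Sum>k. a k * c (2 ^ k * t))"
proof -
  note sm = summable_wave[OF a c] and so = summable_oscillation[OF a]
  have [measurable]: "c \<in> borel_measurable borel" and c1: "\<bar>c t\<bar> \<le> 1" and c2: "\<bar>c t - c t'\<bar> \<le> \<bar>t - t'\<bar>" for t t'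
    using c by (auto simp: unit_wave_def)
  have 1: "\<bar>\<Sum>k. a k * c (2 ^ k * t)\<bar> \<le> suminf a" for t
    using a c1 by (intro order_trans[OF summable_rabs[OF sm(2)]] suminf_le sm(2)) (auto simp: abs_mult intro!: mult_left_le)
  have 2: "suminf a / 2 ^ q \<le> 2 * oscillation_sum a q" for q
  proof -
    have "suminf a / 2 ^ q = (\<Sum>k. a k / 2 ^ q)" by (rule suminf_divide[OF a(2), symmetric])
    also have "\<dots> \<le> oscillation_sum a q"
      unfolding oscillation_sum_def
    proof (intro suminf_le so summable_divide a(2))
      fix k
      \<comment> \<open>All frequencies 2^k are at least 1, so no mode oscillates less than the
        envelope does.\<close>
      have "1 / 2 ^ q \<le> min 1 (2 ^ k / 2 ^ q :: real)" by (auto intro!: divide_right_mono)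
      from mult_left_mono[OF this a(1)] show "a k / 2 ^ q \<le> a k * min 1 (2 ^ k / 2 ^ q)" by simp
    qed
    finally have "suminf a / 2 ^ q \<le> oscillation_sum a q" .
    moreover have "0 \<le> oscillation_sum a q" unfolding oscillation_sum_def by (intro suminf_nonneg so) (use a in auto)
    ultimately show ?thesis by simp
  qed
  have 3: "\<bar>(\<Sum>k. a k * c (2 ^ k * t)) - (\<Sum>k. a k * c (2 ^ k * t'))\<bar> \<le> (1 + 2 ^ q * \<bar>t - t'\<bar>) * (2 * oscillation_sum a q)" for q t t'
  proof -
    let ?D = "2 ^ q * \<bar>t - t'\<bar>"
    have b: "\<bar>a k * c (2 ^ k * t) - a k * c (2 ^ k * t')\<bar> \<le> ((1 + ?D) * 2) * (a k * min 1 (2 ^ k / 2 ^ q))" for k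
    proof -
      have "\<bar>c (2 ^ k * t) - c (2 ^ k * t')\<bar> \<le> ((1 + ?D) * 2) * min 1 (2 ^ k / 2 ^ q)"
      \<comment> \<open>Fast modes are bounded by their size, slow modes by their Lipschitz
        constant.\<close>
      proof (cases "1 \<le> (2 ^ k / 2 ^ q :: real)")
        case True
        have "\<bar>c (2 ^ k * t) - c (2 ^ k * t')\<bar> \<le> 2" using c1[of "2 ^ k * t"] c1[of "2 ^ k * t'"] by linarith
        also have "\<dots> \<le> (1 + ?D) * 2" by simp
        finally show ?thesis using True by (simp add: min_absorb1)
      next
        case False
        have "\<bar>c (2 ^ k * t) - c (2 ^ k * t')\<bar> \<le> \<bar>2 ^ k * t - 2 ^ k * t'\<bar>" by (rule c2)
        also have "\<dots> = 2 ^ k * \<bar>t - t'\<bar>" by (simp add: abs_mult flip: right_diff_distrib)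
        also have "\<dots> = ?D * (2 ^ k / 2 ^ q)" by simp
        also have "\<dots> \<le> ((1 + ?D) * 2) * (2 ^ k / 2 ^ q)" by (intro mult_right_mono) auto
        finally show ?thesis using False by (simp add: min_absorb2)
      qed
      from mult_left_mono[OF this a(1)[of k]] show ?thesis
        using a(1)[of k] by (simp add: abs_mult mult_ac flip: right_diff_distrib)
    qed
    have s: "summable (\<lambda>k. ((1 + ?D) * 2) * (a k * min 1 (2 ^ k / 2 ^ q)))" by (intro summable_mult so)
    have sa: "summable (\<lambda>k. \<bar>a k * c (2 ^ k * t) - a k * c (2 ^ k * t')\<bar>)"
      by (rule summable_comparison_test'[OF s, of 0]) (use b in auto)
    have "\<bar>(\<Sum>k. a k * c (2 ^ k * t)) - (\<Sum>k. a k * c (2 ^ k * t'))\<bar> = \<bar>\<Sum>k. a k * c (2 ^ k * t) - a k * c (2 ^ k * t')\<bar>"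
      by (subst suminf_diff[OF sm(1) sm(1)]) simp
    also have "\<dots> \<le> (\<Sum>k. \<bar>a k * c (2 ^ k * t) - a k * c (2 ^ k * t')\<bar>)" by (rule summable_rabs[OF sa])
    also have "\<dots> \<le> (\<Sum>k. ((1 + ?D) * 2) * (a k * min 1 (2 ^ k / 2 ^ q)))" by (intro suminf_le sa s b)
    also have "\<dots> = (1 + ?D) * (2 * oscillation_sum a q)"
      unfolding oscillation_sum_def by (subst suminf_mult[OF so]) simp
    finally show ?thesis .
  qed
  have "(\<lambda>t. \<Sum>k. a k * c (2 ^ k * t)) \<in> borel_measurable borel" by measurable
  then show ?thesis
    unfolding modulation_def using 1 2 3 suminf_nonneg[OF a(2) a(1)] by auto
qed

text \<open>Trading the factor \<open>(k + 1) powr (e - 1/2) \<le> (n + 1) powr (e - 1/2)\<close> of the tail for smallness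
  leaves the profile \<open>(k + 1) powr (- e)\<close>, which is still in \<open>\<ell>\<^sup>r\<close>.\<close>

lemma oscillation_coef_tail:
  assumes e: "0 < e" "e < 1/2"
  obtains E where "E \<ge> 0"
    "\<And>n q. 2 powr (real q / 2) * oscillation_sum (coef_tail n) q \<le>
      E * (real n + 1) powr (e - 1/2) * (real q + 1) powr (- e)"
proof -
  \<comment> \<open>A summable kernel in the distance j = |k - q| of the two scales: the exponential
    is the gain off the diagonal, the linear factor the cost of replacing (k+1)^(-e) by
    (q+1)^(-e).\<close>
  define b where "b j = (1 + real j) * 2 powr (- real j / 2)" for j
  have b0: "b j \<ge> 0" for j by (simp add: b_def)
  have bs: "summable b"
  proof -
    have "2 powr (- 1/2) < (2::real) powr 0" by (intro powr_less_mono) auto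
    then have "summable (\<lambda>n. of_nat (Suc n) * (2 powr (- 1/2) :: real) ^ n)"
      by (intro sums_summable[OF geometric_deriv_sums]) simp
    moreover have "of_nat (Suc n) * (2 powr (- 1/2) :: real) ^ n = b n" for n
      by (simp add: b_def powr_powr flip: powr_realpow)
    ultimately show ?thesis by simp
  qed
  define dist where "dist q k = (if q \<le> k then k - q else q - k)" for q k :: nat
  have ds: "summable (\<lambda>k. b (dist q k))" and db: "(\<Sum>k. b (dist q k)) \<le> 2 * suminf b" for q
  proof -
    have shift: "(\<lambda>k. b (dist q (k + q))) = b" by (simp add: dist_def)
    show ds: "summable (\<lambda>k. b (dist q k))"
      using bs summable_iff_shift[of "\<lambda>k. b (dist q k)" q] shift by simp
    have "(\<Sum>k<q. b (dist q k)) = (\<Sum>k<q. b (q - k))" by (intro sum.cong) (auto simp: dist_def)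
    also have "\<dots> = sum b ((\<lambda>k. q - k) ` {..<q})" by (subst sum.reindex) (auto simp: inj_on_def)
    also have "\<dots> \<le> suminf b" by (intro sum_le_suminf bs b0) auto
    finally show "(\<Sum>k. b (dist q k)) \<le> 2 * suminf b"
      using suminf_split_initial_segment[OF ds, of q] by (simp add: shift)
  qed
  have term_le: "2 powr (real q / 2) * (coef_tail n k * min 1 (2 ^ k / 2 ^ q)) \<le>
      ((real n + 1) powr (e - 1/2) * (real q + 1) powr (- e)) * b (dist q k)" for n q k
  proof (cases "n \<le> k")
    case True
    let ?j = "real (dist q k)"
    have 1: "(real k + 1) powr (- 1/2) \<le> (real n + 1) powr (e - 1/2) * (real k + 1) powr (- e)"
    proof -
      have "(real k + 1) powr (- 1/2) = (real k + 1) powr (e - 1/2) * (real k + 1) powr (- e)"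
        by (simp flip: powr_add)
      also have "\<dots> \<le> (real n + 1) powr (e - 1/2) * (real k + 1) powr (- e)"
        using e True by (intro mult_right_mono powr_mono2') auto
      finally show ?thesis .
    qed
    \<comment> \<open>Peetre's inequality on the integers, q + 1 \<le> (k + 1) (1 + |k - q|), where
      e < 1 bounds the power of the last factor by the factor itself.\<close>
    have 2: "(real k + 1) powr (- e) \<le> (real q + 1) powr (- e) * (1 + ?j)"
    proof -
      have "real q + 1 \<le> (real k + 1) * (1 + ?j)"
      proof -
        have "real q \<le> real k + ?j" by (simp add: dist_def)
        moreover have "0 \<le> real k * ?j" by simp
        moreover have "(real k + 1) * (1 + ?j) = real k + ?j + 1 + real k * ?j" by (simp add: algebra_simps)
        ultimately show ?thesis by linarith
      qed
      then have "(real q + 1) powr e \<le> ((real k + 1) * (1 + ?j)) powr e" using e by (intro powr_mono2) auto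
      also have "\<dots> = (real k + 1) powr e * (1 + ?j) powr e" by (simp add: powr_mult)
      also have "\<dots> \<le> (real k + 1) powr e * (1 + ?j) powr 1"
        using e by (intro mult_left_mono powr_mono) auto
      finally have "(real q + 1) powr e \<le> (real k + 1) powr e * (1 + ?j)" by simp
      then show ?thesis by (simp add: powr_minus field_simps)
    qed
    \<comment> \<open>For k \<ge> q the coefficient outweighs the Besov weight by 2^(-(k-q)/2). For
      k < q the weight wins by 2^((q-k)/2), and the oscillation factor 2^(k-q) turns this into the
      same decay.\<close>
    have 3: "2 powr (real q / 2) * 2 powr (- real k / 2) * min 1 (2 ^ k / 2 ^ q) \<le> 2 powr (- ?j / 2)"
    proof (cases "q \<le> k")
      case True
      have "2 powr (real q / 2) * 2 powr (- real k / 2) * min 1 (2 ^ k / 2 ^ q) \<le> 2 powr (real q / 2) * 2 powr (- real k / 2) * 1"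
        by (intro mult_left_mono) auto
      also have "\<dots> = 2 powr (- ?j / 2)"
        using True by (simp add: dist_def of_nat_diff diff_divide_distrib flip: powr_add)
      finally show ?thesis .
    next
      case False
      have "2 powr (real q / 2) * 2 powr (- real k / 2) * min 1 (2 ^ k / 2 ^ q) \<le> 2 powr (real q / 2) * 2 powr (- real k / 2) * (2 powr real k / 2 powr real q)"
        by (intro mult_left_mono) (auto simp: powr_realpow)
      also have "\<dots> = 2 powr (real q / 2 - real k / 2 + real k - real q)"
        unfolding powr_diff[symmetric] powr_add[symmetric] by (rule arg_cong[where f="(powr) 2"]) simp
      also have "real q / 2 - real k / 2 + real k - real q = - ?j / 2"
        using False by (simp add: dist_def of_nat_diff field_simps)
      finally show ?thesis .
    qed
    have "2 powr (real q / 2) * (coef_tail n k * min 1 (2 ^ k / 2 ^ q)) =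
      (2 powr (real q / 2) * 2 powr (- real k / 2) * min 1 (2 ^ k / 2 ^ q)) * (real k + 1) powr (- 1/2)"
      using True by (simp add: coef_tail_def coef_def)
    also have "\<dots> \<le> 2 powr (- ?j / 2) * ((real n + 1) powr (e - 1/2) * ((real q + 1) powr (- e) * (1 + ?j)))"
      by (intro mult_mono 3 order_trans[OF 1] mult_left_mono 2) auto
    also have "\<dots> = ((real n + 1) powr (e - 1/2) * (real q + 1) powr (- e)) * b (dist q k)"
      by (simp add: b_def mult_ac)
    finally show ?thesis .
  qed (simp add: coef_tail_def b0)
  show ?thesis
  proof (rule that[of "2 * suminf b"])
    show "0 \<le> 2 * suminf b" using suminf_nonneg[OF bs b0] by simp
    fix n q
    note so = summable_oscillation[of "coef_tail n" q, OF coef_tail_nonneg summable_coef_tail]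
    have "2 powr (real q / 2) * oscillation_sum (coef_tail n) q = (\<Sum>k. 2 powr (real q / 2) * (coef_tail n k * min 1 (2 ^ k / 2 ^ q)))"
      unfolding oscillation_sum_def by (subst suminf_mult[OF so]) simp
    also have "\<dots> \<le> (\<Sum>k. ((real n + 1) powr (e - 1/2) * (real q + 1) powr (- e)) * b (dist q k))"
      by (intro suminf_le term_le summable_mult so ds)
    also have "\<dots> = ((real n + 1) powr (e - 1/2) * (real q + 1) powr (- e)) * (\<Sum>k. b (dist q k))"
      by (rule suminf_mult[OF ds])
    also have "\<dots> \<le> ((real n + 1) powr (e - 1/2) * (real q + 1) powr (- e)) * (2 * suminf b)"
      by (intro mult_left_mono db) auto
    finally show "2 powr (real q / 2) * oscillation_sum (coef_tail n) q \<le>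
      2 * suminf b * (real n + 1) powr (e - 1/2) * (real q + 1) powr (- e)" by (simp add: mult_ac)
  qed
qed

definition wave_series :: "(real \<Rightarrow> real) \<Rightarrow> (real^3 \<Rightarrow> real^3) \<Rightarrow> real^3 \<Rightarrow> real^3"
  where "wave_series c \<psi> x = (\<Sum>k. coef k * c (2 ^ k * x $ 1)) *\<^sub>R \<psi> x"

definition wave_sum :: "(real \<Rightarrow> real) \<Rightarrow> (real^3 \<Rightarrow> real^3) \<Rightarrow> nat \<Rightarrow> real^3 \<Rightarrow> real^3"
  where "wave_sum c \<psi> n x = (\<Sum>k<n. coef k * c (2 ^ k * x $ 1)) *\<^sub>R \<psi> x"

text \<open>The sign is carried by the wave and not by the coefficients, because
  \<open>modulation_series\<close> takes nonnegative coefficients and \<open>- c\<close> is again a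
  unit wave.\<close>

lemma wave_sum_minus_series:
  assumes c: "unit_wave c"
  shows "wave_sum c \<psi> n x - wave_series c \<psi> x = (\<Sum>k. coef_tail n k * (- c (2 ^ k * x $ 1))) *\<^sub>R \<psi> x"
proof -
  let ?f = "\<lambda>k. coef k * c (2 ^ k * x $ 1)" and ?g = "\<lambda>k. coef_tail n k * c (2 ^ k * x $ 1)"
  have sf: "summable ?f" using coef_pos by (intro summable_wave summable_coef c) (auto simp: less_imp_le)
  have sg: "summable ?g" by (intro summable_wave summable_coef_tail coef_tail_nonneg c)
  have "suminf ?f = (\<Sum>k. ?f (k + n)) + (\<Sum>k<n. ?f k)" by (rule suminf_split_initial_segment[OF sf])
  moreover have "suminf ?g = (\<Sum>k. ?g (k + n)) + (\<Sum>k<n. ?g k)" by (rule suminf_split_initial_segment[OF sg])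
  moreover have "(\<Sum>k<n. ?g k) = 0" by (simp add: coef_tail_def)
  moreover have "(\<Sum>k. ?g (k + n)) = (\<Sum>k. ?f (k + n))" by (simp add: coef_tail_def)
  moreover have "(\<Sum>k. coef_tail n k * (- c (2 ^ k * x $ 1))) = - suminf ?g"
    using suminf_minus[OF sg] by simp
  ultimately have "(\<Sum>k<n. ?f k) - suminf ?f = (\<Sum>k. coef_tail n k * (- c (2 ^ k * x $ 1)))" by simp
  then show ?thesis by (simp add: wave_sum_def wave_series_def flip: scaleR_diff_left)
qed

text \<open>One estimate of tails serves both claims: the tail from 0 is the series itself, which
  gives membership, and the tail from \<open>n\<close> is the error of the partial sum up to sign,
  which gives convergence.\<close>

lemma wave_series_besov:
  fixes s p :: real and r :: ennreal
  assumes chi: "lp_cutoff chi" and s: "0 \<le> s" "s \<le> 1/2" and p: "1 < p" and r: "2 < r"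
    and \<psi>: "schwartz \<psi>" and c: "unit_wave c"
  shows "field_distr (wave_series c \<psi>) \<in> besov_space chi s p r" (is ?S)
    and "besov_lim chi s p r (wave_sum c \<psi>) (field_distr (wave_series c \<psi>))" (is ?L)
proof -
  \<comment> \<open>The midpoint of 1/r and 1/2. Above 1/r the profile (q+1)^(-e) is in l^r; below
    1/2 a negative power of \<open>n\<close> is left over. For infinite \<open>r\<close> the default
    values give e = 1/4.\<close>
  define e where "e = 1/4 + 1 / (2 * enn2real r)"
  have R: "enn2real r > 2" if "r \<noteq> \<infinity>" using r that by (cases r) auto
  have e: "0 < e" "e < 1/2" and er: "r \<noteq> \<infinity> \<Longrightarrow> enn2real r > 0 \<and> e * enn2real r > 1"
  proof -
    show "0 < e" unfolding e_def by (intro add_pos_nonneg) auto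
    show "e < 1/2" using R by (cases "r = \<infinity>") (auto simp: e_def field_simps)
    show "enn2real r > 0 \<and> e * enn2real r > 1" if "r \<noteq> \<infinity>" using R[OF that] by (auto simp: e_def field_simps)
  qed
  obtain M where M: "profile M \<psi>" by (rule schwartz_profile[OF \<psi>])
  obtain C where C: "C \<ge> 0"
    "\<And>A \<sigma> \<Theta> d. modulation A \<sigma> \<Theta> \<Longrightarrow> A \<le> d \<Longrightarrow> (\<And>q. 2 powr (real q / 2) * \<sigma> q \<le> d * (real q + 1) powr (- e)) \<Longrightarrow>
      besov_norm chi s p r (field_distr (\<lambda>x. \<Theta> (x$1) *\<^sub>R \<psi> x)) \<le> ennreal (C * d)"
    using besov_norm_modulated[OF chi M p s e(1) er] by blast
  obtain E where E: "E \<ge> 0"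
    "\<And>n q. 2 powr (real q / 2) * oscillation_sum (coef_tail n) q \<le> E * (real n + 1) powr (e - 1/2) * (real q + 1) powr (- e)"
    using oscillation_coef_tail[OF e] by blast
  have tail: "besov_norm chi s p r (field_distr (\<lambda>x. (\<Sum>k. coef_tail n k * c' (2 ^ k * x $ 1)) *\<^sub>R \<psi> x))
     \<le> ennreal (C * (2 * E * (real n + 1) powr (e - 1/2)))" if "unit_wave c'" for n c'
  proof (rule C(2)[OF modulation_series[OF coef_tail_nonneg summable_coef_tail that]])
    \<comment> \<open>At scale 1 every mode counts fully, so the case q = 0 of the oscillation bound
      also controls the amplitude.\<close>
    have "suminf (coef_tail n) = oscillation_sum (coef_tail n) 0" by (simp add: oscillation_sum_def)
    also have "\<dots> \<le> E * (real n + 1) powr (e - 1/2)" using E(2)[of 0 n] by simp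
    also have "\<dots> \<le> 2 * E * (real n + 1) powr (e - 1/2)" using E(1) by simp
    finally show "suminf (coef_tail n) \<le> 2 * E * (real n + 1) powr (e - 1/2)" .
    show "2 powr (real q / 2) * (2 * oscillation_sum (coef_tail n) q) \<le> 2 * E * (real n + 1) powr (e - 1/2) * (real q + 1) powr (- e)" for q
      using E(2)[of q n] by simp
  qed
  have c': "unit_wave (\<lambda>t. - c t)" using c by (auto simp: unit_wave_def abs_minus_commute)
  note \<Theta> = modulation_series[OF less_imp_le[OF coef_pos] summable_coef c]
  have I: "integrable lborel (wave_series c \<psi>)"
    unfolding wave_series_def[abs_def] by (rule integrable_modulated_profile[OF M \<Theta>])
  have "besov_norm chi s p r (field_distr (wave_series c \<psi>)) < \<infinity>"
    using tail[OF c, of 0] by (auto simp: coef_tail_0 wave_series_def[abs_def] le_less_trans)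
  then show ?S
    by (simp add: besov_space_def tempered_field_distr[OF I] real_field_distr[OF I])
  have D: "besov_norm chi s p r (\<lambda>f. field_distr (wave_sum c \<psi> n) f - field_distr (wave_series c \<psi>) f)
     \<le> ennreal (C * (2 * E * (real n + 1) powr (e - 1/2)))" for n
  proof -
    have d: "(\<lambda>x. wave_sum c \<psi> n x - wave_series c \<psi> x) = (\<lambda>x. (\<Sum>k. coef_tail n k * (- c (2 ^ k * x $ 1))) *\<^sub>R \<psi> x)"
      by (rule ext) (rule wave_sum_minus_series[OF c])
    have "integrable lborel (\<lambda>x. wave_sum c \<psi> n x - wave_series c \<psi> x)"
      unfolding d by (rule integrable_modulated_profile[OF M modulation_series[OF coef_tail_nonneg summable_coef_tail c']])
    from Bochner_Integration.integrable_add[OF this I] have J: "integrable lborel (wave_sum c \<psi> n)" by simp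
    have "besov_norm chi s p r (\<lambda>f. field_distr (wave_sum c \<psi> n) f - field_distr (wave_series c \<psi>) f) =
      besov_norm chi s p r (field_distr (\<lambda>x. wave_sum c \<psi> n x - wave_series c \<psi> x))"
      by (rule besov_norm_cong[OF _ chi]) (rule field_distr_diff[OF J I, symmetric])
    then show ?thesis unfolding d using tail[OF c', of n] by simp
  qed
  have "(\<lambda>n. (real n + 1) powr (e - 1/2)) \<longlonglongrightarrow> 0"
    using e by (intro tendsto_neg_powr) (auto intro!: filterlim_tendsto_add_at_top filterlim_real_sequentially simp: add.commute)
  then have "(\<lambda>n. C * (2 * E * (real n + 1) powr (e - 1/2))) \<longlonglongrightarrow> C * (2 * E * 0)" by (intro tendsto_intros)
  then have "(\<lambda>n. ennreal (C * (2 * E * (real n + 1) powr (e - 1/2)))) \<longlonglongrightarrow> 0"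
    using tendsto_ennrealI by fastforce
  then show ?L
    unfolding besov_lim_def
    by (intro tendsto_sandwich[OF _ always_eventually[OF allI[OF D]] tendsto_const]) auto
qed

section \<open>The counterexample\<close>

lemma trig_poly_wave_sum:
  assumes c: "\<And>\<mu>. trig_poly (\<lambda>x. c (\<mu> * x $ 1) *\<^sub>R g x)"
  shows "trig_poly (\<lambda>x. (\<Sum>k<n. b k * c (2 ^ k * x $ 1)) *\<^sub>R g x)"
proof (induction n)
  case (Suc n)
  then show ?case
    using trig_poly.add[OF Suc trig_poly.scale[OF c[of "2 ^ n"], of "b n"]] by (simp add: scaleR_add_left)
qed (simp add: trig_poly.const)

text \<open>The exponent \<open>1/6\<close> makes the product of three bumps the standard Gaussian.\<close>

definition bump :: "real^3 \<Rightarrow> real"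
  where "bump x = exp (- (1/6 * (x \<bullet> x)))"

text \<open>A Gaussian-damped rigid rotation about the third axis. Its first component transports
  \<open>v\<close> along the direction in which \<open>v\<close> oscillates.\<close>

definition amp_u :: "real^3 \<Rightarrow> real^3"
  where "amp_u x = bump x *\<^sub>R (x $ 2 *\<^sub>R axis 1 1 + x $ 1 *\<^sub>R (- axis 2 1))"

definition amp_v :: "real^3 \<Rightarrow> real^3"
  where "amp_v x = bump x *\<^sub>R axis 3 1"

text \<open>Curl of a multiple of \<open>bump x *\<^sub>R axis 1 1\<close>, so that modulation in the first variable keeps it
  divergence free.\<close>

definition amp_w :: "real^3 \<Rightarrow> real^3"
  where "amp_w x = bump x *\<^sub>R (x $ 2 *\<^sub>R axis 3 1 + x $ 3 *\<^sub>R (- axis 2 1))"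

abbreviation field_u :: "nat \<Rightarrow> real^3 \<Rightarrow> real^3" where "field_u \<equiv> wave_sum (\<lambda>_. 1) amp_u"
abbreviation field_v :: "nat \<Rightarrow> real^3 \<Rightarrow> real^3" where "field_v \<equiv> wave_sum sin amp_v"
abbreviation field_w :: "nat \<Rightarrow> real^3 \<Rightarrow> real^3" where "field_w \<equiv> wave_sum cos amp_w"

lemma unit_waves: "unit_wave (\<lambda>_. 1)" "unit_wave sin" "unit_wave cos"
proof -
  have s: "\<bar>sin t - sin t'\<bar> \<le> \<bar>t - t'\<bar>" and c: "\<bar>cos t - cos t'\<bar> \<le> \<bar>t - t'\<bar>" for t t' :: real
  proof -
    have "norm (sin t - sin t') \<le> 1 * norm (t - t')"
      by (rule field_differentiable_bound[of UNIV sin cos]) (auto intro!: derivative_eq_intros)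
    then show "\<bar>sin t - sin t'\<bar> \<le> \<bar>t - t'\<bar>" by simp
    have "norm (cos t - cos t') \<le> 1 * norm (t - t')"
      by (rule field_differentiable_bound[of UNIV cos "\<lambda>x. - sin x"]) (auto intro!: derivative_eq_intros)
    then show "\<bar>cos t - cos t'\<bar> \<le> \<bar>t - t'\<bar>" by simp
  qed
  show "unit_wave (\<lambda>_. 1)" "unit_wave sin" "unit_wave cos"
    unfolding unit_wave_def using s c by auto
qed

lemma schwartz_bump_mult: "trig_poly g \<Longrightarrow> schwartz (\<lambda>x. bump x *\<^sub>R g x)"
  unfolding bump_def by (rule schwartz_gaussian_trig_poly) auto

lemma trig_poly_amps:
  "trig_poly (\<lambda>x. x $ 2 *\<^sub>R axis 1 1 + x $ 1 *\<^sub>R (- axis 2 1 :: real^3))"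
  "trig_poly (\<lambda>x. x $ 2 *\<^sub>R axis 3 1 + x $ 3 *\<^sub>R (- axis 2 1 :: real^3))"
  by (intro trig_poly.add trig_poly.coord trig_poly.const)+

lemma schwartz_amps: "schwartz amp_u" "schwartz amp_v" "schwartz amp_w"
  unfolding amp_u_def[abs_def] amp_v_def[abs_def] amp_w_def[abs_def]
  by (intro schwartz_bump_mult trig_poly_amps trig_poly.const)+

lemma wave_sum_bump:
  "wave_sum c (\<lambda>x. bump x *\<^sub>R g x) n = (\<lambda>x. bump x *\<^sub>R ((\<Sum>k<n. coef k * c (2 ^ k * x $ 1)) *\<^sub>R g x))"
  by (simp add: wave_sum_def fun_eq_iff mult.commute)

lemma schwartz_fields: "schwartz (field_u n)" "schwartz (field_v n)" "schwartz (field_w n)"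
proof -
  show "schwartz (field_u n)"
    unfolding amp_u_def[abs_def] wave_sum_bump
    by (intro schwartz_bump_mult trig_poly_wave_sum) (simp only: scaleR_one trig_poly_amps)
  show "schwartz (field_v n)"
    unfolding amp_v_def[abs_def] wave_sum_bump
    by (intro schwartz_bump_mult trig_poly_wave_sum trig_poly.sin trig_poly.const)
  show "schwartz (field_w n)"
    unfolding amp_w_def[abs_def] wave_sum_bump
    by (intro schwartz_bump_mult trig_poly_wave_sum trig_poly.cos trig_poly_amps)
qed

lemma has_derivative_component_real [derivative_intros]:
  "(f has_derivative f') F \<Longrightarrow> ((\<lambda>x. (f x :: real^3) $ i) has_derivative (\<lambda>h. f' h $ i)) F"
  by (rule bounded_linear.has_derivative[OF bounded_linear_vec_nth])

lemma partial_bump_mult: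
  fixes g :: "real^3 \<Rightarrow> real^3"
  assumes "(g has_derivative g') (at x)"
  shows "partial i (\<lambda>x. bump x *\<^sub>R g x) x = bump x *\<^sub>R (g' (axis i 1) - (1/3 * x $ i) *\<^sub>R g x)"
  using partial_gaussian_mult[OF assms, of i "1/6"] by (simp add: bump_def)

text \<open>The linear field has trace zero, and it is orthogonal to \<open>x\<close>, the direction
  of the gradient of the Gaussian.\<close>

lemma divergence_u: "divergence (field_u n) x = 0"
proof -
  let ?a = "\<Sum>k<n. coef k * 1"
  have d: "((\<lambda>x. ?a *\<^sub>R (x $ 2 *\<^sub>R axis 1 1 + x $ 1 *\<^sub>R (- axis 2 1 :: real^3))) has_derivative
     (\<lambda>h. ?a *\<^sub>R (h $ 2 *\<^sub>R axis 1 1 + h $ 1 *\<^sub>R (- axis 2 1)))) (at x)"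
    by (auto intro!: derivative_eq_intros)
  show ?thesis
    unfolding divergence_def amp_u_def[abs_def] wave_sum_bump partial_bump_mult[OF d]
    by (simp add: sum_3 axis_def)
qed

lemma wave_derivative:
  "((\<lambda>x::real^3. \<Sum>k<n. coef k * sin (2 ^ k * x $ 1)) has_derivative (\<lambda>h. (\<Sum>k<n. coef k * 2 ^ k * cos (2 ^ k * x $ 1)) * h $ 1)) (at x)"
  "((\<lambda>x::real^3. \<Sum>k<n. coef k * cos (2 ^ k * x $ 1)) has_derivative (\<lambda>h. (\<Sum>k<n. - coef k * 2 ^ k * sin (2 ^ k * x $ 1)) * h $ 1)) (at x)"
  by (auto intro!: derivative_eq_intros simp: sum_distrib_left mult_ac fun_eq_iff)

text \<open>The cosine factor varies only along the first axis, where the amplitude has no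
  component; the linear part is a rotation about that axis, to which the radial Gaussian adds
  nothing.\<close>

lemma divergence_w: "divergence (field_w n) x = 0"
proof -
  let ?P = "\<lambda>x::real^3. \<Sum>k<n. coef k * cos (2 ^ k * x $ 1)"
  let ?Q = "\<Sum>k<n. - coef k * 2 ^ k * sin (2 ^ k * x $ 1)"
  have a: "((\<lambda>x. x $ 2 *\<^sub>R axis 3 1 + x $ 3 *\<^sub>R (- axis 2 1 :: real^3)) has_derivative
     (\<lambda>h. h $ 2 *\<^sub>R axis 3 1 + h $ 3 *\<^sub>R (- axis 2 1))) (at x)"
    by (auto intro!: derivative_eq_intros)
  note d = has_derivative_scaleR[OF wave_derivative(2)[of n x] a]
  show ?thesis
    unfolding divergence_def amp_w_def[abs_def] wave_sum_bump partial_bump_mult[OF d]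
    by (simp add: sum_3 axis_def)
qed

text \<open>The amplitude of \<open>u\<close> is tangential to the level sets of the Gaussian, so only the oscillating
  factor of \<open>v\<close> is differentiated.\<close>

lemma advect_uv:
  "advect (field_u n) (field_v n) x = exp (- (1/3 * (x \<bullet> x))) *\<^sub>R
    ((\<Sum>k<n. coef k * 2 ^ k * cos (2 ^ k * x $ 1)) *\<^sub>R (x $ 2 *\<^sub>R ((\<Sum>k<n. coef k) *\<^sub>R axis 3 1)))"
proof -
  let ?S' = "\<Sum>k<n. coef k * 2 ^ k * cos (2 ^ k * x $ 1)"
  have d: "((\<lambda>x. (\<Sum>k<n. coef k * sin (2 ^ k * x $ 1)) *\<^sub>R (axis 3 1 :: real^3)) has_derivative
     (\<lambda>h. (?S' * h $ 1) *\<^sub>R axis 3 1)) (at x)"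
    by (rule has_derivative_scaleR_left[OF wave_derivative(1)])
  have bb: "bump x * bump x = exp (- (1/3 * (x \<bullet> x)))"
    by (simp add: bump_def flip: exp_add)
  have 1: "partial j (field_v n) x = bump x *\<^sub>R ((?S' * axis j 1 $ 1) *\<^sub>R axis 3 1 - (1/3 * x $ j) *\<^sub>R ((\<Sum>k<n. coef k * sin (2 ^ k * x $ 1)) *\<^sub>R axis 3 1))" for j
    unfolding amp_v_def[abs_def] wave_sum_bump partial_bump_mult[OF d] ..
  have "advect (field_u n) (field_v n) x = (bump x * bump x) *\<^sub>R (?S' *\<^sub>R (x $ 2 *\<^sub>R ((\<Sum>k<n. coef k) *\<^sub>R axis 3 1)))"
    unfolding advect_def 1
    by (simp add: sum_3 wave_sum_def amp_u_def vec_eq_iff forall_3 axis_def algebra_simps)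
  then show ?thesis unfolding bb .
qed

lemma schwartz_advect_uv: "schwartz (advect (field_u n) (field_v n))"
proof -
  have "schwartz (\<lambda>x. exp (- (1/3 * (x \<bullet> x))) *\<^sub>R
    ((\<Sum>k<n. (coef k * 2 ^ k) * cos (2 ^ k * x $ 1)) *\<^sub>R (x $ 2 *\<^sub>R ((\<Sum>k<n. coef k) *\<^sub>R (axis 3 1 :: real^3)))))"
    by (intro schwartz_gaussian_trig_poly trig_poly_wave_sum trig_poly.cos trig_poly.coord trig_poly.const) auto
  then show ?thesis by (simp add: advect_uv[abs_def])
qed

section \<open>Gaussian integrals behind the trilinear form\<close>

lemma
  shows integral_gauss_cos: "(\<integral>x. cos (t * x) * exp (- x\<^sup>2 / 2) \<partial>lborel) = sqrt (2 * pi) * exp (- t\<^sup>2 / 2)"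
    and integrable_gauss_cos: "integrable lborel (\<lambda>x. cos (t * x) * exp (- x\<^sup>2 / 2))"
proof -
  have *: "cos (t * x) * exp (- x\<^sup>2 / 2) = Re (cis (t * x) * of_real (exp (- x\<^sup>2 / 2)))" for x by simp
  show "integrable lborel (\<lambda>x. cos (t * x) * exp (- x\<^sup>2 / 2))"
    unfolding * by (rule integrable_Re[OF integrable_gauss_cis])
  show "(\<integral>x. cos (t * x) * exp (- x\<^sup>2 / 2) \<partial>lborel) = sqrt (2 * pi) * exp (- t\<^sup>2 / 2)"
    unfolding * integral_Re[OF integrable_gauss_cis] integral_gauss_cis by simp
qed

lemma
  shows integral_gauss_square: "(\<integral>x. x\<^sup>2 * exp (- x\<^sup>2 / 2) \<partial>lborel) = sqrt (2 * pi)"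
    and integrable_gauss_square: "integrable lborel (\<lambda>x::real. x\<^sup>2 * exp (- x\<^sup>2 / 2))"
proof -
  have "has_bochner_integral lborel (\<lambda>x. std_normal_density x * x ^ (2 * 1)) (fact (2 * 1) / (2 ^ 1 * fact 1))"
    by (rule std_normal_moment_even)
  then have "has_bochner_integral lborel (\<lambda>x. sqrt (2 * pi) * (std_normal_density x * x\<^sup>2)) (sqrt (2 * pi) * 1)"
    by (intro has_bochner_integral_mult_right) simp
  moreover have "sqrt (2 * pi) * (std_normal_density x * x\<^sup>2) = x\<^sup>2 * exp (- x\<^sup>2 / 2)" for x
    by (simp add: std_normal_density_def)
  ultimately have "has_bochner_integral lborel (\<lambda>x::real. x\<^sup>2 * exp (- x\<^sup>2 / 2)) (sqrt (2 * pi))" by simp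
  then show "(\<integral>x. x\<^sup>2 * exp (- x\<^sup>2 / 2) \<partial>lborel) = sqrt (2 * pi)" "integrable lborel (\<lambda>x::real. x\<^sup>2 * exp (- x\<^sup>2 / 2))"
    by (auto simp: has_bochner_integral_iff)
qed

definition cos_product :: "real \<Rightarrow> real \<Rightarrow> real^3 \<Rightarrow> real"
  where "cos_product \<mu> \<nu> x = (x $ 2)\<^sup>2 * exp (- (1/2 * (x \<bullet> x))) * (cos (\<mu> * x $ 1) * cos (\<nu> * x $ 1))"

text \<open>The product-to-sum formula turns the two cosines into frequencies \<mu> - \<nu> and
  \<mu> + \<nu>, at which the one-dimensional Gaussian transform is explicit. The second moment in
  x_2 and the mass in x_3 each give \<open>sqrt (2 * pi)\<close>.\<close>

lemma
  shows integral_cos_product: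
      "(\<integral>x. cos_product \<mu> \<nu> x \<partial>lborel) = sqrt (2 * pi) ^ 3 / 2 * (exp (- (\<mu> - \<nu>)\<^sup>2 / 2) + exp (- (\<mu> + \<nu>)\<^sup>2 / 2))"
    and integrable_cos_product: "integrable lborel (cos_product \<mu> \<nu>)"
proof -
  let ?f = "\<lambda>t x::real. cos (t * x) * exp (- x\<^sup>2 / 2)"
  let ?g = "\<lambda>x::real. (?f (\<mu> - \<nu>) x + ?f (\<mu> + \<nu>) x) / 2"
  have "(\<integral>x. ?g x \<partial>lborel) = ((\<integral>x. ?f (\<mu> - \<nu>) x \<partial>lborel) + (\<integral>x. ?f (\<mu> + \<nu>) x \<partial>lborel)) / 2"
    using integrable_gauss_cos[of "\<mu> - \<nu>"] integrable_gauss_cos[of "\<mu> + \<nu>"] by simp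
  then have g: "integrable lborel ?g" "(\<integral>x. ?g x \<partial>lborel) = sqrt (2 * pi) / 2 * (exp (- (\<mu> - \<nu>)\<^sup>2 / 2) + exp (- (\<mu> + \<nu>)\<^sup>2 / 2))"
    using integrable_gauss_cos[of "\<mu> - \<nu>"] integrable_gauss_cos[of "\<mu> + \<nu>"]
    unfolding integral_gauss_cos by (auto simp: distrib_left)
  have h: "integrable lborel (\<lambda>x::real. exp (- x\<^sup>2 / 2))" "(\<integral>x. exp (- (x::real)\<^sup>2 / 2) \<partial>lborel) = sqrt (2 * pi)"
    using integrable_gauss_cos[of 0] integral_gauss_cos[of 0] by auto
  have eq: "cos_product \<mu> \<nu> x = ?g (x $ 1) * ((x $ 2)\<^sup>2 * exp (- (x $ 2)\<^sup>2 / 2)) * exp (- (x $ 3)\<^sup>2 / 2)" for x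
  proof -
    have "exp (- (1/2 * (x \<bullet> x))) = exp (- (x $ 1)\<^sup>2 / 2) * exp (- (x $ 2)\<^sup>2 / 2) * exp (- (x $ 3)\<^sup>2 / 2)"
      unfolding exp_add[symmetric] by (simp add: inner_3 power2_eq_square field_simps)
    moreover have "cos (\<mu> * x $ 1) * cos (\<nu> * x $ 1) = (cos ((\<mu> - \<nu>) * x $ 1) + cos ((\<mu> + \<nu>) * x $ 1)) / 2"
      by (simp add: cos_times_cos left_diff_distrib distrib_right)
    ultimately show ?thesis unfolding cos_product_def by (simp only:) (simp add: field_simps)
  qed
  show "integrable lborel (cos_product \<mu> \<nu>)"
    unfolding eq[abs_def] by (intro integrable_prod3 g h integrable_gauss_square)
  show "(\<integral>x. cos_product \<mu> \<nu> x \<partial>lborel) = sqrt (2 * pi) ^ 3 / 2 * (exp (- (\<mu> - \<nu>)\<^sup>2 / 2) + exp (- (\<mu> + \<nu>)\<^sup>2 / 2))"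
    unfolding eq integral_prod3[OF g(1) integrable_gauss_square h(1)] g(2) h(2) integral_gauss_square
    by (simp add: power3_eq_cube)
qed

text \<open>The Fourier transform of the Gaussian is positive, so the off-diagonal terms can be dropped.\<close>

lemma pairing_lower_bound:
  assumes n: "n \<ge> 1"
  shows "pairing (euler_B (field_u n) (field_v n)) (field_w n) \<ge> sqrt (2 * pi) ^ 3 / 2 * harm n"
proof -
  let ?A = "\<Sum>k<n. coef k"
  let ?I = "\<lambda>k l. \<integral>x. cos_product (2 ^ k) (2 ^ l) x \<partial>lborel"
  have I0: "?I k l \<ge> 0" for k l by (simp add: integral_cos_product)
  have Id: "?I k k \<ge> sqrt (2 * pi) ^ 3 / 2" for k :: nat
    unfolding integral_cos_product by (subst mult_le_cancel_left1) (simp add: add_increasing2)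
  \<comment> \<open>This scalar comes from the partial sums for \<open>u\<close>. Since n \<ge> 1,
    it contains the term \<open>coef 0 = 1\<close>, and the other terms are positive.\<close>
  have A: "?A \<ge> 1"
  proof -
    have "coef 0 \<le> ?A" using n coef_pos by (intro member_le_sum) (auto simp: less_imp_le)
    then show ?thesis by (simp add: coef_def)
  qed
  have eq: "advect (field_u n) (field_v n) x \<bullet> field_w n x =
     ?A * (\<Sum>k<n. \<Sum>l<n. (coef k * 2 ^ k * coef l) * cos_product (2 ^ k) (2 ^ l) x)" for x
  proof -
    have b: "exp (- (1/3 * (x \<bullet> x))) * bump x = exp (- (1/2 * (x \<bullet> x)))"
      by (simp add: bump_def flip: exp_add)
    have "advect (field_u n) (field_v n) x \<bullet> field_w n x =
      ?A * ((x $ 2)\<^sup>2 * (exp (- (1/3 * (x \<bullet> x))) * bump x) * ((\<Sum>k<n. coef k * 2 ^ k * cos (2 ^ k * x $ 1)) * (\<Sum>l<n. coef l * cos (2 ^ l * x $ 1))))"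
      unfolding advect_uv by (simp add: inner_3 wave_sum_def amp_w_def axis_def power2_eq_square)
    also have "\<dots> = ?A * (\<Sum>k<n. \<Sum>l<n. (coef k * 2 ^ k * coef l) * cos_product (2 ^ k) (2 ^ l) x)"
      unfolding b
      by (intro arg_cong[where f="(*) ?A"]) (simp add: sum_product cos_product_def sum_distrib_left mult_ac)
    finally show ?thesis .
  qed
  have "pairing (euler_B (field_u n) (field_v n)) (field_w n) = pairing (advect (field_u n) (field_v n)) (field_w n)"
    unfolding euler_B_def by (intro pairing_leray_divergence_free schwartz_advect_uv schwartz_fields divergence_w)
  also have "\<dots> = ?A * (\<Sum>k<n. \<Sum>l<n. (coef k * 2 ^ k * coef l) * ?I k l)"
    unfolding pairing_def eq by (simp add: Bochner_Integration.integral_sum integrable_cos_product)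
  also have "\<dots> \<ge> 1 * (\<Sum>k<n. sqrt (2 * pi) ^ 3 / 2 * inverse (real (Suc k)))"
  proof (intro mult_mono A sum_mono)
    fix k assume k: "k \<in> {..<n}"
    \<comment> \<open>The powers of 2 cancel, half against each coefficient, and the two factors
      (k+1)^(-1/2) combine to the harmonic term.\<close>
    have "coef k * 2 ^ k * coef k = inverse (real (Suc k))"
    proof -
      have "coef k * 2 ^ k * coef k = (2 powr (- real k / 2) * 2 powr (- real k / 2) * 2 powr real k) * ((real k + 1) powr (- 1/2) * (real k + 1) powr (- 1/2))"
        by (simp add: coef_def powr_realpow)
      also have "\<dots> = inverse (real (Suc k))"
        unfolding powr_add[symmetric] by (simp add: powr_minus add.commute)
      finally show ?thesis .
    qed
    then have "sqrt (2 * pi) ^ 3 / 2 * inverse (real (Suc k)) \<le> (coef k * 2 ^ k * coef k) * ?I k k"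
      using Id[of k] by (subst mult.commute) (simp add: mult_left_mono)
    also have "\<dots> \<le> (\<Sum>l<n. (coef k * 2 ^ k * coef l) * ?I k l)"
      using k coef_pos I0 by (intro member_le_sum) (auto simp: less_imp_le intro!: mult_nonneg_nonneg)
    finally show "sqrt (2 * pi) ^ 3 / 2 * inverse (real (Suc k)) \<le> (\<Sum>l<n. (coef k * 2 ^ k * coef l) * ?I k l)" .
  qed (use A in \<open>auto intro!: sum_nonneg\<close>)
  also have "1 * (\<Sum>k<n. sqrt (2 * pi) ^ 3 / 2 * inverse (real (Suc k))) = sqrt (2 * pi) ^ 3 / 2 * harm n"
    by (simp add: harm_def sum_distrib_left sum.atLeast1_atMost_eq)
  finally show ?thesis .
qed

theorem proposition5p2:
  fixes chi :: "real^3 \<Rightarrow> real" and s p :: real and r :: ennreal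
  assumes "lp_cutoff chi"
    and "0 \<le> s" and "s \<le> 1/2" and "1 < p" and "2 < r"
  shows "\<exists>u \<in> besov_space chi s p r. \<exists>v \<in> besov_space chi s p r. \<exists>w \<in> besov_space chi s p r.
    \<exists>un vn wn :: nat \<Rightarrow> real^3 \<Rightarrow> real^3.
      (\<forall>n. schwartz (un n) \<and> schwartz (vn n) \<and> schwartz (wn n)) \<and>
      (\<forall>n x. divergence (un n) x = 0) \<and>
      besov_lim chi s p r un u \<and> besov_lim chi s p r vn v \<and> besov_lim chi s p r wn w \<and>
      filterlim (\<lambda>n. pairing (euler_B (un n) (vn n)) (wn n)) at_top sequentially"
proof -
  note B = wave_series_besov[OF assms]
  have "filterlim (\<lambda>n. sqrt (2 * pi) ^ 3 / 2 * harm n) at_top sequentially"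
    by (rule filterlim_tendsto_pos_mult_at_top[OF tendsto_const _ harm_at_top]) simp
  then have "filterlim (\<lambda>n. pairing (euler_B (field_u n) (field_v n)) (field_w n)) at_top sequentially"
    by (rule filterlim_at_top_mono) (rule eventually_mono[OF eventually_ge_at_top[of 1] pairing_lower_bound])
  then show ?thesis
    using B[OF schwartz_amps(1) unit_waves(1)] B[OF schwartz_amps(2) unit_waves(2)] B[OF schwartz_amps(3) unit_waves(3)]
      schwartz_fields divergence_u by blast
qed

end
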